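(* Let $d\ge 0$ be an integer, let $F\in Q_d$ be a homogeneous real bivariate form of degree $d$, and fix an integer $i$ with $0\leq i\leq \lfloor d/2\rfloor$. The following are equivalent. (1) $F$ is $i$-Lorentzian. (2) The Toeplitz matrix $\phi^i_d(F)$ is strongly totally nonnegative. (3) The algebra $A_F$ satisfies mixed HRR$_i$ on the standard open convex cone of linear forms $U=\{ax+by \mid (a,b)\in\mathbb{R}^2_{>0}\}$.
   Context: $Q=\mathbb{R}[X,Y]$ with its standard grading, $Q_d$ is the space of forms of degree $d$ (with the Euclidean topology of $\mathbb{R}^{d+1}$). $R=\mathbb{R}[x,y]$ acts on $Q$ by differentiation: $x\circ F=\partial F/\partial X$, $y\circ F=\partial F/\partial Y$. For $F\in Q_d$, $\operatorname{Ann}(F)=\{\alpha\in R\mid \alpha\circ F=0\}$ and $A_F=R/\operatorname{Ann}(F)$, a graded Artinian Gorenstein algebra, oriented by the linear map $\int_F:(A_F)_d\to\mathbb{R}$, $\int_F\alpha=\alpha\circ F$. Linear forms in $R_1$ are also regarded as elements of $A_F$. Toeplitz matrices: write $F=\sum_{k=0}^d\binom{d}{k}c_kX^kY^{d-k}$. For $0\le j\le\lfloor d/2\rfloor$ the $j$-th Toeplitz matrix of $F$ is the $(j+1)\times(d-j+1)$ matrix $\phi^j_d(F)=(c_{j+q-p})_{0\leq p\leq j,\ 0\leq q\leq d-j}$. A matrix is totally nonnegative if all its minors (of all sizes) are $\geq 0$. The matrix $\phi^i_d(F)$ is strongly totally nonnegative if $\phi^j_d(F)$ is totally nonnegative for every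 $j$ with $0\leq j\leq i$. $i$-Lorentzian: $F\in Q_d$ is strictly $i$-Lorentzian if for every $j$ with $0\le j\le i$ and all integers $a,b\ge0$ with $a+b=d-2j$, one has $\det\big((x^{a+j-p+q}\,y^{b+j+p-q})\circ F\big)_{0\le p,q\le j}>0$ (equivalently, the $j$-th Hessian matrix $\big((x^py^{j-p}\cdot x^qy^{j-q})\circ G\big)_{0\le p,q\le j}$ of each partial derivative $G=x^ay^b\circ F$ of degree $2j$ has determinant of sign $(-1)^{\lfloor (j+1)/2\rfloor}$). $F$ is $i$-Lorentzian if it is a limit in $Q_d$ of a sequence of strictly $i$-Lorentzian polynomials of degree $d$. Mixed HRR$_i$ on $U$: $A_F$ satisfies the mixed Hodge–Riemann relations up to degree $i$ on $U$ if for every sequence $(\ell_0,\ell_1,\ldots,\ell_d)\in U^{d+1}$, every $j$ with $0\leq j\leq i$, and every nonzero $\alpha\in (A_F)_j$ that is primitive, i.e. $\ell_0\ell_1\cdots\ell_{d-2j}\,\alpha=0$ in $A_F$, one has $(-1)^j\int_F \ell_1\cdots\ell_{d-2j}\,\alpha^2>0$ (the empty product being $1$). *)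

theory Defs
  imports
    "HOL-Algebra.QuotRing"
    "HOL-Analysis.L2_Norm"
    "Jordan_Normal_Form.Determinant"
    "Jordan_Normal_Form.DL_Submatrix"
begin

text \<open>
  Both $Q = \mathbb{R}[X,Y]$ and $R = \mathbb{R}[x,y]$ are modelled by the type of
  polynomials in the first variable whose coefficients are polynomials in the second
  variable: the coefficient of $X^m Y^n$ in \<open>F\<close> is \<open>coeff (coeff F m) n\<close>.
\<close>

type_synonym bipoly = "real poly poly"

definition var_x :: bipoly where
  "var_x = [:0, 1:]"

definition var_y :: bipoly where
  "var_y = [:[:0, 1:]:]"

definition const :: "real \<Rightarrow> bipoly" where
  "const c = [:[:c:]:]"

definition forms :: "nat \<Rightarrow> bipoly set" where
  "forms d = {F. \<forall>m n. coeff (coeff F m) n \<noteq> 0 \<longrightarrow> m + n = d}"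

definition dX :: "bipoly \<Rightarrow> bipoly" where
  "dX F = pderiv F"

definition dY :: "bipoly \<Rightarrow> bipoly" where
  "dY F = map_poly pderiv F"

text \<open>The action $\alpha \circ F$ of $R$ on $Q$ by constant coefficient differential operators.\<close>

definition act :: "bipoly \<Rightarrow> bipoly \<Rightarrow> bipoly" where
  "act \<alpha> F = (\<Sum>m\<le>degree \<alpha>. \<Sum>n\<le>degree (coeff \<alpha> m).
     const (coeff (coeff \<alpha> m) n) * (dX ^^ m) ((dY ^^ n) F))"

definition const_val :: "bipoly \<Rightarrow> real" where
  "const_val G = coeff (coeff G 0) 0"

definition R_ring :: "bipoly ring" where
  "R_ring = \<lparr>carrier = UNIV, monoid.mult = (*), one = 1, zero = 0, add = (+)\<rparr>"

definition Ann :: "bipoly \<Rightarrow> bipoly set" where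
  "Ann F = {\<alpha>. act \<alpha> F = 0}"

definition A_alg :: "bipoly \<Rightarrow> bipoly set ring" where
  "A_alg F = R_ring Quot Ann F"

definition cls :: "bipoly \<Rightarrow> bipoly \<Rightarrow> bipoly set" where
  "cls F \<alpha> = Ann F +>\<^bsub>R_ring\<^esub> \<alpha>"

definition A_graded :: "bipoly \<Rightarrow> nat \<Rightarrow> bipoly set set" where
  "A_graded F k = cls F ` forms k"

text \<open>The orientation $\int_F$, meaningful on \<open>A_graded F d\<close> for \<open>F \<in> forms d\<close>: there every
  representative \<open>\<alpha> \<in> forms d\<close> of a given class yields the same constant \<open>act \<alpha> F\<close>.\<close>

definition A_integral :: "nat \<Rightarrow> bipoly \<Rightarrow> bipoly set \<Rightarrow> real" where
  "A_integral d F a = (THE c. \<exists>\<alpha>\<in>forms d. cls F \<alpha> = a \<and> act \<alpha> F = const c)"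

definition pos_cone :: "bipoly set" where
  "pos_cone = {const a * var_x + const b * var_y | a b. a > 0 \<and> b > 0}"

text \<open>Only the values \<open>L 0, \<dots>, L d\<close> of the sequence are relevant.\<close>

definition mixed_HRR :: "nat \<Rightarrow> nat \<Rightarrow> bipoly \<Rightarrow> bipoly set \<Rightarrow> bool" where
  "mixed_HRR d i F U \<longleftrightarrow>
     (\<forall>L :: nat \<Rightarrow> bipoly. (\<forall>k\<le>d. L k \<in> U) \<longrightarrow>
       (\<forall>j\<le>i. \<forall>a\<in>A_graded F j.
          a \<noteq> \<zero>\<^bsub>A_alg F\<^esub> \<longrightarrow>
          cls F (\<Prod>k = 0..d - 2 * j. L k) \<otimes>\<^bsub>A_alg F\<^esub> a = \<zero>\<^bsub>A_alg F\<^esub> \<longrightarrow>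
          (-1) ^ j * A_integral d F
            (cls F (\<Prod>k = 1..d - 2 * j. L k) \<otimes>\<^bsub>A_alg F\<^esub> (a \<otimes>\<^bsub>A_alg F\<^esub> a)) > 0))"

text \<open>The normalized coefficient $c_k$ in $F = \sum_k \binom{d}{k} c_k X^k Y^{d-k}$.\<close>

definition norm_coeff :: "nat \<Rightarrow> bipoly \<Rightarrow> nat \<Rightarrow> real" where
  "norm_coeff d F k = coeff (coeff F k) (d - k) / real (d choose k)"

definition toeplitz :: "nat \<Rightarrow> nat \<Rightarrow> bipoly \<Rightarrow> real mat" where
  "toeplitz d j F = mat (j + 1) (d - j + 1) (\<lambda>(p, q). norm_coeff d F (j + q - p))"

definition totally_nonneg :: "real mat \<Rightarrow> bool" where
  "totally_nonneg A \<longleftrightarrow>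
     (\<forall>I J. I \<subseteq> {..<dim_row A} \<and> J \<subseteq> {..<dim_col A} \<and> card I = card J \<longrightarrow>
        det (submatrix A I J) \<ge> 0)"

definition strongly_totally_nonneg :: "nat \<Rightarrow> nat \<Rightarrow> bipoly \<Rightarrow> bool" where
  "strongly_totally_nonneg d i F \<longleftrightarrow> (\<forall>j\<le>i. totally_nonneg (toeplitz d j F))"

text \<open>In the range \<open>p, q \<le> j\<close> the truncated subtractions in the exponents are exact, and the
  entries are forms of degree 0.\<close>

definition strictly_lorentzian :: "nat \<Rightarrow> nat \<Rightarrow> bipoly \<Rightarrow> bool" where
  "strictly_lorentzian d i F \<longleftrightarrow> F \<in> forms d \<and>
     (\<forall>j\<le>i. \<forall>a b. a + b + 2 * j = d \<longrightarrow>
        det (mat (j + 1) (j + 1) (\<lambda>(p, q).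
          const_val (act (var_x ^ (a + j + q - p) * var_y ^ (b + j + p - q)) F))) > 0)"

text \<open>The Euclidean distance on the space of forms of degree \<open>d\<close>, identified with
  $\mathbb{R}^{d+1}$ via the monomial basis.\<close>

definition form_dist :: "nat \<Rightarrow> bipoly \<Rightarrow> bipoly \<Rightarrow> real" where
  "form_dist d F G =
     L2_set (\<lambda>k. coeff (coeff F k) (d - k) - coeff (coeff G k) (d - k)) {..d}"

definition lorentzian :: "nat \<Rightarrow> nat \<Rightarrow> bipoly \<Rightarrow> bool" where
  "lorentzian d i F \<longleftrightarrow> F \<in> forms d \<and>
     (\<exists>G :: nat \<Rightarrow> bipoly. (\<forall>n. strictly_lorentzian d i (G n)) \<and>
        (\<lambda>n. form_dist d (G n) F) \<longlonglongrightarrow> 0)"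

end

theory Submission
  imports Defs
begin

text \<open>
  All three conditions depend only on the normalized coefficient sequence \<open>c\<close> of \<open>F\<close> and on the
  linear functional on binary forms of degree \<open>d\<close> that it defines.

  (1) implies (2): positivity of the contiguous minors gives positivity of all minors of the
  Toeplitz matrices (Fekete's criterion), and total nonnegativity is a closed condition.

  (2) implies (3): multiplication by a positive linear form preserves nonnegativity of column minors
  and the existence of a positive maximal one. Hence, as long as \<open>F\<close> has no annihilator of degree
  \<open>j\<close>, the square Toeplitz sections of \<open>M \<circ> F\<close> are nonsingular with nonnegative minors for every
  product \<open>M\<close> of positive linear forms, and Cramer's rule yields the sign on primitive elements.
  In degrees at least that of a minimal annihilator \<open>f\<close> there are no primitive elements, because
  \<open>f\<close> has no root on the negative axis.

  (3) implies (1): a small Moebius substitution moves the closed cone into the open one. The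
  cofactors of a row of a Toeplitz section then form a primitive element, on which the form is
  \<open>(-1) ^ j\<close> times the product of two consecutive sections; so all sections up to the degree of a
  minimal annihilator are positive. Adding small multiples of geometric sequences, with alternating
  signs, makes the remaining ones positive.
\<close>

section \<open>Determinants of matrices given by functions\<close>

text \<open>The relations in (3) hold on the open cone, whereas the determinants in (1) belong to
  the products \<open>x ^ a * y ^ b\<close> on its boundary; the substitution x -> x + e y, y -> e x
  + y bridges this gap. The obstacle is degeneracy. If f is an annihilator of minimal degree r,
  every section of size above r vanishes, so positivity there cannot be read off from (3) and has to
  be created. A geometric sequence is evaluation at a point t, a functional of rank one killed by x
  - t. Adding a small multiple of it trades f for (x - t) f, of degree one higher, which permits
  iteration. The sign of the multiple is forced: the cofactors of the top row are proportional to f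
  and the last of them has sign \<open>(-1) ^ r\<close>. For (2) implies (3), a negative root of f
  would split off a positive linear form, f = l q. Then q, of degree r - 1, would be killed by a
  product of positive linear forms, against the nonsingularity of the sections of degree r - 1. This
  is why f is coprime to l, and why primitive elements can be divided by f.\<close>

definition fdet :: "nat \<Rightarrow> (nat \<Rightarrow> nat \<Rightarrow> real) \<Rightarrow> real" where
  "fdet n A = det (mat n n (\<lambda>(p, q). A p q))"

lemma fdet_cong:
  assumes "\<And>p q. p < n \<Longrightarrow> q < n \<Longrightarrow> A p q = B p q"
  shows "fdet n A = fdet n B"
  unfolding fdet_def using assms by (intro arg_cong[where f = det] eq_matI) auto

lemma fdet_0 [simp]: "fdet 0 A = 1"
  unfolding fdet_def by (intro det_dim_zero) auto

lemma fdet_transpose: "fdet n (\<lambda>p q. A q p) = fdet n A"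
proof -
  have "mat n n (\<lambda>(p, q). A q p) = transpose_mat (mat n n (\<lambda>(p, q). A p q))"
    by (intro eq_matI) auto
  then show ?thesis
    unfolding fdet_def using det_transpose[of "mat n n (\<lambda>(p, q). A p q)" n] by simp
qed

lemma fdet_leibniz:
  "fdet n A = (\<Sum>\<pi>\<in>{\<pi>. \<pi> permutes {0..<n}}. signof \<pi> * (\<Prod>i = 0..<n. A i (\<pi> i)))"
proof -
  have "fdet n A = (\<Sum>\<pi>\<in>{\<pi>. \<pi> permutes {0..<n}}.
      signof \<pi> * (\<Prod>i = 0..<n. mat n n (\<lambda>(p, q). A p q) $$ (i, \<pi> i)))"
    unfolding fdet_def by (subst det_def') auto
  also have "\<dots> = (\<Sum>\<pi>\<in>{\<pi>. \<pi> permutes {0..<n}}. signof \<pi> * (\<Prod>i = 0..<n. A i (\<pi> i)))"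
  proof (intro sum.cong refl arg_cong2[where f = "(*)"] prod.cong)
    fix \<pi> i assume "\<pi> \<in> {\<pi>. \<pi> permutes {0..<n}}" "i \<in> {0..<n}"
    then show "mat n n (\<lambda>(p, q). A p q) $$ (i, \<pi> i) = A i (\<pi> i)"
      using permutes_in_image[of \<pi> "{0..<n}" i] by auto
  qed
  finally show ?thesis .
qed

lemma tendsto_fdet:
  assumes "\<And>p q. p < n \<Longrightarrow> q < n \<Longrightarrow> ((\<lambda>x. A x p q) \<longlongrightarrow> B p q) Fl"
  shows "((\<lambda>x. fdet n (A x)) \<longlongrightarrow> fdet n B) Fl"
  unfolding fdet_leibniz
proof (intro tendsto_sum tendsto_mult tendsto_const tendsto_prod)
  fix \<pi> i assume "\<pi> \<in> {\<pi>. \<pi> permutes {0..<n}}" "i \<in> {0..<n}"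
  then show "((\<lambda>x. A x i (\<pi> i)) \<longlongrightarrow> B i (\<pi> i)) Fl"
    using permutes_in_image[of \<pi> "{0..<n}" i] by (intro assms) auto
qed

lemma fdet_scale: "fdet n (\<lambda>p q. k * A p q) = k ^ n * fdet n A"
  unfolding fdet_leibniz by (simp add: prod.distrib sum_distrib_left mult.left_commute)

lemma fdet_identical_cols:
  assumes "k \<noteq> l" "k < n" "l < n" "\<And>p. p < n \<Longrightarrow> A p k = A p l"
  shows "fdet n A = 0"
  unfolding fdet_def
proof (rule det_identical_columns[where i = k and j = l])
  show "col (mat n n (\<lambda>(p, q). A p q)) k = col (mat n n (\<lambda>(p, q). A p q)) l"
    using assms by (intro eq_vecI) auto
qed (use assms in auto)

lemma fdet_identical_rows:
  assumes "k \<noteq> l" "k < n" "l < n" "\<And>q. q < n \<Longrightarrow> A k q = A l q"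
  shows "fdet n A = 0"
  using fdet_identical_cols[of k l n "\<lambda>p q. A q p"] assms
  by (simp add: fdet_transpose[of n A])

lemma fdet_permute_cols:
  assumes "\<pi> permutes {0..<n}"
  shows "fdet n (\<lambda>p q. A p (\<pi> q)) = signof \<pi> * fdet n A"
proof -
  have "fdet n (\<lambda>p q. A p (\<pi> q)) = fdet n (\<lambda>q p. A p (\<pi> q))"
    using fdet_transpose[of n "\<lambda>q p. A p (\<pi> q)"] by simp
  also have "\<dots> = det (mat n n (\<lambda>(i, j). mat n n (\<lambda>(q, p). A p q) $$ (\<pi> i, j)))"
    unfolding fdet_def using permutes_in_image[OF assms]
    by (intro arg_cong[where f = det] eq_matI) auto
  also have "\<dots> = signof \<pi> * fdet n (\<lambda>q p. A p q)"
    unfolding fdet_def by (rule det_permute_rows) (use assms in auto)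
  finally show ?thesis by (simp add: fdet_transpose[of n A])
qed

section \<open>Cofactor expansions, kernel vectors and Cramer's rule\<close>

definition cof :: "nat \<Rightarrow> (nat \<Rightarrow> nat \<Rightarrow> real) \<Rightarrow> nat \<Rightarrow> nat \<Rightarrow> real" where
  "cof n A r s = (-1) ^ (r + s) * fdet n (\<lambda>p q. A (insert_index r p) (insert_index s q))"

lemma fdet_expand_row:
  assumes "r < Suc n"
  shows "fdet (Suc n) A = (\<Sum>q<Suc n. A r q * cof n A r q)"
proof -
  let ?A = "mat (Suc n) (Suc n) (\<lambda>(p, q). A p q)"
  have "cofactor ?A r q = cof n A r q" if "q < Suc n" for q
    unfolding cofactor_def cof_def fdet_def mat_delete_def using that assms
    by (intro arg_cong2[where f = "(*)"] refl arg_cong[where f = det] eq_matI)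
       (auto simp: insert_index_def)
  then show ?thesis
    unfolding fdet_def using laplace_expansion_row[of ?A "Suc n" r] assms by simp
qed

lemma fdet_expand_alien_row:
  assumes "r < Suc n" "r' < Suc n" "r \<noteq> r'"
  shows "(\<Sum>q<Suc n. A r' q * cof n A r q) = 0"
proof -
  let ?B = "\<lambda>p. A (if p = r then r' else p)"
  have "0 = fdet (Suc n) ?B"
    by (rule fdet_identical_rows[of r r', symmetric]) (use assms in auto)
  also have "\<dots> = (\<Sum>q<Suc n. ?B r q * cof n ?B r q)"
    by (rule fdet_expand_row) fact
  also have "\<dots> = (\<Sum>q<Suc n. A r' q * cof n A r q)"
    unfolding cof_def by (intro sum.cong refl) auto
  finally show ?thesis by simp
qed

lemma cof_transpose: "cof n (\<lambda>p q. A q p) r s = cof n A s r"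
  unfolding cof_def using fdet_transpose[of n "\<lambda>p q. A (insert_index s p) (insert_index r q)"]
  by (simp add: add.commute)

lemma fdet_expand_col:
  assumes "s < Suc n"
  shows "fdet (Suc n) A = (\<Sum>p<Suc n. A p s * cof n A p s)"
  using fdet_expand_row[OF assms, of "\<lambda>p q. A q p"] by (simp add: fdet_transpose[of "Suc n" A] cof_transpose[of n A])

lemma fdet_expand_alien_col:
  assumes "s < Suc n" "s' < Suc n" "s \<noteq> s'"
  shows "(\<Sum>p<Suc n. A p s' * cof n A p s) = 0"
  using fdet_expand_alien_row[OF assms, of "\<lambda>p q. A q p"] by (simp add: cof_transpose[of n A])

text \<open>The alternating maximal minors of an n by n + 1 matrix are, up to a common sign, the
  cofactors along an extra row \<open>n\<close>, and that row does not enter them. Orthogonality to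
  the other rows is the alien expansion.\<close>

lemma cofactor_kernel:
  assumes "p < n"
  shows "(\<Sum>q<Suc n. (-1) ^ q * fdet n (\<lambda>p q'. A p (insert_index q q')) * A p q) = 0"
proof -
  have "cof n A n q = (-1) ^ n * ((-1) ^ q * fdet n (\<lambda>p q'. A p (insert_index q q')))" for q
    unfolding cof_def by (simp add: power_add) (rule fdet_cong, simp)
  then have "(\<Sum>q<Suc n. A p q * cof n A n q) =
      (-1) ^ n * (\<Sum>q<Suc n. (-1) ^ q * fdet n (\<lambda>p q'. A p (insert_index q q')) * A p q)"
    unfolding sum_distrib_left by (intro sum.cong) (auto simp: algebra_simps)
  then show ?thesis using fdet_expand_alien_row[of n n p A] assms by simp
qed

lemma cramer_solve:
  assumes "\<And>p. p < n \<Longrightarrow> (\<Sum>q<n. A p q * v q) = w p" "s < n" "n = Suc m"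
  shows "fdet n A * v s = (\<Sum>p<n. cof m A p s * w p)"
proof -
  have "(\<Sum>p<n. cof m A p s * w p) = (\<Sum>p<n. \<Sum>q<n. cof m A p s * (A p q * v q))"
    using assms(1) by (intro sum.cong refl) (simp add: sum_distrib_left[symmetric])
  also have "\<dots> = (\<Sum>q<n. (\<Sum>p<n. A p q * cof m A p s) * v q)"
    by (subst sum.swap) (simp add: sum_distrib_right sum_distrib_left mult_ac)
  also have "\<dots> = (\<Sum>q<n. if q = s then fdet n A * v s else 0)"
  proof (intro sum.cong refl)
    fix q assume "q \<in> {..<n}"
    then show "(\<Sum>p<n. A p q * cof m A p s) * v q = (if q = s then fdet n A * v s else 0)"
      using fdet_expand_alien_col[of s m q A] fdet_expand_col[of s m A] assms(2,3) by auto
  qed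
  also have "\<dots> = fdet n A * v s" using assms(2) by simp
  finally show ?thesis by simp
qed

lemma fdet_nonzero_kernel:
  assumes "fdet n A \<noteq> 0" "\<And>p. p < n \<Longrightarrow> (\<Sum>q<n. A p q * v q) = 0" "s < n"
  shows "v s = 0"
proof -
  obtain m where "n = Suc m" using assms(3) by (cases n) auto
  then show ?thesis using cramer_solve[of n A v "\<lambda>_. 0" s m] assms by simp
qed

text \<open>Multilinearity in all columns at once, where \<open>X\<close> collects the columns taken
  from \<open>B\<close>. It is applied with \<open>B\<close> equal to \<open>A\<close> shifted by
  one column, which describes multiplication by a linear form.\<close>

lemma fdet_add_cols:
  "fdet n (\<lambda>p q. b * A p q + a * B p q) =
    (\<Sum>X\<in>Pow {0..<n}. b ^ card ({0..<n} - X) * a ^ card X *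
      fdet n (\<lambda>p q. if q \<in> X then B p q else A p q))"
proof -
  have rows: "fdet n (\<lambda>p q. a * B p q + b * A p q) =
    (\<Sum>X\<in>Pow {0..<n}. b ^ card ({0..<n} - X) * a ^ card X *
      fdet n (\<lambda>p q. if p \<in> X then B p q else A p q))" for A B
  proof -
    have prod_eq: "(\<Prod>i = 0..<n. if i \<in> X then B i (\<pi> i) else A i (\<pi> i)) =
        (\<Prod>i\<in>X. B i (\<pi> i)) * (\<Prod>i\<in>{0..<n} - X. A i (\<pi> i))" if "X \<subseteq> {0..<n}" for X \<pi>
    proof -
      have "(\<Prod>i = 0..<n. if i \<in> X then B i (\<pi> i) else A i (\<pi> i)) =
        (\<Prod>i\<in>{0..<n} - X. if i \<in> X then B i (\<pi> i) else A i (\<pi> i)) *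
        (\<Prod>i\<in>X. if i \<in> X then B i (\<pi> i) else A i (\<pi> i))"
        by (rule prod.subset_diff) (use that in auto)
      then show ?thesis by (simp add: mult.commute)
    qed
    have "fdet n (\<lambda>p q. a * B p q + b * A p q) =
       (\<Sum>\<pi>\<in>{\<pi>. \<pi> permutes {0..<n}}. \<Sum>X\<in>Pow {0..<n}. signof \<pi> *
         ((\<Prod>i\<in>X. a * B i (\<pi> i)) * (\<Prod>i\<in>{0..<n} - X. b * A i (\<pi> i))))"
      unfolding fdet_leibniz by (simp add: prod_add sum_distrib_left)
    also have "\<dots> = (\<Sum>X\<in>Pow {0..<n}. \<Sum>\<pi>\<in>{\<pi>. \<pi> permutes {0..<n}}. signof \<pi> *
         ((\<Prod>i\<in>X. a * B i (\<pi> i)) * (\<Prod>i\<in>{0..<n} - X. b * A i (\<pi> i))))"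
      by (rule sum.swap)
    also have "\<dots> = (\<Sum>X\<in>Pow {0..<n}. b ^ card ({0..<n} - X) * a ^ card X *
      fdet n (\<lambda>p q. if p \<in> X then B p q else A p q))"
    proof (intro sum.cong refl)
      fix X assume "X \<in> Pow {0..<n}"
      then have X: "X \<subseteq> {0..<n}" by simp
      have if_app: "(if P then B i else A i) j = (if P then B i j else A i j)" for P i j by simp
      show "(\<Sum>\<pi>\<in>{\<pi>. \<pi> permutes {0..<n}}. signof \<pi> *
         ((\<Prod>i\<in>X. a * B i (\<pi> i)) * (\<Prod>i\<in>{0..<n} - X. b * A i (\<pi> i)))) =
         b ^ card ({0..<n} - X) * a ^ card X * fdet n (\<lambda>p q. if p \<in> X then B p q else A p q)"
        unfolding fdet_leibniz sum_distrib_left prod_eq[OF X]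
        by (intro sum.cong refl) (simp add: prod.distrib)
    qed
    finally show ?thesis .
  qed
  show ?thesis
    using rows[of "\<lambda>p q. B q p" "\<lambda>p q. A q p"]
      fdet_transpose[of n "\<lambda>p q. b * A p q + a * B p q"]
      fdet_transpose[of n "\<lambda>p q. if q \<in> X then B p q else A p q" for X]
    by (simp add: add.commute)
qed

section \<open>Minors of rectangular matrices\<close>

text \<open>Rows are added one at a time. The cofactors of a new last column form a vector whose
  last entry is the old minor, hence nonzero. Independence of the rows gives a column that pairs
  nontrivially with it, and this pairing is the enlarged minor.\<close>

lemma exists_nonzero_minor:
  fixes A :: "nat \<Rightarrow> nat \<Rightarrow> real"
  assumes "\<And>v. (\<forall>q<N. (\<Sum>p<n. v p * A p q) = 0) \<Longrightarrow> \<forall>p<n. v p = 0"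
  shows "\<exists>g. (\<forall>k<n. g k < N) \<and> fdet n (\<lambda>p q. A p (g q)) \<noteq> 0"
  using assms
proof (induction n)
  case 0
  then show ?case by simp
next
  case (Suc n)
  have "\<exists>g. (\<forall>k<n. g k < N) \<and> fdet n (\<lambda>p q. A p (g q)) \<noteq> 0"
  proof (rule Suc.IH)
    fix v assume v: "\<forall>q<N. (\<Sum>p<n. v p * A p q) = 0"
    have "\<forall>p<Suc n. (v(n := 0)) p = 0"
      by (rule Suc.prems) (use v in simp)
    then show "\<forall>p<n. v p = 0" by (metis fun_upd_apply less_SucI less_irrefl)
  qed
  then obtain g where g: "\<forall>k<n. g k < N" "fdet n (\<lambda>p q. A p (g q)) \<noteq> 0" by blast
  define v where "v p = cof n (\<lambda>p q. A p (g q)) p n" for p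
  have "v n = fdet n (\<lambda>p q. A p (g q))"
    unfolding v_def cof_def by (simp add: power_add[symmetric]) (rule fdet_cong, simp)
  then have "\<not> (\<forall>p<Suc n. v p = 0)" using g(2) by auto
  then obtain q where q: "q < N" "(\<Sum>p<Suc n. v p * A p q) \<noteq> 0"
    using Suc.prems[of v] by blast
  have "fdet (Suc n) (\<lambda>p k. A p ((g(n := q)) k)) =
      (\<Sum>p<Suc n. A p q * cof n (\<lambda>p k. A p ((g(n := q)) k)) p n)"
    by (subst fdet_expand_col[of n]) simp_all
  also have "\<dots> = (\<Sum>p<Suc n. v p * A p q)"
  proof (intro sum.cong refl)
    fix p
    have "cof n (\<lambda>p k. A p ((g(n := q)) k)) p n = v p"
      unfolding v_def cof_def by (intro arg_cong2[where f = "(*)"] refl fdet_cong) simp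
    then show "A p q * cof n (\<lambda>p k. A p ((g(n := q)) k)) p n = v p * A p q" by simp
  qed
  finally have "fdet (Suc n) (\<lambda>p k. A p ((g(n := q)) k)) \<noteq> 0" using q by simp
  moreover have "\<forall>k<Suc n. (g(n := q)) k < N" using g q by (auto simp: less_Suc_eq)
  ultimately show ?case by blast
qed

text \<open>A nonzero minor has distinct columns, and sorting them changes only its sign.\<close>

lemma exists_increasing_nonzero_minor:
  fixes A :: "nat \<Rightarrow> nat \<Rightarrow> real"
  assumes "\<And>v. (\<forall>q<N. (\<Sum>p<n. v p * A p q) = 0) \<Longrightarrow> \<forall>p<n. v p = 0"
  obtains g where "strict_mono_on {..<n} g" "\<forall>k<n. g k < N" "fdet n (\<lambda>p q. A p (g q)) \<noteq> 0"
proof -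
  obtain g where g: "\<forall>k<n. g k < N" "fdet n (\<lambda>p q. A p (g q)) \<noteq> 0"
    using exists_nonzero_minor[OF assms] by blast
  have inj: "inj_on g {..<n}"
  proof (rule inj_onI)
    fix x y assume "x \<in> {..<n}" "y \<in> {..<n}" "g x = g y"
    then show "x = y" using fdet_identical_cols[of x y n "\<lambda>p q. A p (g q)"] g by auto
  qed
  define S where "S = g ` {..<n}"
  have fin: "finite S" and card: "card S = n"
    using inj by (simp_all add: S_def card_image)
  \<comment> \<open>The rank of column \<open>g k\<close> among the chosen ones;
    \<open>pick S\<close> inverts it.\<close>
  define \<pi> where "\<pi> k = (if k < n then card {a \<in> S. a < g k} else k)" for k
  have pick_\<pi>: "pick S (\<pi> k) = g k" if "k < n" for k
    using pick_card_in_set[of "g k" S] that by (auto simp: \<pi>_def S_def)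
  have \<pi>_less: "\<pi> k < n" if "k < n" for k
  proof -
    have "{a \<in> S. a < g k} \<subset> S" using that by (auto simp: S_def)
    then show ?thesis using psubset_card_mono[OF fin] card that by (simp add: \<pi>_def)
  qed
  have inj_\<pi>: "inj_on \<pi> {0..<n}"
    by (rule inj_onI) (use inj pick_\<pi> in \<open>metis atLeastLessThan_iff inj_onD lessThan_iff\<close>)
  have "\<pi> ` {0..<n} = {0..<n}"
    by (rule endo_inj_surj) (use \<pi>_less inj_\<pi> in auto)
  with inj_\<pi> have "bij_betw \<pi> {0..<n} {0..<n}" by (simp add: bij_betw_def)
  then have perm: "\<pi> permutes {0..<n}"
    by (rule bij_imp_permutes) (auto simp: \<pi>_def)
  have "fdet n (\<lambda>p q. A p (g q)) = fdet n (\<lambda>p q. A p (pick S (\<pi> q)))"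
    by (rule fdet_cong) (simp add: pick_\<pi>)
  also have "\<dots> = signof \<pi> * fdet n (\<lambda>p q. A p (pick S q))"
    by (rule fdet_permute_cols[OF perm, of "\<lambda>p q. A p (pick S q)"])
  finally have "fdet n (\<lambda>p q. A p (pick S q)) \<noteq> 0" using g(2) by auto
  moreover have "strict_mono_on {..<n} (pick S)"
    using pick_mono_le[of _ S] card by (auto simp: strict_mono_on_def)
  moreover have "\<forall>k<n. pick S k < N"
  proof (intro allI impI)
    fix k assume "k < n"
    then have "pick S k \<in> S" using card by (intro pick_in_set_le) simp
    then show "pick S k < N" using g(1) by (auto simp: S_def)
  qed
  ultimately show ?thesis using that by blast
qed

text \<open>The vectors \<open>w\<close>, \<open>y\<close> and \<open>z\<close> of alternating
  minors all lie in the kernel of the first \<open>n\<close> rows, which have n + 2 columns. Since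
  the minor on the middle columns is nonzero, a kernel vector vanishing in both outer columns is
  zero; the relation is entry \<open>t\<close> of such a vector.\<close>

lemma plucker_three_term:
  fixes B :: "nat \<Rightarrow> nat \<Rightarrow> real"
  assumes "0 < t" "t \<le> n" and K: "fdet n (\<lambda>p q. B p (Suc q)) \<noteq> 0"
  shows "fdet (Suc n) (\<lambda>p q. B p (insert_index t q)) * fdet n (\<lambda>p q. B p (Suc q)) =
    fdet (Suc n) B * fdet n (\<lambda>p q. B p (Suc (insert_index (t - 1) q))) +
    fdet (Suc n) (\<lambda>p q. B p (Suc q)) * fdet n (\<lambda>p q. B p (insert_index t q))"
proof -
  define K where "K = fdet n (\<lambda>p q. B p (Suc q))"
  define T where "T s = fdet (Suc n) (\<lambda>p q. B p (insert_index s q))" for s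
  define Y where "Y s = fdet n (\<lambda>p q. B p (Suc (insert_index s q)))" for s
  define Z where "Z s = fdet n (\<lambda>p q. B p (insert_index s q))" for s
  have T0: "T 0 = fdet (Suc n) (\<lambda>p q. B p (Suc q))" unfolding T_def by (rule fdet_cong) simp
  have Tn: "T (Suc n) = fdet (Suc n) B" unfolding T_def by (rule fdet_cong) simp
  have Yn: "Y n = K" unfolding Y_def K_def by (rule fdet_cong) simp
  have Z0: "Z 0 = K" unfolding Z_def K_def by (rule fdet_cong) simp
  define w where "w s = (-1) ^ s * T s" for s
  define y where "y s = (if s = 0 then 0 else (-1) ^ (s - 1) * Y (s - 1))" for s
  define z where "z s = (if s = Suc n then 0 else (-1) ^ s * Z s)" for s
  \<comment> \<open>The coefficients are chosen so that the entries 0 and \<open>Suc n\<close>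
    cancel.\<close>
  define v where "v s = K * w s + T (Suc n) * y s - T 0 * z s" for s
  have sums: "(\<Sum>s<Suc (Suc n). v s * B p s) = 0" if p: "p < n" for p
  proof -
    have "(\<Sum>s<Suc (Suc n). w s * B p s) = 0"
      using cofactor_kernel[of p "Suc n" B] p by (simp add: w_def T_def)
    moreover have "(\<Sum>s<Suc (Suc n). y s * B p s) = 0"
      using cofactor_kernel[of p n "\<lambda>p q. B p (Suc q)"] p
      by (simp add: sum.lessThan_Suc_shift y_def Y_def del: sum.lessThan_Suc)
    moreover have "(\<Sum>s<Suc (Suc n). z s * B p s) = 0"
    proof -
      have "(\<Sum>s<Suc n. z s * B p s) = 0"
        using cofactor_kernel[of p n B] p by (simp add: z_def Z_def)
      then show ?thesis by (simp add: z_def)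
    qed
    ultimately show ?thesis
      unfolding v_def
      by (simp only: left_diff_distrib distrib_right sum.distrib sum_subtractf mult.assoc
          sum_distrib_left[symmetric])
  qed
  have v0: "v 0 = 0" by (simp add: v_def w_def y_def z_def Z0)
  have vn: "v (Suc n) = 0" by (simp add: v_def w_def y_def z_def Yn)
  have "v (Suc (t - 1)) = 0"
  proof (rule fdet_nonzero_kernel[where v = "\<lambda>q. v (Suc q)" and s = "t - 1", OF K])
    fix p assume "p < n"
    from sums[OF this] have "(\<Sum>q<n. v (Suc q) * B p (Suc q)) = 0"
      by (simp add: sum.lessThan_Suc_shift[of _ "Suc n"] v0 vn del: sum.lessThan_Suc)
         (simp add: vn)
    then show "(\<Sum>q<n. B p (Suc q) * v (Suc q)) = 0" by (simp add: mult.commute)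
  qed (use assms in auto)
  then have "v t = 0" using assms(1) by simp
  moreover obtain t' where t: "t = Suc t'" using assms(1) by (cases t) auto
  ultimately have "(-1) ^ t' * (T t * K) = (-1) ^ t' * (T (Suc n) * Y (t - 1) + T 0 * Z t)"
    using assms(2) by (simp add: v_def w_def y_def z_def algebra_simps)
  then have "T t * K = T (Suc n) * Y (t - 1) + T 0 * Z t" by simp
  then show ?thesis unfolding Tn T0 unfolding T_def K_def Y_def Z_def .
qed

lemma strict_mono_on_gap:
  fixes g :: "nat \<Rightarrow> nat"
  assumes "strict_mono_on {..n} g" "\<not> (\<forall>k\<le>n. g k = g 0 + k)"
  obtains t where "0 < t" "t \<le> n" "Suc (g (t - 1)) < g t"
proof -
  have "\<exists>k. k \<le> n \<and> g k \<noteq> g 0 + k" using assms(2) by blast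
  then obtain t where t: "t \<le> n" "g t \<noteq> g 0 + t"
    and least: "\<And>k. k < t \<Longrightarrow> \<not> (k \<le> n \<and> g k \<noteq> g 0 + k)"
    using exists_least_iff[of "\<lambda>k. k \<le> n \<and> g k \<noteq> g 0 + k"] by blast
  have "0 < t" using t(2) by (cases t) auto
  moreover have "g (t - 1) = g 0 + (t - 1)" using least[of "t - 1"] t(1) \<open>0 < t\<close> by simp
  moreover have "g (t - 1) < g t"
    using assms(1) t(1) \<open>0 < t\<close> by (auto simp: strict_mono_on_def)
  ultimately show ?thesis using that[of t] t by linarith
qed

text \<open>Fekete's criterion: the spread of the chosen columns is reduced by inserting a column into
  a gap and applying the three-term Pluecker relation, all of whose other factors are positive.\<close>

lemma fekete_cols:
  assumes "\<And>m c. m \<le> n \<Longrightarrow> c + m \<le> C \<Longrightarrow> fdet m (\<lambda>p q. A p (c + q)) > 0"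
    and "strict_mono_on {..<n} g" "\<And>k. k < n \<Longrightarrow> g k < C"
  shows "fdet n (\<lambda>p q. A p (g q)) > 0"
  using assms
proof (induction n arbitrary: g)
  case 0
  then show ?case by simp
next
  case (Suc n)
  have IH: "fdet n (\<lambda>p q. A p (g q)) > 0"
    if "strict_mono_on {..<n} g" "\<And>k. k < n \<Longrightarrow> g k < C" for g
    by (rule Suc.IH) (use Suc.prems(1) that in auto)
  show ?case
    using Suc.prems(2,3)
  proof (induction "g n - g 0" arbitrary: g rule: less_induct)
    case less
    have mono: "g k < g l" if "k < l" "l \<le> n" for k l
      using less.prems(1) that by (auto simp: strict_mono_on_def)
    have mono_le: "g k \<le> g l" if "k \<le> l" "l \<le> n" for k l
      using mono[of k l] that by (cases "k = l") auto
    show ?case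
    proof (cases "\<forall>k\<le>n. g k = g 0 + k")
      case True
      have "fdet (Suc n) (\<lambda>p q. A p (g q)) = fdet (Suc n) (\<lambda>p q. A p (g 0 + q))"
        by (intro fdet_cong) (metis True less_Suc_eq_le)
      moreover have "g n = g 0 + n" using True by blast
      then have "g 0 + Suc n \<le> C" using less.prems(2)[of n] by simp
      then have "fdet (Suc n) (\<lambda>p q. A p (g 0 + q)) > 0" by (intro Suc.prems(1)) auto
      ultimately show ?thesis by (simp only:)
    next
      case False
      have "strict_mono_on {..n} g" using less.prems(1) by (simp add: lessThan_Suc_atMost)
      then obtain t where t: "0 < t" "t \<le> n" "Suc (g (t - 1)) < g t"
        using strict_mono_on_gap False by blast
      \<comment> \<open>\<open>h\<close> lists the columns of \<open>g\<close> together with one new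
        column, placed right after \<open>g (t - 1)\<close> in the gap; deleting position
        \<open>t\<close> gives \<open>g\<close> back.\<close>
      define h where "h k = (if k < t then g k else if k = t then Suc (g (t - 1)) else g (k - 1))" for k
      have h_mono: "h k < h l" if "k < l" "l \<le> Suc n" for k l
      proof -
        consider "l < t" | "l = t" | "k < t" "l > t" | "k = t" "l > t" | "k > t" "l > t"
          using that by linarith
        then show ?thesis
        proof cases
          case 2
          then have "g k \<le> g (t - 1)" using that t by (intro mono_le) auto
          then show ?thesis using 2 that by (simp add: h_def)
        next
          case 4
          then have "g t \<le> g (l - 1)" using that by (intro mono_le) auto
          then show ?thesis using 4 t by (simp add: h_def)
        qed (use that mono t in \<open>auto simp: h_def\<close>)
      qed
      have h_less: "h k < C" if "k \<le> Suc n" for k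
        using that less.prems(2)[of k] less.prems(2)[of "k - 1"] less.prems(2)[of t] t
        by (auto simp: h_def)
      have h0: "h 0 = g 0" using t by (simp add: h_def)
      have hn: "h (Suc n) = g n" using t by (simp add: h_def)
      have g_h: "g k = h (insert_index t k)" for k
        by (auto simp: h_def insert_index_def)
      have ins: "insert_index s k < insert_index s l" if "k < l" for s k l
        using that by (auto simp: insert_index_def)
      have ins_le: "insert_index s k \<le> n" if "k < n" for s k
        using that by (auto simp: insert_index_def)
      have pos: "fdet n (\<lambda>p q. A p (h (f q))) > 0"
        if "\<And>k l. k < l \<Longrightarrow> l < n \<Longrightarrow> f k < f l" "\<And>k. k < n \<Longrightarrow> f k \<le> Suc n" for f
        by (rule IH) (auto simp: strict_mono_on_def intro!: h_mono h_less that)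
      \<comment> \<open>Dropping an end column of \<open>h\<close> leaves n + 1 columns of smaller
        spread than \<open>g\<close>, so the inner induction applies. The minors of size n are
        covered by the outer one through \<open>pos\<close>.\<close>
      have pos_Suc: "fdet (Suc n) (\<lambda>p q. A p (h (s + q))) > 0" if s: "s \<le> 1" for s
      proof (rule less.hyps)
        consider "s = 0" | "s = 1" using s by linarith
        then show "h (s + n) - h (s + 0) < g n - g 0"
        proof cases
          case 1
          then show ?thesis using h_mono[of n "Suc n"] mono[of 0 n] t h0 hn by simp
        next
          case 2
          then show ?thesis using h_mono[of 0 1] mono[of 0 n] t h0 hn by simp
        qed
      qed (use s in \<open>auto simp: strict_mono_on_def intro!: h_mono h_less\<close>)
      have K: "fdet n (\<lambda>p q. A p (h (Suc q))) > 0" by (rule pos) auto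
      have "fdet (Suc n) (\<lambda>p q. A p (g q)) * fdet n (\<lambda>p q. A p (h (Suc q))) > 0"
        unfolding g_h
      proof (subst plucker_three_term[where B = "\<lambda>p q. A p (h q)"])
        show "0 < fdet (Suc n) (\<lambda>p q. A p (h q)) *
            fdet n (\<lambda>p q. A p (h (Suc (insert_index (t - 1) q)))) +
          fdet (Suc n) (\<lambda>p q. A p (h (Suc q))) * fdet n (\<lambda>p q. A p (h (insert_index t q)))"
          using pos_Suc[of 0] pos_Suc[of 1]
          by (intro add_pos_pos mult_pos_pos pos) (auto intro: ins dest: ins_le le_SucI)
      qed (use t K in auto)
      then show ?thesis using K by (simp add: zero_less_mult_iff)
    qed
  qed
qed

text \<open>The column version is applied twice: to every block of contiguous rows, and then, after
  transposition, to the rows with the selected columns fixed.\<close>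

lemma fekete:
  assumes "\<And>m r c. m \<le> n \<Longrightarrow> r + m \<le> R \<Longrightarrow> c + m \<le> C \<Longrightarrow> fdet m (\<lambda>p q. A (r + p) (c + q)) > 0"
    and "strict_mono_on {..<n} f" "\<And>k. k < n \<Longrightarrow> f k < R"
    and "strict_mono_on {..<n} g" "\<And>k. k < n \<Longrightarrow> g k < C"
  shows "fdet n (\<lambda>p q. A (f p) (g q)) > 0"
proof -
  have "fdet n (\<lambda>q p. A (f p) (g q)) > 0"
  proof (rule fekete_cols[where A = "\<lambda>q p. A p (g q)" and C = R])
    fix m r assume m: "m \<le> n" "r + m \<le> R"
    have "fdet m (\<lambda>p q. A (r + p) (g q)) > 0"
      by (rule fekete_cols[where A = "\<lambda>p q. A (r + p) q" and C = C])
         (use m assms in \<open>auto simp: strict_mono_on_def\<close>)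
    then show "fdet m (\<lambda>p q. A (r + q) (g p)) > 0"
      by (subst fdet_transpose[symmetric])
  qed (use assms in auto)
  then show ?thesis by (subst fdet_transpose[symmetric])
qed

section \<open>Column minors under multiplication by a positive linear form\<close>

definition cols_nonneg :: "nat \<Rightarrow> nat \<Rightarrow> (nat \<Rightarrow> nat \<Rightarrow> real) \<Rightarrow> bool" where
  "cols_nonneg n N A \<longleftrightarrow>
    (\<forall>g. strict_mono_on {..<n} g \<longrightarrow> (\<forall>k<n. g k < N) \<longrightarrow> fdet n (\<lambda>p q. A p (g q)) \<ge> 0)"

definition cols_pos :: "nat \<Rightarrow> nat \<Rightarrow> (nat \<Rightarrow> nat \<Rightarrow> real) \<Rightarrow> bool" where
  "cols_pos n N A \<longleftrightarrow>
    (\<exists>g. strict_mono_on {..<n} g \<and> (\<forall>k<n. g k < N) \<and> fdet n (\<lambda>p q. A p (g q)) > 0)"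

text \<open>Raising some of the columns by one keeps their order weakly. Either they stay distinct
  and the hypothesis applies, or two of them coincide and the minor is zero.\<close>

lemma cols_nonneg_bump:
  assumes nonneg: "cols_nonneg n (Suc N) A"
    and g: "strict_mono_on {..<n} g" "\<forall>k<n. g k < N"
  shows "fdet n (\<lambda>p q. if q \<in> X then A p (Suc (g q)) else A p (g q)) \<ge> 0"
proof -
  define h where "h q = (if q \<in> X then Suc (g q) else g q)" for q
  have eq: "(\<lambda>p q. if q \<in> X then A p (Suc (g q)) else A p (g q)) = (\<lambda>p q. A p (h q))"
    by (intro ext) (simp add: h_def)
  show ?thesis
  proof (cases "strict_mono_on {..<n} h")
    case True
    moreover have "\<forall>k<n. h k < Suc N" using g(2) by (auto simp: h_def less_SucI)
    ultimately show ?thesis using nonneg unfolding eq cols_nonneg_def by blast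
  next
    case False
    then obtain k l where kl: "k < l" "l < n" "\<not> h k < h l"
      by (auto simp: strict_mono_on_def)
    moreover have "g k < g l" using g(1) kl by (auto simp: strict_mono_on_def)
    ultimately have "h k = h l" by (auto simp: h_def split: if_splits)
    then have "fdet n (\<lambda>p q. A p (h q)) = 0"
      using kl by (intro fdet_identical_cols[of k l]) auto
    then show ?thesis unfolding eq by simp
  qed
qed

lemma cols_nonneg_step:
  assumes "cols_nonneg n (Suc N) A" "a \<ge> 0" "b \<ge> 0"
  shows "cols_nonneg n N (\<lambda>p q. b * A p q + a * A p (Suc q))"
  unfolding cols_nonneg_def
proof (intro allI impI)
  fix g assume g: "strict_mono_on {..<n} g" "\<forall>k<n. g k < N"
  show "0 \<le> fdet n (\<lambda>p q. b * A p (g q) + a * A p (Suc (g q)))"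
    unfolding fdet_add_cols
    by (intro sum_nonneg mult_nonneg_nonneg cols_nonneg_bump[OF assms(1) g])
       (use assms in auto)
qed

lemma cols_pos_step:
  assumes nonneg: "cols_nonneg n (Suc N) A" and "cols_pos n (Suc N) A"
    and "a > 0" "b > 0" "n \<le> N"
  shows "cols_pos n N (\<lambda>p q. b * A p q + a * A p (Suc q))"
proof -
  obtain g where g: "strict_mono_on {..<n} g" "\<forall>k<n. g k < Suc N"
    and pos: "fdet n (\<lambda>p q. A p (g q)) > 0"
    using assms(2) by (auto simp: cols_pos_def)
  have "card (g ` {..<n}) < card {..<Suc N}"
    using card_image_le[of "{..<n}" g] \<open>n \<le> N\<close> by simp
  then have "\<not> {..<Suc N} \<subseteq> g ` {..<n}"
    using card_mono[of "g ` {..<n}" "{..<Suc N}"] by force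
  then obtain v where "v < Suc N" "v \<notin> g ` {..<n}" by blast
  then have v: "v \<le> N" "\<And>k. k < n \<Longrightarrow> g k \<noteq> v" by auto
  \<comment> \<open>Precisely the columns that were lowered: raising them again recovers
    \<open>g\<close>, so the term for \<open>X\<close> contains the positive minor.\<close>
  define X where "X = {k \<in> {0..<n}. v < g k}"
  define h where "h k = (if k \<in> X then g k - 1 else g k)" for k
  have h_mono: "strict_mono_on {..<n} h"
  proof (rule strict_mono_onI)
    fix k l assume kl: "k \<in> {..<n}" "l \<in> {..<n}" "k < l"
    then have "g k < g l" using g(1) by (auto simp: strict_mono_on_def)
    moreover have "g k \<noteq> v" using v(2) kl by auto
    ultimately show "h k < h l" using kl by (auto simp: h_def X_def)
  qed
  have h_less: "\<forall>k<n. h k < N"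
  proof (intro allI impI)
    fix k assume "k < n"
    then show "h k < N" using g(2) v(1) v(2)[of k] by (force simp: h_def X_def)
  qed
  let ?t = "\<lambda>X. b ^ card ({0..<n} - X) * a ^ card X *
      fdet n (\<lambda>p q. if q \<in> X then A p (Suc (h q)) else A p (h q))"
  have "fdet n (\<lambda>p q. if q \<in> X then A p (Suc (h q)) else A p (h q)) = fdet n (\<lambda>p q. A p (g q))"
    by (rule fdet_cong) (auto simp: h_def X_def)
  then have "0 < ?t X" using pos assms by simp
  also have "?t X \<le> (\<Sum>X\<in>Pow {0..<n}. ?t X)"
  proof (rule member_le_sum)
    show "0 \<le> ?t Y" for Y
      using cols_nonneg_bump[OF nonneg h_mono h_less] assms by simp
  qed (auto simp: X_def)
  also have "\<dots> = fdet n (\<lambda>p q. b * A p (h q) + a * A p (Suc (h q)))"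
    by (rule fdet_add_cols[symmetric])
  finally show ?thesis unfolding cols_pos_def using h_mono h_less by blast
qed

text \<open>In a square matrix the only increasing choice of all columns is the identity; this turns
  \<open>cols_pos\<close> into a statement about the determinant.\<close>

lemma strict_mono_on_bounded_id:
  fixes g :: "nat \<Rightarrow> nat"
  assumes "strict_mono_on {..<n} g" "\<forall>k<n. g k < n" "k < n"
  shows "g k = k"
proof -
  have ge: "m \<le> g m" if "m < n" for m
    using that
  proof (induction m)
    case (Suc m)
    have "g m < g (Suc m)" using assms(1) Suc.prems by (auto simp: strict_mono_on_def)
    then show ?case using Suc by simp
  qed simp
  have le: "g m \<le> m" if "m + x + 1 = n" for m x
    using that
  proof (induction x arbitrary: m)
    case 0
    then have "m < n" by simp
    then have "g m < n" using assms(2) by blast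
    then show ?case using 0 by linarith
  next
    case (Suc x)
    have "g m < g (Suc m)" using assms(1) Suc.prems by (auto simp: strict_mono_on_def)
    then show ?case using Suc.IH[of "Suc m"] Suc.prems by simp
  qed
  show ?thesis using ge[OF assms(3)] le[of k "n - Suc k"] assms(3) by simp
qed

section \<open>The functional of a coefficient sequence\<close>

text \<open>Binary forms of degree \<open>k\<close> are represented by their dehomogenizations, polynomials of
  degree at most \<open>k\<close>; a positive linear form \<open>a x + b y\<close> becomes \<open>[:b, a:]\<close>. The functional below
  is the contraction of a form of degree \<open>d\<close> against the form with normalized coefficients \<open>c\<close>,
  up to the factor \<open>d!\<close>.\<close>

definition Lf :: "nat \<Rightarrow> (nat \<Rightarrow> real) \<Rightarrow> real poly \<Rightarrow> real" where
  "Lf d c p = (\<Sum>m\<le>d. coeff p m * c m)"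

lemma Lf_0 [simp]: "Lf d c 0 = 0"
  by (simp add: Lf_def)

lemma Lf_add: "Lf d c (p + q) = Lf d c p + Lf d c q"
  by (simp add: Lf_def distrib_right sum.distrib)

lemma Lf_smult: "Lf d c (smult a p) = a * Lf d c p"
  by (simp add: Lf_def sum_distrib_left mult.assoc)

lemma Lf_sum: "Lf d c (\<Sum>x\<in>S. f x) = (\<Sum>x\<in>S. Lf d c (f x))"
  by (induction S rule: infinite_finite_induct) (simp_all add: Lf_add)

lemma Lf_monom: "k \<le> d \<Longrightarrow> Lf d c (monom a k) = a * c k"
  by (simp add: Lf_def if_distrib[of "\<lambda>x. x * _"] cong: if_cong)

lemma Lf_mult_expand:
  assumes "degree q \<le> n"
  shows "Lf d c (q * r) = (\<Sum>k\<le>n. coeff q k * Lf d c (monom 1 k * r))"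
proof -
  have "q = (\<Sum>k\<le>n. smult (coeff q k) (monom 1 k))"
    using poly_as_sum_of_monoms'[OF assms] by (simp add: smult_monom)
  then have "Lf d c (q * r) = Lf d c ((\<Sum>k\<le>n. smult (coeff q k) (monom 1 k)) * r)" by simp
  then show ?thesis by (simp add: sum_distrib_right Lf_sum Lf_smult)
qed

lemma Lf_shift:
  assumes "degree p \<le> n" "s + n \<le> d"
  shows "Lf d c (monom 1 s * p) = (\<Sum>k\<le>n. coeff p k * c (s + k))"
proof -
  have "Lf d c (monom 1 s * p) = (\<Sum>k\<le>n. coeff p k * Lf d c (monom 1 (s + k)))"
    using Lf_mult_expand[OF assms(1), of d c "monom 1 s"] by (simp add: mult.commute mult_monom add.commute)
  then show ?thesis using assms(2) by (simp add: Lf_monom)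
qed

text \<open>\<open>m\<close> is the degree of the form, which the dehomogenization \<open>p\<close>
  forgets: a factor y lowers \<open>degree p\<close> but not \<open>m\<close>. For
  \<open>m > d\<close> only the degree bound remains, in accordance with A_F being zero above degree
  \<open>d\<close>.\<close>

definition annihilates :: "nat \<Rightarrow> (nat \<Rightarrow> real) \<Rightarrow> nat \<Rightarrow> real poly \<Rightarrow> bool" where
  "annihilates d c m p \<longleftrightarrow> degree p \<le> m \<and> (\<forall>s. s + m \<le> d \<longrightarrow> Lf d c (monom 1 s * p) = 0)"

lemma annihilates_mult:
  assumes "annihilates d c m p" "degree q + m \<le> d"
  shows "Lf d c (q * p) = 0"
  by (subst Lf_mult_expand[OF order_refl], rule sum.neutral)
     (use assms in \<open>auto simp: annihilates_def\<close>)

inductive pos_lin_prod :: "nat \<Rightarrow> real poly \<Rightarrow> bool" where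
  one: "pos_lin_prod 0 1"
| lin: "pos_lin_prod n M \<Longrightarrow> a > 0 \<Longrightarrow> b > 0 \<Longrightarrow> pos_lin_prod (Suc n) ([:b, a:] * M)"

lemma pos_lin_prod_mult:
  "pos_lin_prod m M \<Longrightarrow> pos_lin_prod n N \<Longrightarrow> pos_lin_prod (m + n) (M * N)"
  by (induction rule: pos_lin_prod.induct) (auto intro: pos_lin_prod.lin simp: mult.assoc simp del: mult_pCons_left)

lemma pos_lin_prod_power:
  "a > 0 \<Longrightarrow> b > 0 \<Longrightarrow> pos_lin_prod n ([:b, a:] ^ n)"
  by (induction n) (auto intro: pos_lin_prod.intros simp del: mult_pCons_left)

lemma pos_lin_prod_degree: "pos_lin_prod n M \<Longrightarrow> degree M \<le> n"
proof (induction rule: pos_lin_prod.induct)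
  case (lin n M a b)
  then show ?case
    using degree_mult_le[of "[:b, a:]" M] by (simp del: mult_pCons_left)
qed simp

lemma Lf_lin_mult:
  "Lf d c (monom 1 k * ([:b, a:] * M)) =
    b * Lf d c (monom 1 k * M) + a * Lf d c (monom 1 (Suc k) * M)"
proof -
  have "monom 1 k * ([:b, a:] * M) = smult b (monom 1 k * M) + smult a (monom 1 (Suc k) * M)"
    by (simp add: monom_Suc distrib_left)
  then show ?thesis by (simp add: Lf_add Lf_smult)
qed

text \<open>Each linear factor replaces a column by a positive combination of itself and its right
  neighbour, at the cost of one column; thus \<open>N + n\<close> columns become \<open>N\<close>.
  The bound by \<open>j\<close> keeps the truncated subtraction exact, so that moving one column to
  the right raises the exponent by one.\<close>

lemma cols_nonneg_pos_lin_prod: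
  assumes "pos_lin_prod n M" "\<And>p. p < m \<Longrightarrow> f p \<le> j"
    and "cols_nonneg m (N + n) (\<lambda>p q. Lf d c (monom 1 (j + q - f p)))"
  shows "cols_nonneg m N (\<lambda>p q. Lf d c (monom 1 (j + q - f p) * M))"
  using assms(1,3)
proof (induction arbitrary: N rule: pos_lin_prod.induct)
  case one
  then show ?case by simp
next
  case (lin n M a b)
  have eq: "Lf d c (monom 1 (j + q - f p) * ([:b, a:] * M)) =
      b * Lf d c (monom 1 (j + q - f p) * M) + a * Lf d c (monom 1 (j + Suc q - f p) * M)"
    if "p < m" for p q
    unfolding Lf_lin_mult using assms(2)[OF that] by (simp add: Suc_diff_le)
  have "cols_nonneg m N (\<lambda>p q. b * Lf d c (monom 1 (j + q - f p) * M) +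
      a * Lf d c (monom 1 (j + Suc q - f p) * M))"
    using lin by (intro cols_nonneg_step lin.IH) auto
  then show ?case unfolding cols_nonneg_def
    by (simp add: eq cong: fdet_cong del: mult_pCons_left)
qed

lemma cols_pos_pos_lin_prod:
  assumes "pos_lin_prod n M" "\<And>p. p < m \<Longrightarrow> f p \<le> j" "m \<le> N"
    and "cols_nonneg m (N + n) (\<lambda>p q. Lf d c (monom 1 (j + q - f p)))"
    and "cols_pos m (N + n) (\<lambda>p q. Lf d c (monom 1 (j + q - f p)))"
  shows "cols_pos m N (\<lambda>p q. Lf d c (monom 1 (j + q - f p) * M))"
  using assms(1,3-)
proof (induction arbitrary: N rule: pos_lin_prod.induct)
  case one
  then show ?case by simp
next
  case (lin n M a b)
  have eq: "Lf d c (monom 1 (j + q - f p) * ([:b, a:] * M)) =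
      b * Lf d c (monom 1 (j + q - f p) * M) + a * Lf d c (monom 1 (j + Suc q - f p) * M)"
    if "p < m" for p q
    unfolding Lf_lin_mult using assms(2)[OF that] by (simp add: Suc_diff_le)
  have "cols_pos m N (\<lambda>p q. b * Lf d c (monom 1 (j + q - f p) * M) +
      a * Lf d c (monom 1 (j + Suc q - f p) * M))"
    using lin by (intro cols_pos_step cols_nonneg_pos_lin_prod[OF lin(1)] lin.IH assms(2)) auto
  then show ?case unfolding cols_pos_def
    by (simp add: eq cong: fdet_cong del: mult_pCons_left)
qed

section \<open>Total nonnegativity implies the Hodge--Riemann relations\<close>

definition toeplitz_nonneg :: "nat \<Rightarrow> nat \<Rightarrow> (nat \<Rightarrow> real) \<Rightarrow> bool" where
  "toeplitz_nonneg d i c \<longleftrightarrow> (\<forall>j\<le>i. \<forall>n f g.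
    strict_mono_on {..<n} f \<longrightarrow> (\<forall>k<n. f k \<le> j) \<longrightarrow>
    strict_mono_on {..<n} g \<longrightarrow> (\<forall>k<n. g k \<le> d - j) \<longrightarrow>
    fdet n (\<lambda>p q. c (j + g q - f p)) \<ge> 0)"

text \<open>\<open>[:b, a:]\<close> stands for the form l_0 that defines primitivity and
  \<open>M\<close> for the product of the others. The form l_0 M p has degree d - j + 1, so it is
  zero in A_F as soon as it pairs to zero with the monomials of degree j - 1, which gives the range
  \<open>s < j\<close>.\<close>

definition hodge_riemann :: "nat \<Rightarrow> nat \<Rightarrow> (nat \<Rightarrow> real) \<Rightarrow> bool" where
  "hodge_riemann d i c \<longleftrightarrow> (\<forall>j\<le>i. \<forall>M a b p.
    pos_lin_prod (d - 2 * j) M \<longrightarrow> a > 0 \<longrightarrow> b > 0 \<longrightarrow> degree p \<le> j \<longrightarrow>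
    \<not> annihilates d c j p \<longrightarrow> (\<forall>s<j. Lf d c (monom 1 s * ([:b, a:] * M * p)) = 0) \<longrightarrow>
    (-1) ^ j * Lf d c (M * p * p) > 0)"

lemma toeplitz_nonneg_cols:
  assumes "toeplitz_nonneg d i c" "j \<le> i" "2 * i \<le> d"
    and "strict_mono_on {..<n} f" "\<And>k. k < n \<Longrightarrow> f k \<le> j"
  shows "cols_nonneg n (Suc (d - j)) (\<lambda>p q. Lf d c (monom 1 (j + q - f p)))"
  unfolding cols_nonneg_def
proof (intro allI impI)
  fix g assume g: "strict_mono_on {..<n} g" "\<forall>k<n. g k < Suc (d - j)"
  have "fdet n (\<lambda>p q. c (j + g q - f p)) \<ge> 0"
    using assms g unfolding toeplitz_nonneg_def by (auto simp: less_Suc_eq_le)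
  also have "fdet n (\<lambda>p q. c (j + g q - f p)) = fdet n (\<lambda>p q. Lf d c (monom 1 (j + g q - f p)))"
  proof (rule fdet_cong)
    fix p q assume "p < n" "q < n"
    then have "j + g q - f p \<le> d" using g(2) assms(2,3) by (auto simp: less_Suc_eq_le)
    then show "c (j + g q - f p) = Lf d c (monom 1 (j + g q - f p))" by (simp add: Lf_monom)
  qed
  finally show "0 \<le> fdet n (\<lambda>p q. Lf d c (monom 1 (j + g q - f p)))" .
qed

text \<open>A vector in the left kernel of the Toeplitz matrix is, in reversed order, the
  coefficient list of an annihilator of degree \<open>j\<close>. Without such annihilators the rows
  are independent, some maximal minor is nonzero, and total nonnegativity makes it positive.\<close>

lemma no_annihilator_cols_pos:
  assumes "toeplitz_nonneg d i c" "j \<le> i" "2 * i \<le> d"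
    and "\<And>p. annihilates d c j p \<Longrightarrow> p = 0"
  shows "cols_pos (Suc j) (Suc (d - j)) (\<lambda>p q. Lf d c (monom 1 (j + q - p)))"
proof -
  let ?A = "\<lambda>p q. Lf d c (monom 1 (j + q - p))"
  have kernel: "\<forall>p<Suc j. v p = 0" if v: "\<forall>q<Suc (d - j). (\<Sum>p<Suc j. v p * ?A p q) = 0" for v
  proof -
    define \<alpha> where "\<alpha> = (\<Sum>p<Suc j. monom (v p) (j - p))"
    have coeff: "coeff \<alpha> (j - p) = v p" if "p < Suc j" for p
    proof -
      have "coeff \<alpha> (j - p) = (\<Sum>p'<Suc j. if p' = p then v p' else 0)"
        unfolding \<alpha>_def coeff_sum by (intro sum.cong refl) (use that in auto)
      then show ?thesis using that by simp
    qed
    have "annihilates d c j \<alpha>"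
      unfolding annihilates_def
    proof (intro conjI allI impI)
      show "degree \<alpha> \<le> j"
        unfolding \<alpha>_def by (intro degree_sum_le) (auto intro: order_trans[OF degree_monom_le])
      fix s assume s: "s + j \<le> d"
      have "Lf d c (monom 1 s * \<alpha>) = (\<Sum>p<Suc j. Lf d c (monom (v p) (s + (j - p))))"
        by (simp add: \<alpha>_def sum_distrib_left distrib_left Lf_sum Lf_add mult_monom)
      also have "\<dots> = (\<Sum>p<Suc j. v p * ?A p s)"
        by (intro sum.cong refl) (use s in \<open>auto simp: Lf_monom add.commute\<close>)
      also have "\<dots> = 0" using v s by auto
      finally show "Lf d c (monom 1 s * \<alpha>) = 0" .
    qed
    then have "\<alpha> = 0" by (rule assms(4))
    then show ?thesis using coeff by auto
  qed
  obtain g where g: "strict_mono_on {..<Suc j} g" "\<forall>k<Suc j. g k < Suc (d - j)"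
      "fdet (Suc j) (\<lambda>p q. ?A p (g q)) \<noteq> 0"
    using exists_increasing_nonzero_minor[where A = ?A and n = "Suc j" and N = "Suc (d - j)"] kernel
    by blast
  moreover have "cols_nonneg (Suc j) (Suc (d - j)) ?A"
    using toeplitz_nonneg_cols[OF assms(1-3), of "Suc j" "\<lambda>p. p"]
    by (auto simp: strict_mono_on_def)
  ultimately show ?thesis unfolding cols_nonneg_def cols_pos_def
    by (metis less_eq_real_def)
qed

text \<open>The \<open>d - 2 * j\<close> factors of \<open>M\<close> reduce the
  \<open>Suc (d - j)\<close> columns to exactly \<open>Suc j\<close>. The matrix is then square, so
  its only maximal minor is the determinant itself. The second claim is the same propagation with
  row \<open>r\<close> left out.\<close>

lemma toeplitz_section_minors:
  assumes "toeplitz_nonneg d i c" "j \<le> i" "2 * i \<le> d"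
    and "\<And>p. annihilates d c j p \<Longrightarrow> p = 0"
    and M: "pos_lin_prod (d - 2 * j) M"
  defines "T \<equiv> \<lambda>p q. Lf d c (monom 1 (j + q - p) * M)"
  shows "fdet (Suc j) T > 0"
    and "r \<le> j \<Longrightarrow> s \<le> j \<Longrightarrow> fdet j (\<lambda>p q. T (insert_index r p) (insert_index s q)) \<ge> 0"
proof -
  have N: "Suc j + (d - 2 * j) = Suc (d - j)" using assms(2,3) by linarith
  have "cols_pos (Suc j) (Suc j) T"
    unfolding T_def
  proof (rule cols_pos_pos_lin_prod[OF M, where f = "\<lambda>p. p"], goal_cases)
    case 3
    show ?case unfolding N
      by (rule toeplitz_nonneg_cols[OF assms(1-3)]) (auto simp: strict_mono_on_def)
  next
    case 4
    show ?case unfolding N by (rule no_annihilator_cols_pos[OF assms(1-4)])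
  qed auto
  then obtain g where g: "strict_mono_on {..<Suc j} g" "\<forall>k<Suc j. g k < Suc j"
    "fdet (Suc j) (\<lambda>p q. T p (g q)) > 0" by (auto simp: cols_pos_def)
  have "fdet (Suc j) (\<lambda>p q. T p (g q)) = fdet (Suc j) T"
    by (rule fdet_cong) (simp add: strict_mono_on_bounded_id[OF g(1,2)])
  then show "fdet (Suc j) T > 0" using g(3) by simp
  assume rs: "r \<le> j" "s \<le> j"
  have "cols_nonneg j (Suc j) (\<lambda>p q. T (insert_index r p) q)"
    unfolding T_def
  proof (rule cols_nonneg_pos_lin_prod[OF M], goal_cases)
    case 2
    show ?case unfolding N
      by (rule toeplitz_nonneg_cols[OF assms(1-3)])
         (auto simp: strict_mono_on_def insert_index_def)
  qed (auto simp: insert_index_def)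
  moreover have "strict_mono_on {..<j} (insert_index s)" "\<forall>k<j. insert_index s k < Suc j"
    by (auto simp: strict_mono_on_def insert_index_def)
  ultimately show "fdet j (\<lambda>p q. T (insert_index r p) (insert_index s q)) \<ge> 0"
    unfolding cols_nonneg_def by blast
qed

text \<open>Cramer's rule expresses the quadratic form at a primitive element through the minors of the
  Toeplitz section; since primitivity makes \<open>Lf d c (monom 1 k * M * p)\<close> a geometric progression
  with negative ratio, all terms have the same sign.\<close>

lemma toeplitz_primitive_sign:
  assumes T_pos: "fdet (Suc j) (\<lambda>p q. Lf d c (monom 1 (j + q - p) * M)) > 0"
    and minors: "\<And>r s. r \<le> j \<Longrightarrow> s \<le> j \<Longrightarrow> fdet j (\<lambda>p q.
      Lf d c (monom 1 (j + insert_index s q - insert_index r p) * M)) \<ge> 0"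
    and "a > 0" "b > 0" "degree p \<le> j" "p \<noteq> 0"
    and prim: "\<And>s. s < j \<Longrightarrow> Lf d c (monom 1 s * ([:b, a:] * M * p)) = 0"
  shows "(-1) ^ j * Lf d c (M * p * p) > 0"
proof -
  define T where "T = (\<lambda>p q. Lf d c (monom 1 (j + q - p) * M))"
  define mi where "mi r s = fdet j (\<lambda>p q. T (insert_index r p) (insert_index s q))" for r s
  define w where "w k = Lf d c (monom 1 k * (M * p))" for k
  define t where "t = b / a"
  have t: "t > 0" using assms by (simp add: t_def)
  have w_Suc: "w (Suc k) = - t * w k" if "k < j" for k
  proof -
    have "b * w k + a * w (Suc k) = 0"
      using prim[OF that] unfolding w_def mult.assoc Lf_lin_mult .
    then show ?thesis using \<open>a > 0\<close> by (simp add: t_def field_simps)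
  qed
  have w_eq: "w k = (-1) ^ k * t ^ k * w 0" if "k \<le> j" for k
    using that by (induction k) (simp_all add: w_Suc)
  \<comment> \<open>Row \<open>r\<close> of the section pairs \<open>p\<close> with the monomial of
    exponent \<open>j - r\<close>: the rows run backwards.\<close>
  have T_w: "(\<Sum>q<Suc j. T r q * coeff p q) = w (j - r)" if "r < Suc j" for r
  proof -
    have "w (j - r) = Lf d c (p * (monom 1 (j - r) * M))"
      by (simp add: w_def mult_ac)
    also have "\<dots> = (\<Sum>q\<le>j. coeff p q * Lf d c (monom 1 q * (monom 1 (j - r) * M)))"
      by (rule Lf_mult_expand) fact
    also have "\<dots> = (\<Sum>q\<le>j. T r q * coeff p q)"
    proof (intro sum.cong refl)
      fix q
      have "q + (j - r) = j + q - r" using that by simp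
      then have eq: "monom 1 q * (monom 1 (j - r) * M) = monom 1 (j + q - r) * M"
        by (simp add: mult.assoc[symmetric] mult_monom)
      show "coeff p q * Lf d c (monom 1 q * (monom 1 (j - r) * M)) = T r q * coeff p q"
        unfolding eq T_def by (rule mult.commute)
    qed
    finally show ?thesis by (simp add: lessThan_Suc_atMost)
  qed
  let ?D = "fdet (Suc j) T"
  have D: "?D > 0" using T_pos by (simp add: T_def)
  have mi: "mi r s \<ge> 0" if "r \<le> j" "s \<le> j" for r s
    using minors[OF that] by (simp add: mi_def T_def)
  have cramer: "?D * coeff p s = (\<Sum>r<Suc j. cof j T r s * w (j - r))" if "s < Suc j" for s
    by (rule cramer_solve) (use T_w that in auto)
  \<comment> \<open>If the progression started at zero it would vanish throughout, and Cramer's rule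
    would give \<open>p = 0\<close>.\<close>
  have w0: "w 0 \<noteq> 0"
  proof
    assume "w 0 = 0"
    then have "w k = 0" if "k \<le> j" for k using w_eq[OF that] by simp
    then have "?D * coeff p s = 0" if "s < Suc j" for s unfolding cramer[OF that] by simp
    then have "coeff p s = 0" if "s \<le> j" for s using that D by (simp add: less_Suc_eq_le)
    then have "p = 0" using \<open>degree p \<le> j\<close> by (metis leading_coeff_0_iff)
    then show False using \<open>p \<noteq> 0\<close> by simp
  qed
  have "?D * Lf d c (M * p * p) = (\<Sum>s<Suc j. ?D * coeff p s * w s)"
    using Lf_mult_expand[OF \<open>degree p \<le> j\<close>, of d c "M * p"]
    by (simp add: w_def mult_ac sum_distrib_left lessThan_Suc_atMost)
  also have "\<dots> = (\<Sum>s<Suc j. \<Sum>r<Suc j. cof j T r s * w (j - r) * w s)"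
    by (intro sum.cong refl) (simp add: cramer sum_distrib_right del: sum.lessThan_Suc)
  also have "\<dots> = (\<Sum>s<Suc j. \<Sum>r<Suc j. (-1) ^ j * ((w 0)\<^sup>2 * t ^ (j - r + s) * mi r s))"
  proof (intro sum.cong refl)
    fix s r assume sr: "s \<in> {..<Suc j}" "r \<in> {..<Suc j}"
    have "(-1 :: real) ^ (r + s) * (-1) ^ (j - r) * (-1) ^ s = (-1) ^ (r + s + (j - r) + s)"
      by (simp only: power_add)
    also have "r + s + (j - r) + s = j + 2 * s" using sr by auto
    finally have sign: "(-1 :: real) ^ (r + s) * (-1) ^ (j - r) * (-1) ^ s = (-1) ^ j"
      by (simp add: power_add power_mult)
    have "cof j T r s * w (j - r) * w s =
      ((-1) ^ (r + s) * (-1) ^ (j - r) * (-1) ^ s) * ((w 0)\<^sup>2 * (t ^ (j - r) * t ^ s) * mi r s)"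
      using sr unfolding cof_def mi_def by (simp add: w_eq[of "j - r"] w_eq[of s] power2_eq_square mult_ac)
    then show "cof j T r s * w (j - r) * w s = (-1) ^ j * ((w 0)\<^sup>2 * t ^ (j - r + s) * mi r s)"
      unfolding sign by (simp add: power_add)
  qed
  also have "\<dots> = (-1) ^ j * (\<Sum>s<Suc j. \<Sum>r<Suc j. (w 0)\<^sup>2 * t ^ (j - r + s) * mi r s)"
    by (simp only: sum_distrib_left)
  finally have "?D * Lf d c (M * p * p) =
      (-1) ^ j * (\<Sum>s<Suc j. \<Sum>r<Suc j. (w 0)\<^sup>2 * t ^ (j - r + s) * mi r s)" (is "_ = _ * ?S") .
  then have "?D * ((-1) ^ j * Lf d c (M * p * p)) = (-1) ^ j * ((-1) ^ j * ?S)"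
    by (simp only: mult.left_commute[of ?D])
  also have "\<dots> = ?S" by (simp only: mult.assoc[symmetric] power_mult_distrib[symmetric]) simp
  finally have eq: "?D * ((-1) ^ j * Lf d c (M * p * p)) = ?S" .
  have nonneg: "0 \<le> (w 0)\<^sup>2 * t ^ (j - r + s) * mi r s" if "s < Suc j" "r < Suc j" for r s
    using mi[of r s] that t by simp
  \<comment> \<open>Strictness: the determinant is positive, so some cofactor in row 0 is nonzero
    and one term of the nonnegative sum is positive.\<close>
  have "\<exists>s<Suc j. cof j T 0 s \<noteq> 0"
  proof (rule ccontr)
    assume "\<not> ?thesis"
    then have "?D = 0" by (subst fdet_expand_row[of 0]) auto
    then show False using D by simp
  qed
  then obtain s where s: "s < Suc j" "cof j T 0 s \<noteq> 0" by blast
  then have "mi 0 s > 0" using mi[of 0 s] by (auto simp: cof_def mi_def)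
  then have "0 < (w 0)\<^sup>2 * t ^ (j - 0 + s) * mi 0 s" using w0 t by simp
  also have "\<dots> \<le> (\<Sum>r<Suc j. (w 0)\<^sup>2 * t ^ (j - r + s) * mi r s)"
    by (rule member_le_sum[of 0 _ "\<lambda>r. (w 0)\<^sup>2 * t ^ (j - r + s) * mi r s"]) (use nonneg s in auto)
  also have "\<dots> \<le> ?S"
    by (rule member_le_sum[of s _ "\<lambda>s. \<Sum>r<Suc j. (w 0)\<^sup>2 * t ^ (j - r + s) * mi r s"])
       (use nonneg s in \<open>auto intro!: sum_nonneg simp del: sum.lessThan_Suc\<close>)
  finally have "?D * ((-1) ^ j * Lf d c (M * p * p)) > 0" unfolding eq .
  then show ?thesis using D by (simp add: zero_less_mult_iff)
qed

section \<open>Degrees at least that of a minimal annihilator: primitive elements vanish\<close>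

lemma section_kernel:
  assumes T: "fdet (Suc j) (\<lambda>p q. Lf d c (monom 1 (j + q - p) * M)) \<noteq> 0"
    and "degree p \<le> j" "\<And>s. s \<le> j \<Longrightarrow> Lf d c (monom 1 s * (M * p)) = 0"
  shows "p = 0"
proof -
  have "coeff p s = 0" if "s < Suc j" for s
  proof (rule fdet_nonzero_kernel[OF T _ that])
    fix r assume r: "r < Suc j"
    have "0 = Lf d c (p * (monom 1 (j - r) * M))"
      using assms(3)[of "j - r"] by (simp add: mult_ac)
    also have "\<dots> = (\<Sum>q\<le>j. coeff p q * Lf d c (monom 1 q * (monom 1 (j - r) * M)))"
      by (rule Lf_mult_expand) fact
    also have "\<dots> = (\<Sum>q\<le>j. Lf d c (monom 1 (j + q - r) * M) * coeff p q)"
    proof (intro sum.cong refl)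
      fix q
      have "q + (j - r) = j + q - r" using r by simp
      then have eq: "monom 1 q * (monom 1 (j - r) * M) = monom 1 (j + q - r) * M"
        by (simp add: mult.assoc[symmetric] mult_monom)
      show "coeff p q * Lf d c (monom 1 q * (monom 1 (j - r) * M)) =
          Lf d c (monom 1 (j + q - r) * M) * coeff p q"
        unfolding eq by (rule mult.commute)
    qed
    finally show "(\<Sum>q<Suc j. Lf d c (monom 1 (j + q - r) * M) * coeff p q) = 0"
      by (simp add: lessThan_Suc_atMost)
  qed
  then show ?thesis using assms(2) by (metis leading_coeff_0_iff less_Suc_eq_le)
qed

text \<open>A Bezout decomposition for the coprime polynomials \<open>f\<close> and
  \<open>[:b, a:] ^ n\<close> with explicit degree bounds. It is built one factor at a time, which
  keeps the bounds in terms of \<open>r\<close> even when \<open>degree f < r\<close>.\<close>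

lemma division_by_linear_power:
  fixes f p :: "real poly"
  assumes "poly f (- b / a) \<noteq> 0" "a \<noteq> 0" "degree f \<le> r" "degree p < r + n" "0 < r"
  shows "\<exists>\<delta> \<gamma>. p = f * \<delta> + [:b, a:] ^ n * \<gamma> \<and> degree \<gamma> < r \<and> (\<delta> = 0 \<or> degree \<delta> < n)"
  using assms(4)
proof (induction n arbitrary: p)
  case 0
  then show ?case by (intro exI[of _ 0] exI[of _ p]) simp
next
  case (Suc n)
  \<comment> \<open>Subtracting this multiple of \<open>f\<close> creates a zero at the root of the
    linear factor, which can then be divided out.\<close>
  define e where "e = poly p (- b / a) / poly f (- b / a)"
  have "poly (p - smult e f) (- b / a) = 0" using assms(1) by (simp add: e_def)
  then have "[:- (- b / a), 1:] dvd p - smult e f" by (simp only: poly_eq_0_iff_dvd)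
  then obtain q' where q': "p - smult e f = [:b / a, 1:] * q'" by (auto elim!: dvdE)
  define q where "q = smult (1 / a) q'"
  have "[:b / a, 1:] * q' = [:b, a:] * q"
    using assms(2) by (simp add: q_def smult_add_right)
  with q' have q: "p = smult e f + [:b, a:] * q" by (metis add.commute diff_add_cancel)
  have "degree q < r + n"
  proof (cases "q = 0")
    case False
    have "degree ([:b, a:] * q) = Suc (degree q)"
      using False assms(2) by (subst degree_mult_eq) auto
    moreover have "[:b, a:] * q = p - smult e f" using q by simp
    moreover have "degree (p - smult e f) < r + Suc n"
      using Suc.prems assms(3) degree_smult_le[of e f] by (intro degree_diff_less) linarith+
    ultimately have "Suc (degree q) < r + Suc n" by (simp only:)
    then show ?thesis by simp
  qed (use \<open>0 < r\<close> in simp)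
  then obtain \<delta> \<gamma> where IH: "q = f * \<delta> + [:b, a:] ^ n * \<gamma>" "degree \<gamma> < r" "\<delta> = 0 \<or> degree \<delta> < n"
    using Suc.IH by blast
  have "p = f * ([:e:] + [:b, a:] * \<delta>) + [:b, a:] ^ Suc n * \<gamma>"
    using q IH(1) by (simp add: algebra_simps)
  moreover have "degree ([:e:] + [:b, a:] * \<delta>) < Suc n"
  proof -
    have "degree ([:b, a:] * \<delta>) \<le> n"
    proof (cases "\<delta> = 0")
      case False
      moreover have "degree [:b, a:] \<le> 1" by simp
      ultimately show ?thesis using degree_mult_le[of "[:b, a:]" \<delta>] IH(3) by linarith
    qed simp
    then have "degree ([:e:] + [:b, a:] * \<delta>) \<le> n" by (intro degree_add_le) auto
    then show ?thesis by simp
  qed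
  ultimately show ?case using IH(2) by blast
qed

text \<open>With l the linear form of primitivity, write p = f \<delta> + l ^ n \<gamma>. The first
  summand is annihilated together with \<open>f\<close>. Testing primitivity against the multipliers
  x ^ s l ^ (j - r) then puts \<gamma> into the kernel of a nonsingular section of degree r - 1, so
  that p is a multiple of \<open>f\<close>.\<close>

lemma annihilates_if_primitive:
  assumes "j \<le> i" "2 * i \<le> d" "a > 0" "b > 0" "degree p \<le> j"
    and f: "annihilates d c r f" "f \<noteq> 0" "0 < r" "r \<le> j"
    and regular: "\<And>M. pos_lin_prod (d - 2 * (r - 1)) M \<Longrightarrow>
      fdet (Suc (r - 1)) (\<lambda>p q. Lf d c (monom 1 (r - 1 + q - p) * M)) \<noteq> 0"
    and M: "pos_lin_prod (d - 2 * j) M"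
    and prim: "\<And>s. s < j \<Longrightarrow> Lf d c (monom 1 s * ([:b, a:] * M * p)) = 0"
  shows "annihilates d c j p"
proof -
  let ?l = "[:b, a:] :: real poly"
  have deg_f: "degree f \<le> r" using f(1) by (simp add: annihilates_def)
  have root: "poly f (- b / a) \<noteq> 0"
  proof
    assume "poly f (- b / a) = 0"
    then have "[:- (- b / a), 1:] dvd f" by (simp only: poly_eq_0_iff_dvd)
    then obtain q' where q': "f = [:b / a, 1:] * q'" by (auto elim!: dvdE)
    define q where "q = smult (1 / a) q'"
    have q: "f = ?l * q" using assms(3) unfolding q' by (simp add: q_def smult_add_right)
    have "q \<noteq> 0" using q \<open>f \<noteq> 0\<close> by auto
    then have "degree f = Suc (degree q)"
      unfolding q using assms(3) by (subst degree_mult_eq) auto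
    then have "degree q \<le> r - 1" using deg_f by simp
    \<comment> \<open>One of these factors turns \<open>q\<close> into \<open>f\<close>; the
      remaining \<open>d - 2 * r + 1\<close> only multiply the annihilator.\<close>
    have e: "d - 2 * (r - 1) = Suc (d - 2 * r + 1)" using assms(1,2) f(3,4) by linarith
    have pl: "pos_lin_prod (d - 2 * (r - 1)) (?l ^ (d - 2 * (r - 1)))"
      using assms by (intro pos_lin_prod_power)
    have "q = 0"
    proof (rule section_kernel[OF regular[OF pl]])
      fix s assume s: "s \<le> r - 1"
      have "monom 1 s * (?l ^ (d - 2 * (r - 1)) * q) = (monom 1 s * ?l ^ (d - 2 * r + 1)) * f"
        unfolding e q by (simp only: power_Suc mult_ac)
      moreover have "degree (monom 1 s * ?l ^ (d - 2 * r + 1)) + r \<le> d"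
      proof -
        have "degree (?l ^ (d - 2 * r + 1)) \<le> d - 2 * r + 1"
          by (rule pos_lin_prod_degree[OF pos_lin_prod_power]) fact+
        moreover have "degree (monom 1 s * ?l ^ (d - 2 * r + 1)) \<le> s + degree (?l ^ (d - 2 * r + 1))"
          using degree_mult_le[of "monom 1 s" "?l ^ (d - 2 * r + 1)"] by (simp add: degree_monom_eq)
        ultimately show ?thesis using s assms(1,2) f(3,4) by linarith
      qed
      ultimately show "Lf d c (monom 1 s * (?l ^ (d - 2 * (r - 1)) * q)) = 0"
        using annihilates_mult[OF f(1)] by (simp only:)
    qed fact
    then show False using \<open>q \<noteq> 0\<close> by simp
  qed
  \<comment> \<open>The least exponent for which the division applies to all \<open>p\<close> of
    degree at most \<open>j\<close>.\<close>
  define n where "n = j - r + 1"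
  have "degree p < r + n" using assms(5) f(4) by (simp add: n_def)
  then obtain \<delta> \<gamma> where decomp: "p = f * \<delta> + ?l ^ n * \<gamma>" "degree \<gamma> < r" "\<delta> = 0 \<or> degree \<delta> < n"
    using division_by_linear_power[OF root _ deg_f] assms(3) f(3) by blast
  have deg_\<delta>: "degree \<delta> \<le> j - r" using decomp(3) by (auto simp: n_def)
  have prim': "Lf d c (q * (?l * M * p)) = 0" if "degree q < j" for q
    unfolding Lf_mult_expand[OF order_refl, of _ _ q "?l * M * p"]
    by (rule sum.neutral) (use prim that in auto)
  \<comment> \<open>The number of linear factors is (j - r) + 1 + (d - 2 j) + (j - r + 1) = d - 2 (r
    - 1), as a section of degree r - 1 requires.\<close>
  define M' where "M' = ?l ^ (j - r) * (?l * M) * ?l ^ n"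
  have M': "pos_lin_prod (d - 2 * (r - 1)) M'"
  proof -
    have "pos_lin_prod (j - r + Suc (d - 2 * j) + n) M'"
      unfolding M'_def using assms
      by (intro pos_lin_prod_mult pos_lin_prod_power pos_lin_prod.lin)
    also have "j - r + Suc (d - 2 * j) + n = d - 2 * (r - 1)"
      using assms(1,2) f(3,4) by (simp add: n_def)
    finally show ?thesis .
  qed
  have deg_l: "degree (?l ^ k) \<le> k" for k
    by (rule pos_lin_prod_degree[OF pos_lin_prod_power]) fact+
  have "\<gamma> = 0"
  proof (rule section_kernel[OF regular[OF M']])
    show "degree \<gamma> \<le> r - 1" using decomp(2) by simp
    fix s assume s: "s \<le> r - 1"
    let ?q = "monom 1 s * ?l ^ (j - r)"
    have deg_q: "degree ?q \<le> s + (j - r)"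
      using degree_mult_le[of "monom 1 s" "?l ^ (j - r)"] deg_l[of "j - r"]
      by (simp add: degree_monom_eq)
    then have "degree ?q < j" using s f(3,4) by linarith
    then have "0 = Lf d c (?q * (?l * M * p))" using prim' by simp
    also have "?q * (?l * M * p) = (?q * (?l * M) * \<delta>) * f + monom 1 s * (M' * \<gamma>)"
      unfolding decomp(1) M'_def by (simp only: distrib_left mult_ac)
    also have "Lf d c \<dots> = Lf d c (monom 1 s * (M' * \<gamma>))"
    proof -
      have "degree (?q * (?l * M) * \<delta>) \<le> degree ?q + (degree ?l + degree M) + degree \<delta>"
        by (meson add_mono degree_mult_le le_trans order_refl)
      moreover have "degree M \<le> d - 2 * j" using pos_lin_prod_degree[OF M] .
      moreover have "degree ?l \<le> 1" by simp
      ultimately have "degree (?q * (?l * M) * \<delta>) + r \<le> d"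
        using deg_q deg_\<delta> s assms(1,2) f(3,4) by linarith
      then show ?thesis using annihilates_mult[OF f(1)] by (simp only: Lf_add)
    qed
    finally show "Lf d c (monom 1 s * (M' * \<gamma>)) = 0" by simp
  qed
  then have p: "p = f * \<delta>" using decomp(1) by simp
  show ?thesis
    unfolding annihilates_def
  proof (intro conjI allI impI)
    fix s assume s: "s + j \<le> d"
    have "degree (monom 1 s * \<delta>) \<le> s + degree \<delta>"
      using degree_mult_le[of "monom 1 s" \<delta>] by (simp add: degree_monom_eq)
    then have "degree (monom 1 s * \<delta>) + r \<le> d" using deg_\<delta> s f(4) by linarith
    then have "Lf d c ((monom 1 s * \<delta>) * f) = 0" by (rule annihilates_mult[OF f(1)])
    then show "Lf d c (monom 1 s * p) = 0" unfolding p by (simp add: mult_ac)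
  qed fact
qed

theorem toeplitz_nonneg_imp_hodge_riemann:
  assumes "toeplitz_nonneg d i c" "2 * i \<le> d"
  shows "hodge_riemann d i c"
  unfolding hodge_riemann_def
proof (intro allI impI)
  fix j M a b p
  assume j: "j \<le> i" and M: "pos_lin_prod (d - 2 * j) M" and ab: "(0 :: real) < a" "(0 :: real) < b"
    and p: "degree p \<le> j" "\<not> annihilates d c j p"
    and prim: "\<forall>s<j. Lf d c (monom 1 s * ([:b, a:] * M * p)) = 0"
  show "(-1) ^ j * Lf d c (M * p * p) > 0"
  proof (cases "\<exists>r f. r \<le> j \<and> f \<noteq> 0 \<and> annihilates d c r f")
    case True
    then obtain r where r: "r \<le> j" "\<exists>f. f \<noteq> 0 \<and> annihilates d c r f"
      and least: "\<And>r'. r' < r \<Longrightarrow> \<not> (r' \<le> j \<and> (\<exists>f. f \<noteq> 0 \<and> annihilates d c r' f))"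
      using exists_least_iff[of "\<lambda>r. r \<le> j \<and> (\<exists>f. f \<noteq> 0 \<and> annihilates d c r f)"] by blast
    then obtain f where f: "f \<noteq> 0" "annihilates d c r f" by blast
    have "annihilates d c j p"
    proof (cases "r = 0")
      \<comment> \<open>A nonzero constant annihilator means that the functional is zero, so every
        \<open>p\<close> annihilates; there is no degree r - 1 to descend to.\<close>
      case True
      then obtain e where e: "f = [:e:]" using f(2) degree_eq_zeroE by (auto simp: annihilates_def)
      with f(1) have "e \<noteq> 0" by simp
      show ?thesis
        unfolding annihilates_def
      proof (intro conjI allI impI)
        fix s assume s: "s + j \<le> d"
        have "degree (monom 1 s * p) \<le> s + degree p"
          using degree_mult_le[of "monom 1 s" p] by (simp add: degree_monom_eq)
        then have "Lf d c (monom 1 s * p * f) = 0"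
          using s p True by (intro annihilates_mult[OF f(2)]) linarith
        then show "Lf d c (monom 1 s * p) = 0" using \<open>e \<noteq> 0\<close> by (simp add: e Lf_smult)
      qed fact
    next
      case False
      \<comment> \<open>Minimality of \<open>r\<close> is what makes the sections of degree
        \<open>r - 1\<close> nonsingular.\<close>
      have no_ann: "q = 0" if "annihilates d c (r - 1) q" for q
        using least[of "r - 1"] r(1) False that by auto
      have r1: "r - 1 \<le> i" using r(1) j by simp
      show ?thesis
      proof (rule annihilates_if_primitive[OF j assms(2) ab p(1) f(2,1)])
        show "fdet (Suc (r - 1)) (\<lambda>p q. Lf d c (monom 1 (r - 1 + q - p) * M)) \<noteq> 0"
          if "pos_lin_prod (d - 2 * (r - 1)) M" for M
          using toeplitz_section_minors(1)[OF assms(1) r1 assms(2) no_ann that] by simp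
      qed (use False r prim M in auto)
    qed
    then show ?thesis using p(2) by contradiction
  next
    case False
    then have no_ann: "q = 0" if "annihilates d c j q" for q using that by blast
    have "p \<noteq> 0"
    proof
      assume "p = 0"
      then show False using p(2) by (simp add: annihilates_def)
    qed
    show ?thesis
      by (rule toeplitz_primitive_sign[OF _ _ ab p(1) \<open>p \<noteq> 0\<close>])
         (use toeplitz_section_minors[OF assms(1) j assms(2) no_ann M] prim in auto)
  qed
qed

section \<open>Limits of strictly positive sequences are totally nonnegative\<close>

text \<open>\<open>n\<close> bounds the sizes of the sections, so that \<open>n = 0\<close> is a
  vacuous start for inductions and the condition up to degree i reads \<open>Suc i\<close>. The
  indices in a section run from \<open>a\<close> to \<open>a + 2 * j\<close>.\<close>

definition strict_toeplitz :: "nat \<Rightarrow> nat \<Rightarrow> (nat \<Rightarrow> real) \<Rightarrow> bool" where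
  "strict_toeplitz d n c \<longleftrightarrow>
    (\<forall>j<n. \<forall>a. a + 2 * j \<le> d \<longrightarrow> fdet (Suc j) (\<lambda>p q. c (a + j + q - p)) > 0)"

definition toeplitz_limit :: "nat \<Rightarrow> nat \<Rightarrow> (nat \<Rightarrow> real) \<Rightarrow> bool" where
  "toeplitz_limit d i c \<longleftrightarrow>
    (\<forall>e>0. \<exists>c'. strict_toeplitz d (Suc i) c' \<and> (\<forall>k\<le>d. \<bar>c' k - c k\<bar> < e))"

text \<open>Contiguous blocks of a Toeplitz matrix are again Toeplitz, hence sections of smaller
  size, so Fekete's criterion applies.\<close>

lemma strict_toeplitz_minor_pos:
  assumes "strict_toeplitz d (Suc i) c" "j \<le> i" "2 * i \<le> d"
    and f: "strict_mono_on {..<n} f" "\<And>k. k < n \<Longrightarrow> f k \<le> j"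
    and g: "strict_mono_on {..<n} g" "\<And>k. k < n \<Longrightarrow> g k \<le> d - j"
  shows "fdet n (\<lambda>p q. c (j + g q - f p)) > 0"
proof (rule fekete[where A = "\<lambda>p q. c (j + q - p)" and R = "Suc j" and C = "Suc (d - j)"])
  fix m r s assume m: "m \<le> n" "r + m \<le> Suc j" "s + m \<le> Suc (d - j)"
  show "fdet m (\<lambda>p q. c (j + (s + q) - (r + p))) > 0"
  proof (cases m)
    case (Suc k)
    \<comment> \<open>The index in the lower left corner of the block, the smallest one that
      occurs.\<close>
    define a where "a = j + s - r - k"
    have "a + 2 * k \<le> d" using m assms(2,3) Suc by (simp add: a_def)
    moreover have "k < Suc i" using m Suc assms(2) by simp
    ultimately have "fdet (Suc k) (\<lambda>p q. c (a + k + q - p)) > 0"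
      using assms(1) unfolding strict_toeplitz_def by blast
    also have "fdet (Suc k) (\<lambda>p q. c (a + k + q - p)) = fdet m (\<lambda>p q. c (j + (s + q) - (r + p)))"
      unfolding Suc
    proof (rule fdet_cong)
      fix p q assume "p < Suc k"
      then have "a + k + q - p = j + (s + q) - (r + p)" using m Suc by (simp add: a_def)
      then show "c (a + k + q - p) = c (j + (s + q) - (r + p))" by simp
    qed
    finally show ?thesis .
  qed simp
qed (use f g in \<open>auto simp: less_Suc_eq_le\<close>)

theorem toeplitz_limit_imp_nonneg:
  assumes "toeplitz_limit d i c" "2 * i \<le> d"
  shows "toeplitz_nonneg d i c"
  unfolding toeplitz_nonneg_def
proof (intro allI impI)
  fix j n :: nat and f g :: "nat \<Rightarrow> nat"
  assume j: "j \<le> i" and f: "strict_mono_on {..<n} f" "\<forall>k<n. f k \<le> j"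
    and g: "strict_mono_on {..<n} g" "\<forall>k<n. g k \<le> d - j"
  have "\<exists>c'. strict_toeplitz d (Suc i) c' \<and> (\<forall>k\<le>d. \<bar>c' k - c k\<bar> < 1 / real (Suc N))" for N
    using assms(1) unfolding toeplitz_limit_def by (metis of_nat_0_less_iff zero_less_Suc zero_less_divide_1_iff)
  then obtain C where C: "strict_toeplitz d (Suc i) (C N)" "k \<le> d \<Longrightarrow> \<bar>C N k - c k\<bar> < 1 / real (Suc N)"
    for N k by metis
  have lim: "(\<lambda>N. C N k) \<longlonglongrightarrow> c k" if "k \<le> d" for k
  proof (rule LIMSEQ_I)
    fix r :: real assume "r > 0"
    then obtain N0 where N0: "1 / real (Suc N0) < r" using nat_approx_posE by blast
    have "norm (C N k - c k) < r" if "N \<ge> N0" for N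
    proof -
      have "1 / real (Suc N) \<le> 1 / real (Suc N0)" using that by (simp add: frac_le)
      then show ?thesis using C(2)[OF \<open>k \<le> d\<close>, of N] N0 by simp
    qed
    then show "\<exists>no. \<forall>N\<ge>no. norm (C N k - c k) < r" by blast
  qed
  have "(\<lambda>N. fdet n (\<lambda>p q. C N (j + g q - f p))) \<longlonglongrightarrow> fdet n (\<lambda>p q. c (j + g q - f p))"
  proof (rule tendsto_fdet, rule lim)
    fix p q assume "p < n" "q < n"
    then show "j + g q - f p \<le> d" using g(2) j assms(2) by fastforce
  qed
  moreover have "fdet n (\<lambda>p q. C N (j + g q - f p)) \<ge> 0" for N
    using strict_toeplitz_minor_pos[OF C(1) j assms(2) f(1) _ g(1)] f(2) g(2)
    by (meson less_imp_le)
  ultimately show "fdet n (\<lambda>p q. c (j + g q - f p)) \<ge> 0"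
    by (meson LIMSEQ_le_const)
qed

section \<open>A Moebius substitution moving the boundary of the cone into its interior\<close>

text \<open>The substitution x -> x + e y, y -> e x + y on binary forms of degree \<open>n\<close>,
  dehomogenized. For \<open>e > 0\<close> it sends the boundary forms x and y into the open
  cone.\<close>

definition moebius :: "real \<Rightarrow> nat \<Rightarrow> real poly \<Rightarrow> real poly" where
  "moebius e n p = (\<Sum>k\<le>n. smult (coeff p k) ([:e, 1:] ^ k * [:1, e:] ^ (n - k)))"

text \<open>The pullback of the functional along the substitution, evaluated on monomials.\<close>

definition moebius_seq :: "real \<Rightarrow> nat \<Rightarrow> (nat \<Rightarrow> real) \<Rightarrow> nat \<Rightarrow> real" where
  "moebius_seq e d c k = Lf d c ([:e, 1:] ^ k * [:1, e:] ^ (d - k))"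

lemma Lf_moebius: "Lf d (moebius_seq e d c) p = Lf d c (moebius e d p)"
  unfolding moebius_def Lf_sum Lf_smult by (simp add: Lf_def[of d "moebius_seq e d c"] moebius_seq_def)

lemma poly_moebius:
  assumes "degree p \<le> n" "1 + e * z \<noteq> 0"
  shows "poly (moebius e n p) z = (1 + e * z) ^ n * poly p ((e + z) / (1 + e * z))"
proof -
  have "poly (moebius e n p) z = (\<Sum>k\<le>n. coeff p k * ((e + z) ^ k * (1 + e * z) ^ (n - k)))"
    by (simp add: moebius_def poly_sum poly_mult poly_power mult.commute[of e])
  also have "\<dots> = (\<Sum>k\<le>n. (1 + e * z) ^ n * (coeff p k * ((e + z) / (1 + e * z)) ^ k))"
  proof (intro sum.cong refl)
    fix k assume "k \<in> {..n}"
    then have "(1 + e * z) ^ n = (1 + e * z) ^ (n - k) * (1 + e * z) ^ k"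
      by (simp add: power_add[symmetric])
    then show "coeff p k * ((e + z) ^ k * (1 + e * z) ^ (n - k)) =
        (1 + e * z) ^ n * (coeff p k * ((e + z) / (1 + e * z)) ^ k)"
      using assms(2) by (simp add: power_divide)
  qed
  also have "\<dots> = (1 + e * z) ^ n * poly p ((e + z) / (1 + e * z))"
    using arg_cong[OF poly_as_sum_of_monoms'[OF assms(1)], of "\<lambda>p. poly p ((e + z) / (1 + e * z))"]
    by (simp only: poly_sum poly_monom sum_distrib_left[symmetric])
  finally show ?thesis .
qed

text \<open>The substitution is a fractional linear change of variable only where 1 + e z is
  nonzero. On (0, 1) this holds, and infinitely many points determine a polynomial.\<close>

lemma poly_eqI_unit_interval:
  fixes p q :: "real poly"
  assumes "\<And>z. 0 < z \<Longrightarrow> z < 1 \<Longrightarrow> poly p z = poly q z"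
  shows "p = q"
proof (rule ccontr)
  assume "p \<noteq> q"
  then have "finite {z. poly (p - q) z = 0}" by (intro poly_roots_finite) simp
  moreover have "{0<..<1} \<subseteq> {z. poly (p - q) z = 0}" using assms by auto
  ultimately have "finite {0<..<1 :: real}" by (rule rev_finite_subset)
  then show False using infinite_Ioo[of "0 :: real" 1] by simp
qed

lemma moebius_denominator_pos:
  fixes e z :: real
  assumes "\<bar>e\<bar> < 1" "0 < z" "z < 1"
  shows "1 + e * z > 0"
proof -
  have "\<bar>e\<bar> * z \<le> 1 * z" using assms by (intro mult_right_mono) auto
  moreover have "\<bar>e * z\<bar> = \<bar>e\<bar> * z" using assms by (simp add: abs_mult)
  ultimately show ?thesis using assms(3) by linarith
qed

lemma degree_moebius: "degree (moebius e n p) \<le> n"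
  unfolding moebius_def
proof (intro degree_sum_le)
  fix k assume "k \<in> {..n}"
  have "degree ([:e, 1:] ^ k) \<le> k" "degree ([:1, e:] ^ (n - k)) \<le> n - k"
    using degree_power_le[of "[:e, 1:]" k] degree_power_le[of "[:1, e:]" "n - k"]
    by (auto split: if_splits)
  then have "degree ([:e, 1:] ^ k * [:1, e:] ^ (n - k)) \<le> k + (n - k)"
    by (meson add_mono degree_mult_le le_trans)
  then show "degree (smult (coeff p k) ([:e, 1:] ^ k * [:1, e:] ^ (n - k))) \<le> n"
    using \<open>k \<in> {..n}\<close> by (intro order_trans[OF degree_smult_le]) simp
qed simp

lemma moebius_mult:
  assumes "\<bar>e\<bar> < 1" "degree p \<le> n" "degree q \<le> m"
  shows "moebius e (n + m) (p * q) = moebius e n p * moebius e m q"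
proof (rule poly_eqI_unit_interval)
  fix z :: real assume "0 < z" "z < 1"
  then have "1 + e * z \<noteq> 0" using moebius_denominator_pos[OF assms(1)] by fastforce
  moreover have "degree (p * q) \<le> n + m"
    using degree_mult_le[of p q] assms(2,3) by linarith
  ultimately show "poly (moebius e (n + m) (p * q)) z = poly (moebius e n p * moebius e m q) z"
    using assms(2,3) by (simp add: poly_moebius poly_mult power_add)
qed

text \<open>The matrices with rows (1, e), (e, 1) and (1, -e), (-e, 1) multiply to (1 - e^2) times
  the identity, which acts on forms of degree \<open>n\<close> by the power \<open>n\<close> of that
  scalar.\<close>

lemma moebius_inverse:
  assumes "\<bar>e\<bar> < 1" "degree p \<le> n"
  shows "moebius e n (moebius (- e) n p) = smult ((1 - e\<^sup>2) ^ n) p"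
proof (rule poly_eqI_unit_interval)
  fix z :: real assume z: "0 < z" "z < 1"
  define D where "D = 1 + e * z"
  have D: "D \<noteq> 0" using moebius_denominator_pos[OF assms(1) z] by (simp add: D_def)
  define w where "w = (e + z) / D"
  have "e\<^sup>2 < 1" using assms(1) by (simp add: abs_square_less_1)
  have Dw: "D * (1 + - e * w) = 1 - e\<^sup>2"
    using D by (simp add: w_def field_simps) (simp add: D_def power2_eq_square algebra_simps)
  then have ne: "1 + - e * w \<noteq> 0" using \<open>e\<^sup>2 < 1\<close> by auto
  have "D * (- e + w) = (1 - e\<^sup>2) * z"
    using D by (simp add: w_def field_simps) (simp add: D_def power2_eq_square algebra_simps)
  also have "\<dots> = D * ((1 + - e * w) * z)" using Dw by (simp add: mult.assoc)
  finally have "- e + w = (1 + - e * w) * z" using D by simp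
  then have quot: "(- e + w) / (1 + - e * w) = z" using ne by simp
  have "poly (moebius e n (moebius (- e) n p)) z = D ^ n * poly (moebius (- e) n p) w"
    using poly_moebius[OF degree_moebius, of e z n "- e" p] D by (simp add: D_def w_def)
  also have "\<dots> = D ^ n * ((1 + - e * w) ^ n * poly p z)"
    using poly_moebius[OF assms(2), of "- e" w] ne quot by simp
  also have "\<dots> = (1 - e\<^sup>2) ^ n * poly p z"
    by (simp only: mult.assoc[symmetric] power_mult_distrib[symmetric] Dw)
  finally show "poly (moebius e n (moebius (- e) n p)) z = poly (smult ((1 - e\<^sup>2) ^ n) p) z"
    by simp
qed

lemma moebius_nonzero:
  assumes "\<bar>e\<bar> < 1" "degree p \<le> n" "p \<noteq> 0"
  shows "moebius e n p \<noteq> 0"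
proof
  assume "moebius e n p = 0"
  then have "smult ((1 - e\<^sup>2) ^ n) p = 0"
    using moebius_inverse[of "- e" p n] assms by (simp add: moebius_def)
  moreover have "e\<^sup>2 < 1" using assms(1) by (simp add: abs_square_less_1)
  ultimately show False using assms(3) by simp
qed

lemma moebius_monom: "k \<le> n \<Longrightarrow> moebius e n (monom 1 k) = [:e, 1:] ^ k * [:1, e:] ^ (n - k)"
  by (simp add: moebius_def if_distrib[of "\<lambda>x. smult x _"] cong: if_cong)

text \<open>The functional is pulled back, so annihilators move by the inverse substitution;
  substituting again returns a multiple of \<open>f\<close>. This keeps the minimal annihilator
  available for the perturbation.\<close>

lemma annihilates_moebius:
  assumes "annihilates d c m f" "\<bar>e\<bar> < 1"
  shows "annihilates d (moebius_seq e d c) m (moebius (- e) m f)"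
  unfolding annihilates_def
proof (intro conjI allI impI degree_moebius)
  fix s assume s: "s + m \<le> d"
  have f: "degree f \<le> m" using assms(1) by (simp add: annihilates_def)
  have "moebius e ((d - m) + m) (monom 1 s * moebius (- e) m f) =
      moebius e (d - m) (monom 1 s) * moebius e m (moebius (- e) m f)"
    by (rule moebius_mult[OF assms(2)]) (use s in \<open>auto simp: degree_monom_eq degree_moebius\<close>)
  then have "Lf d (moebius_seq e d c) (monom 1 s * moebius (- e) m f) =
      (1 - e\<^sup>2) ^ m * Lf d c (moebius e (d - m) (monom 1 s) * f)"
    using s by (simp add: Lf_moebius moebius_inverse[OF assms(2) f] Lf_smult)
  also have "Lf d c (moebius e (d - m) (monom 1 s) * f) = 0"
    using s degree_moebius[of e "d - m" "monom 1 s"] by (intro annihilates_mult[OF assms(1)]) simp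
  finally show "Lf d (moebius_seq e d c) (monom 1 s * moebius (- e) m f) = 0" by simp
qed

lemma tendsto_coeff_mult:
  assumes "\<And>m. ((\<lambda>x. coeff (P x) m) \<longlongrightarrow> coeff p m) Fl" "\<And>m. ((\<lambda>x. coeff (Q x) m) \<longlongrightarrow> coeff q m) Fl"
  shows "((\<lambda>x. coeff (P x * Q x :: real poly) m) \<longlongrightarrow> coeff (p * q) m) Fl"
  unfolding coeff_mult by (intro tendsto_intros assms)

lemma tendsto_coeff_power:
  assumes "\<And>m. ((\<lambda>x. coeff (P x) m) \<longlongrightarrow> coeff p m) Fl"
  shows "((\<lambda>x. coeff (P x ^ n :: real poly) m) \<longlongrightarrow> coeff (p ^ n) m) Fl"
proof (induction n arbitrary: m)
  case (Suc n)
  show ?case unfolding power_Suc by (rule tendsto_coeff_mult[OF assms Suc.IH])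
qed simp

lemma tendsto_moebius_seq:
  assumes "k \<le> d"
  shows "((\<lambda>e. moebius_seq e d c k) \<longlongrightarrow> c k) (at_right 0)"
proof -
  have lin: "((\<lambda>e. coeff [:e, 1:] m) \<longlongrightarrow> coeff [:0, 1:] m) (at_right (0 :: real))"
    "((\<lambda>e. coeff [:1, e:] m) \<longlongrightarrow> coeff [:1, 0:] m) (at_right (0 :: real))" for m
    by (cases m; cases "m - 1"; auto intro!: tendsto_intros)+
  have "((\<lambda>e. moebius_seq e d c k) \<longlongrightarrow> Lf d c ([:0, 1:] ^ k * [:1, 0:] ^ (d - k))) (at_right 0)"
    unfolding moebius_seq_def Lf_def
    by (intro tendsto_intros tendsto_coeff_mult tendsto_coeff_power lin)
  also have "[:0, 1:] ^ k * [:1, 0:] ^ (d - k) = (monom 1 k :: real poly)"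
    by (simp add: monom_altdef flip: one_pCons)
  also have "Lf d c (monom 1 k) = c k" using assms by (simp add: Lf_monom)
  finally show ?thesis .
qed

section \<open>The Hodge--Riemann relations imply strict positivity after the substitution\<close>

lemma coeff_sum_monom:
  fixes v :: "nat \<Rightarrow> 'a :: comm_monoid_add"
  shows "coeff (\<Sum>q<n. monom (v q) q) m = (if m < n then v m else 0)"
  by (simp add: coeff_sum)

text \<open>Pairing the cofactor polynomial with exponent \<open>a + k\<close> expands row
  \<open>j - k\<close> along the cofactors of row 0, so every row but the top one gives
  zero.\<close>

lemma Lf_cofactor_poly:
  fixes c :: "nat \<Rightarrow> real"
  assumes "a + 2 * j \<le> d" "k \<le> j"
  defines "T \<equiv> \<lambda>p q. c (a + j + q - p)"
  shows "Lf d c (monom 1 (a + k) * (\<Sum>q<Suc j. monom (cof j T 0 q) q)) =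
    (if k = j then fdet (Suc j) T else 0)"
proof -
  let ?\<alpha> = "\<Sum>q<Suc j. monom (cof j T 0 q) q"
  have "degree ?\<alpha> \<le> j"
    by (intro degree_sum_le) (auto intro: order_trans[OF degree_monom_le])
  then have "Lf d c (monom 1 (a + k) * ?\<alpha>) = (\<Sum>q\<le>j. coeff ?\<alpha> q * c (a + k + q))"
    using assms by (intro Lf_shift) auto
  also have "\<dots> = (\<Sum>q<Suc j. T (j - k) q * cof j T 0 q)"
    unfolding lessThan_Suc_atMost[symmetric]
    by (intro sum.cong refl) (use assms(2) in \<open>auto simp: coeff_sum_monom T_def algebra_simps simp del: sum.lessThan_Suc\<close>)
  also have "\<dots> = (if k = j then fdet (Suc j) T else 0)"
    using fdet_expand_row[of 0 j T] fdet_expand_alien_row[of 0 j "j - k" T] assms(2)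
    by (auto simp del: sum.lessThan_Suc)
  finally show ?thesis .
qed

text \<open>Deleting the first row and the last column of a section leaves the section with the same
  offset \<open>a\<close> and size one less.\<close>

lemma lower_section_pos:
  assumes "strict_toeplitz d j c" "a + 2 * j \<le> d"
  shows "fdet j (\<lambda>p q. c (a + j + q - Suc p)) > 0"
proof (cases j)
  case (Suc k)
  then have "fdet (Suc k) (\<lambda>p q. c (a + k + q - p)) > 0"
    using assms unfolding strict_toeplitz_def by simp
  then show ?thesis unfolding Suc by simp
qed simp

lemma cof_last:
  "cof j T 0 j = (-1) ^ j * fdet j (\<lambda>p q. T (Suc p) q)"
  unfolding cof_def by (simp cong: fdet_cong)

text \<open>The cofactors of the top row of a Toeplitz section form a primitive element, and the
  quadratic form takes there the value \<open>(-1) ^ j\<close> times the product of the section with the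
  next smaller one.\<close>

lemma hodge_riemann_imp_strict_toeplitz:
  assumes hr: "hodge_riemann d i c" and "2 * i \<le> d" "0 < e" "e < 1" "m \<le> Suc i"
    and no_ann: "\<And>j f. j < m \<Longrightarrow> annihilates d c j f \<Longrightarrow> f = 0"
  shows "strict_toeplitz d m (moebius_seq e d c)"
  using assms(5,6)
proof (induction m)
  case 0
  then show ?case by (simp add: strict_toeplitz_def)
next
  case (Suc j)
  define c' where "c' = moebius_seq e d c"
  have IH: "strict_toeplitz d j c'"
    unfolding c'_def
  proof (rule Suc.IH)
    show "f = 0" if "k < j" "annihilates d c k f" for k f
      using Suc.prems(2)[of k f] that by simp
  qed (use Suc.prems(1) in simp)
  have e: "\<bar>e\<bar> < 1" using assms by simp
  have "fdet (Suc j) (\<lambda>p q. c' (a + j + q - p)) > 0" if a: "a + 2 * j \<le> d" for a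
  proof -
    define T where "T = (\<lambda>p q. c' (a + j + q - p))"
    define \<alpha> where "\<alpha> = (\<Sum>q<Suc j. monom (cof j T 0 q) q)"
    define D0 where "D0 = fdet j (\<lambda>p q. c' (a + j + q - Suc p))"
    have D0: "D0 > 0" unfolding D0_def by (rule lower_section_pos[OF IH a])
    have deg: "degree \<alpha> \<le> j"
      unfolding \<alpha>_def by (intro degree_sum_le) (auto intro: order_trans[OF degree_monom_le])
    have coeff_j: "coeff \<alpha> j = (-1) ^ j * D0"
      unfolding \<alpha>_def coeff_sum_monom by (simp add: cof_last D0_def T_def)
    have row: "Lf d c' (monom 1 (a + k) * \<alpha>) = (if k = j then fdet (Suc j) T else 0)" if "k \<le> j" for k
      unfolding \<alpha>_def T_def by (rule Lf_cofactor_poly[OF a that])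
    have shift: "Lf d c' (q * (monom 1 a * \<alpha>)) = coeff q j * fdet (Suc j) T" if "degree q \<le> j" for q
    proof -
      have "Lf d c' (q * (monom 1 a * \<alpha>)) = (\<Sum>k\<le>j. coeff q k * Lf d c' (monom 1 k * (monom 1 a * \<alpha>)))"
        by (rule Lf_mult_expand[OF that])
      also have "\<dots> = (\<Sum>k\<le>j. coeff q k * Lf d c' (monom 1 (a + k) * \<alpha>))"
        by (intro sum.cong refl) (simp add: mult.assoc[symmetric] mult_monom add.commute)
      also have "\<dots> = (\<Sum>k\<le>j. if k = j then coeff q j * fdet (Suc j) T else 0)"
        by (intro sum.cong refl) (simp add: row)
      finally show ?thesis by simp
    qed
    define P where "P = moebius e j \<alpha>"
    \<comment> \<open>The image of the boundary product x^a y^(d - 2 j - a). The form defining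
      primitivity will be \<open>[:1, e:]\<close>, the image of y.\<close>
    define M where "M = [:e, 1:] ^ a * [:1, e:] ^ (d - 2 * j - a)"
    have M: "pos_lin_prod (d - 2 * j) M"
    proof -
      have "pos_lin_prod (a + (d - 2 * j - a)) M"
        unfolding M_def using assms(3) by (intro pos_lin_prod_mult pos_lin_prod_power) auto
      then show ?thesis using a by simp
    qed
    have M_moebius: "M = moebius e (d - 2 * j) (monom 1 a)"
      unfolding M_def using a by (subst moebius_monom) auto
    have lM_moebius: "[:1, e:] * M = moebius e (Suc (d - 2 * j)) (monom 1 a)"
    proof -
      have "Suc (d - 2 * j) - a = Suc (d - 2 * j - a)" using a by simp
      then show ?thesis unfolding M_def using a by (subst moebius_monom) (auto simp: mult_ac simp del: mult_pCons_left mult_pCons_right)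
    qed
    have "\<alpha> \<noteq> 0" using coeff_j D0 by auto
    then have "P \<noteq> 0" unfolding P_def by (rule moebius_nonzero[OF e deg])
    have "(-1) ^ j * Lf d c (M * P * P) > 0"
    proof (rule hr[unfolded hodge_riemann_def, rule_format, OF _ M])
      show "j \<le> i" using Suc.prems by simp
      show "\<not> annihilates d c j P" using Suc.prems(2)[of j P] \<open>P \<noteq> 0\<close> by auto
      show "degree P \<le> j" unfolding P_def by (rule degree_moebius)
      show "e > 0" "(1 :: real) > 0" using assms by auto
      fix s assume s: "s < j"
      \<comment> \<open>A preimage, up to a scalar, of the test monomial of exponent
        \<open>s\<close>. It has degree at most \<open>j - 1\<close>, so its coefficient at
        \<open>j\<close>, the only one detected by \<open>\<alpha>\<close>, is zero.\<close>
      define Q where "Q = moebius (- e) (j - 1) (monom 1 s)"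
      have degQ: "degree Q \<le> j - 1" unfolding Q_def by (rule degree_moebius)
      have "moebius e (j - 1 + (Suc (d - 2 * j) + j)) (Q * (monom 1 a * \<alpha>)) =
          moebius e (j - 1) Q * (moebius e (Suc (d - 2 * j)) (monom 1 a) * moebius e j \<alpha>)"
      proof (subst moebius_mult[OF e degQ])
        show "degree (monom 1 a * \<alpha>) \<le> Suc (d - 2 * j) + j"
          using degree_mult_le[of "monom 1 a" \<alpha>] deg a by (simp add: degree_monom_eq)
        show "moebius e (j - 1) Q * moebius e (Suc (d - 2 * j) + j) (monom 1 a * \<alpha>) =
            moebius e (j - 1) Q * (moebius e (Suc (d - 2 * j)) (monom 1 a) * moebius e j \<alpha>)"
          by (subst moebius_mult[OF e _ deg]) (use a in \<open>auto simp: degree_monom_eq\<close>)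
      qed
      moreover have "j - 1 + (Suc (d - 2 * j) + j) = d" using s a by simp
      moreover have "moebius e (j - 1) Q = smult ((1 - e\<^sup>2) ^ (j - 1)) (monom 1 s)"
        unfolding Q_def using s by (intro moebius_inverse[OF e]) (simp add: degree_monom_eq)
      ultimately have "moebius e d (Q * (monom 1 a * \<alpha>)) =
          smult ((1 - e\<^sup>2) ^ (j - 1)) (monom 1 s * ([:1, e:] * M * P))"
        unfolding lM_moebius P_def by (simp only: mult_smult_left)
      then have "(1 - e\<^sup>2) ^ (j - 1) * Lf d c (monom 1 s * ([:1, e:] * M * P)) =
          Lf d c' (Q * (monom 1 a * \<alpha>))"
        unfolding c'_def Lf_moebius by (simp only: Lf_smult)
      also have "\<dots> = 0"
        using degQ s by (subst shift) (auto intro: coeff_eq_0)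
      finally show "Lf d c (monom 1 s * ([:1, e:] * M * P)) = 0"
        using e by (simp add: abs_square_eq_1 power2_eq_1_iff del: mult_pCons_left)
    qed
    also have "Lf d c (M * P * P) = Lf d c' (\<alpha> * (monom 1 a * \<alpha>))"
    proof -
      have "moebius e (j + (d - 2 * j + j)) (\<alpha> * (monom 1 a * \<alpha>)) = P * (M * P)"
      proof (subst moebius_mult[OF e deg])
        show "degree (monom 1 a * \<alpha>) \<le> d - 2 * j + j"
          using degree_mult_le[of "monom 1 a" \<alpha>] deg a by (simp add: degree_monom_eq)
        show "moebius e j \<alpha> * moebius e (d - 2 * j + j) (monom 1 a * \<alpha>) = P * (M * P)"
          unfolding P_def M_moebius
          by (subst moebius_mult[OF e _ deg]) (use a in \<open>auto simp: degree_monom_eq\<close>)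
      qed
      moreover have "j + (d - 2 * j + j) = d" using a by simp
      ultimately show ?thesis unfolding c'_def Lf_moebius by (simp add: mult_ac)
    qed
    also have "\<dots> = (-1) ^ j * D0 * fdet (Suc j) T" using shift[OF deg] coeff_j by simp
    finally have "((-1) ^ j * (-1) ^ j) * (D0 * fdet (Suc j) T) > 0" by (simp only: mult.assoc)
    then have "D0 * fdet (Suc j) T > 0"
      by (simp only: power_mult_distrib[symmetric]) simp
    then show ?thesis using D0 unfolding T_def by (simp add: zero_less_mult_iff)
  qed
  then show ?case
    using IH unfolding strict_toeplitz_def c'_def by (auto simp: less_Suc_eq)
qed

section \<open>Resolving degenerate sequences by geometric perturbations\<close>

lemma Lf_add_seq: "Lf d (\<lambda>k. c k + h * b k) p = Lf d c p + h * Lf d b p"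
  by (simp add: Lf_def distrib_left sum.distrib sum_distrib_left mult_ac)

text \<open>The geometric sequence represents evaluation at \<open>t\<close>.\<close>

lemma Lf_geometric:
  assumes "degree p \<le> d"
  shows "Lf d (\<lambda>k. t ^ k) p = poly p t"
  using arg_cong[OF poly_as_sum_of_monoms'[OF assms], of "\<lambda>p. poly p t"]
  by (simp add: Lf_def poly_sum poly_monom)

text \<open>Adding \<open>(-1) ^ m * \<delta> * t ^ k\<close> turns the annihilator \<open>f\<close> into \<open>(x - t) * f\<close>. To first order in
  \<open>\<delta>\<close>, the sections of size \<open>m + 1\<close>, which vanish for \<open>\<delta> = 0\<close>, become \<open>\<delta>\<close> times a positive
  multiple of sections of size \<open>m\<close>.\<close>

lemma geometric_perturbation:
  assumes strict: "strict_toeplitz d m c" and ann: "annihilates d c m f" and "f \<noteq> 0"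
    and "2 * m \<le> d" "\<epsilon> > 0"
  shows "\<exists>c' f'. strict_toeplitz d (Suc m) c' \<and> annihilates d c' (Suc m) f' \<and> f' \<noteq> 0 \<and>
    (\<forall>k\<le>d. \<bar>c' k - c k\<bar> < \<epsilon>)"
proof -
  have deg: "degree f \<le> m" using ann by (simp add: annihilates_def)
  have "finite {t. poly f t = 0}" using \<open>f \<noteq> 0\<close> by (rule poly_roots_finite)
  then have "\<not> {0<..} \<subseteq> {t. poly f t = 0}"
    using infinite_Ioi[of "0 :: real"] finite_subset by blast
  then obtain t where t: "t > 0" "poly f t \<noteq> 0" by auto
  define C where "C \<delta> k = c k + ((-1) ^ m * \<delta>) * t ^ k" for \<delta> k
  have C0: "C 0 = c" by (simp add: C_def fun_eq_iff)
  have lim: "((\<lambda>\<delta>. C \<delta> k) \<longlongrightarrow> c k) (at_right 0)" for k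
    unfolding C_def by (auto intro!: tendsto_eq_intros)
  \<comment> \<open>Chosen so that the section at offset \<open>a\<close>, multiplied by the square
    of \<open>coeff f m\<close>, equals \<open>\<delta> * t ^ a * W \<delta> a\<close> for every
    \<open>\<delta>\<close>. The sign question is thereby reduced to continuity at
    \<open>\<delta> = 0\<close>.\<close>
  define W where "W \<delta> a = (-1) ^ m * coeff f m * poly f t *
    (\<Sum>q<Suc m. cof m (\<lambda>p q. C \<delta> (a + m + q - p)) 0 q * t ^ q)" for \<delta> a
  have f_row: "(\<Sum>q<Suc m. c (a + k + q) * coeff f q) = 0" if "a + k + m \<le> d" for a k
  proof -
    have "(\<Sum>q\<le>m. coeff f q * c (a + k + q)) = Lf d c (monom 1 (a + k) * f)"
      by (rule Lf_shift[OF deg that, symmetric])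
    also have "\<dots> = 0" using ann that by (simp add: annihilates_def)
    finally show ?thesis by (simp add: lessThan_Suc_atMost mult.commute)
  qed
  have kernel: "v s = 0"
    if "\<And>p. p < m \<Longrightarrow> (\<Sum>q<m. c (a + m + q - Suc p) * v q) = 0" "s < m" "a + 2 * m \<le> d" for v s a
    using fdet_nonzero_kernel[of m "\<lambda>p q. c (a + m + q - Suc p)" v s] that
      lower_section_pos[OF strict that(3)] by auto
  \<comment> \<open>With leading coefficient zero, the other coefficients of \<open>f\<close> would
    form a kernel vector of a nonsingular section of size \<open>m\<close>.\<close>
  have lead: "coeff f m \<noteq> 0"
  proof
    assume 0: "coeff f m = 0"
    have "coeff f s = 0" if "s < m" for s
    proof (rule kernel[of 0 "coeff f"])
      fix p assume p: "p < m"
      have "(\<Sum>q<m. c (0 + m + q - Suc p) * coeff f q) = (\<Sum>q<Suc m. c (0 + (m - Suc p) + q) * coeff f q)"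
        using p 0 by (simp add: Nat.add_diff_assoc2)
      also have "\<dots> = 0" using p assms(4) by (intro f_row) simp
      finally show "(\<Sum>q<m. c (0 + m + q - Suc p) * coeff f q) = 0" .
    qed (use that assms in auto)
    then have "f = 0" using 0 deg by (metis leading_coeff_0_iff le_eq_less_or_eq)
    then show False using \<open>f \<noteq> 0\<close> by simp
  qed
  have W0: "W 0 a > 0" if a: "a + 2 * m \<le> d" for a
  proof -
    let ?T = "\<lambda>p q. c (a + m + q - p)"
    let ?\<alpha> = "\<lambda>q. cof m ?T 0 q"
    define D0 where "D0 = fdet m (\<lambda>p q. c (a + m + q - Suc p))"
    have D0: "D0 > 0" unfolding D0_def by (rule lower_section_pos[OF strict a])
    have \<alpha>_m: "?\<alpha> m = (-1) ^ m * D0" by (simp add: cof_last D0_def)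
    \<comment> \<open>The cofactors and the coefficients of \<open>f\<close> both solve the lower
      \<open>m\<close> rows. The combination \<open>?v\<close> vanishes at index \<open>m\<close>,
      so nonsingularity on the other columns makes it zero; hence \<open>W 0 a\<close> is a positive
      minor times the square of \<open>poly f t\<close>.\<close>
    have proportional: "?\<alpha> q * coeff f m = ?\<alpha> m * coeff f q" if "q < Suc m" for q
    proof (cases "q = m")
      case False
      let ?v = "\<lambda>q. ?\<alpha> q * coeff f m - ?\<alpha> m * coeff f q"
      have "?v q = 0"
      proof (rule kernel[of a ?v])
        fix p assume p: "p < m"
        have "(\<Sum>q<Suc m. ?T (Suc p) q * ?\<alpha> q) = 0"
          by (rule fdet_expand_alien_row) (use p in auto)
        moreover have "(\<Sum>q<Suc m. ?T (Suc p) q * coeff f q) = 0"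
        proof -
          have "?T (Suc p) q = c (a + (m - Suc p) + q)" for q using p by (simp add: Nat.add_diff_assoc2)
          then show ?thesis using f_row[of a "m - Suc p"] a p by simp
        qed
        moreover have "(\<Sum>q<Suc m. ?T (Suc p) q * ?v q) =
            (\<Sum>q<Suc m. ?T (Suc p) q * ?\<alpha> q) * coeff f m -
            ?\<alpha> m * (\<Sum>q<Suc m. ?T (Suc p) q * coeff f q)"
          by (simp only: right_diff_distrib sum_subtractf sum_distrib_left sum_distrib_right mult_ac)
        ultimately have "(\<Sum>q<Suc m. ?T (Suc p) q * ?v q) = 0" by simp
        then show "(\<Sum>q<m. ?T (Suc p) q * ?v q) = 0" by simp
      qed (use False that a in auto)
      then show ?thesis by simp
    qed simp
    have "coeff f m * (\<Sum>q<Suc m. ?\<alpha> q * t ^ q) = (\<Sum>q<Suc m. (?\<alpha> q * coeff f m) * t ^ q)"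
      by (simp only: sum_distrib_left mult_ac)
    also have "\<dots> = (\<Sum>q<Suc m. ?\<alpha> m * (coeff f q * t ^ q))"
      by (intro sum.cong refl) (simp only: lessThan_iff proportional mult.assoc)
    also have "\<dots> = ?\<alpha> m * poly f t"
      using Lf_geometric[OF deg, of t]
      by (simp only: sum_distrib_left[symmetric] Lf_def lessThan_Suc_atMost)
    finally have sum: "coeff f m * (\<Sum>q<Suc m. ?\<alpha> q * t ^ q) = ?\<alpha> m * poly f t" .
    have "W 0 a = (-1) ^ m * poly f t * (coeff f m * (\<Sum>q<Suc m. ?\<alpha> q * t ^ q))"
      unfolding W_def C0 by (simp only: mult_ac)
    also have "\<dots> = ((-1) ^ m * (-1) ^ m) * D0 * (poly f t * poly f t)"
      unfolding sum \<alpha>_m by (simp only: mult_ac)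
    also have "\<dots> > 0"
    proof -
      have "poly f t * poly f t > 0" using t(2) by (metis not_real_square_gt_zero)
      then show ?thesis using D0 by (simp only: power_mult_distrib[symmetric]) simp
    qed
    finally show ?thesis .
  qed
  have W_lim: "((\<lambda>\<delta>. W \<delta> a) \<longlongrightarrow> W 0 a) (at_right 0)" for a
    unfolding W_def cof_def C0 by (intro tendsto_intros tendsto_fdet lim)
  \<comment> \<open>Only finitely many strict inequalities are involved, and all hold in the limit,
    so one small positive \<open>\<delta>\<close> satisfies them together.\<close>
  have "\<forall>\<^sub>F \<delta> in at_right 0. \<forall>a\<in>{a. a + 2 * m \<le> d}. W \<delta> a > 0"
    by (intro eventually_ball_finite ballI order_tendstoD(1)[OF W_lim] W0)
       (auto intro: finite_subset[of _ "{..d}"])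
  moreover have "\<forall>\<^sub>F \<delta> in at_right 0. \<forall>x\<in>{(j, a). j < m \<and> a + 2 * j \<le> d}.
      fdet (Suc (fst x)) (\<lambda>p q. C \<delta> (snd x + fst x + q - p)) > 0"
  proof (intro eventually_ball_finite ballI)
    show "finite {(j, a). j < m \<and> a + 2 * j \<le> d}"
      by (rule finite_subset[of _ "{..m} \<times> {..d}"]) auto
    fix x assume x: "x \<in> {(j, a). j < m \<and> a + 2 * j \<le> d}"
    show "\<forall>\<^sub>F \<delta> in at_right 0. fdet (Suc (fst x)) (\<lambda>p q. C \<delta> (snd x + fst x + q - p)) > 0"
    proof (rule order_tendstoD(1)[OF tendsto_fdet[OF lim]])
      show "fdet (Suc (fst x)) (\<lambda>p q. c (snd x + fst x + q - p)) > 0"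
        using strict x by (auto simp: strict_toeplitz_def)
    qed
  qed
  moreover have "\<forall>\<^sub>F \<delta> in at_right 0. \<forall>k\<in>{..d}. dist (C \<delta> k) (c k) < \<epsilon>"
    by (intro eventually_ball_finite ballI tendstoD[OF lim] assms) simp
  moreover have "\<forall>\<^sub>F \<delta> in at_right 0. \<delta> > (0 :: real)"
    by (rule eventually_at_right_less)
  ultimately have "\<forall>\<^sub>F \<delta> in at_right 0. (\<forall>a\<in>{a. a + 2 * m \<le> d}. W \<delta> a > 0) \<and>
      (\<forall>x\<in>{(j, a). j < m \<and> a + 2 * j \<le> d}.
        fdet (Suc (fst x)) (\<lambda>p q. C \<delta> (snd x + fst x + q - p)) > 0) \<and>
      (\<forall>k\<in>{..d}. dist (C \<delta> k) (c k) < \<epsilon>) \<and> \<delta> > 0"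
    by (intro eventually_conj)
  from eventually_happens'[OF trivial_limit_at_right_real this]
  obtain \<delta> where \<delta>: "\<delta> > 0" "\<And>a. a + 2 * m \<le> d \<Longrightarrow> W \<delta> a > 0"
    "\<And>j a. j < m \<Longrightarrow> a + 2 * j \<le> d \<Longrightarrow> fdet (Suc j) (\<lambda>p q. C \<delta> (a + j + q - p)) > 0"
    "\<And>k. k \<le> d \<Longrightarrow> dist (C \<delta> k) (c k) < \<epsilon>"
    by auto
  have top: "fdet (Suc m) (\<lambda>p q. C \<delta> (a + m + q - p)) > 0" if a: "a + 2 * m \<le> d" for a
  proof -
    define T where "T = (\<lambda>p q. C \<delta> (a + m + q - p))"
    let ?\<alpha> = "\<lambda>q. cof m T 0 q"
    have row: "(\<Sum>q<Suc m. T p q * ?\<alpha> q) = (if p = 0 then fdet (Suc m) T else 0)" if "p < Suc m" for p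
      using fdet_expand_row[of 0 m T] fdet_expand_alien_row[of 0 m p T] that by auto
    \<comment> \<open>Combining the rows with the coefficients of \<open>f\<close> kills the part
      from \<open>c\<close> and leaves only the geometric part.\<close>
    have col: "(\<Sum>p<Suc m. coeff f (m - p) * T p q) = (-1) ^ m * \<delta> * (t ^ a * poly f t) * t ^ q"
      if "q < Suc m" for q
    proof -
      have "(\<Sum>p<Suc m. coeff f (m - p) * T p q) = (\<Sum>k<Suc m. coeff f k * C \<delta> (a + q + k))"
        by (subst sum.nat_diff_reindex[symmetric], intro sum.cong refl) (auto simp: T_def algebra_simps)
      also have "\<dots> = Lf d (C \<delta>) (monom 1 (a + q) * f)"
        using a that by (simp only: lessThan_Suc_atMost) (intro Lf_shift[OF deg, symmetric], simp)
      also have "\<dots> = Lf d c (monom 1 (a + q) * f) + (-1) ^ m * \<delta> * Lf d (\<lambda>k. t ^ k) (monom 1 (a + q) * f)"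
        unfolding C_def by (rule Lf_add_seq)
      also have "Lf d c (monom 1 (a + q) * f) = 0"
        using ann a that by (simp add: annihilates_def)
      also have "Lf d (\<lambda>k. t ^ k) (monom 1 (a + q) * f) = poly (monom 1 (a + q) * f) t"
      proof (rule Lf_geometric)
        show "degree (monom 1 (a + q) * f) \<le> d"
          using degree_mult_le[of "monom 1 (a + q)" f] deg a that by (simp add: degree_monom_eq)
      qed
      finally show ?thesis by (simp add: poly_monom power_add mult_ac)
    qed
    have "coeff f m * fdet (Suc m) T = (\<Sum>p<Suc m. if p = 0 then coeff f m * fdet (Suc m) T else 0)"
      by simp
    also have "\<dots> = (\<Sum>p<Suc m. coeff f (m - p) * (\<Sum>q<Suc m. T p q * ?\<alpha> q))"
      by (intro sum.cong refl) (simp add: row del: sum.lessThan_Suc)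
    also have "\<dots> = (\<Sum>q<Suc m. (\<Sum>p<Suc m. coeff f (m - p) * T p q) * ?\<alpha> q)"
      unfolding sum_distrib_left sum_distrib_right mult.assoc by (rule sum.swap)
    also have "\<dots> = (\<Sum>q<Suc m. (-1) ^ m * \<delta> * (t ^ a * poly f t) * (?\<alpha> q * t ^ q))"
      by (intro sum.cong refl) (simp only: lessThan_iff col, simp only: mult_ac)
    also have "\<dots> = (-1) ^ m * \<delta> * (t ^ a * poly f t) * (\<Sum>q<Suc m. ?\<alpha> q * t ^ q)"
      by (simp only: sum_distrib_left)
    finally have "coeff f m * (coeff f m * fdet (Suc m) T) = \<delta> * t ^ a * W \<delta> a"
      unfolding W_def T_def[symmetric] by (simp only: mult_ac)
    also have "\<dots> > 0" using \<delta>(1) \<delta>(2)[OF a] t by simp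
    finally have "(coeff f m * coeff f m) * fdet (Suc m) T > 0" by (simp only: mult.assoc)
    moreover have "coeff f m * coeff f m > 0" using lead by (metis not_real_square_gt_zero)
    ultimately show ?thesis unfolding T_def by (simp add: zero_less_mult_iff)
  qed
  have "strict_toeplitz d (Suc m) (C \<delta>)"
    unfolding strict_toeplitz_def using top \<delta>(3) by (auto simp: less_Suc_eq)
  \<comment> \<open>The factor \<open>f\<close> kills the old sequence and the linear factor kills
    the evaluation at \<open>t\<close>.\<close>
  moreover have "annihilates d (C \<delta>) (Suc m) ([:- t, 1:] * f)"
    unfolding annihilates_def
  proof (intro conjI allI impI)
    have deg1: "degree ([:- t, 1:] * f) \<le> Suc m"
    proof -
      have "degree [:- t, 1:] = 1" by simp
      then show ?thesis using degree_mult_le[of "[:- t, 1:]" f] deg by linarith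
    qed
    then show "degree ([:- t, 1:] * f) \<le> Suc m" .
    fix s assume s: "s + Suc m \<le> d"
    have deg2: "degree (monom 1 s * [:- t, 1:]) \<le> s + 1"
      using degree_mult_le[of "monom 1 s" "[:- t, 1:]"] by (simp add: degree_monom_eq)
    have "Lf d (C \<delta>) (monom 1 s * ([:- t, 1:] * f)) =
        Lf d c ((monom 1 s * [:- t, 1:]) * f) + (-1) ^ m * \<delta> * Lf d (\<lambda>k. t ^ k) (monom 1 s * ([:- t, 1:] * f))"
      unfolding C_def Lf_add_seq by (simp only: mult.assoc)
    also have "Lf d c ((monom 1 s * [:- t, 1:]) * f) = 0"
      using deg2 s by (intro annihilates_mult[OF ann]) linarith
    also have "Lf d (\<lambda>k. t ^ k) (monom 1 s * ([:- t, 1:] * f)) = poly (monom 1 s * ([:- t, 1:] * f)) t"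
    proof (rule Lf_geometric)
      have "degree (monom 1 s * ([:- t, 1:] * f)) \<le> s + degree ([:- t, 1:] * f)"
        using degree_mult_le[of "monom 1 s" "[:- t, 1:] * f"] by (simp only: degree_monom_eq[OF one_neq_zero])
      then show "degree (monom 1 s * ([:- t, 1:] * f)) \<le> d" using deg1 s by linarith
    qed
    also have "\<dots> = 0" by (simp only: poly_mult) simp
    finally show "Lf d (C \<delta>) (monom 1 s * ([:- t, 1:] * f)) = 0" by simp
  qed
  moreover have "[:- t, 1:] * f \<noteq> 0"
    using \<open>f \<noteq> 0\<close> by (simp only: mult_eq_0_iff) simp
  moreover have "\<forall>k\<le>d. \<bar>C \<delta> k - c k\<bar> < \<epsilon>" using \<delta>(4) by (simp add: dist_real_def)
  ultimately show ?thesis by blast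
qed

text \<open>The bound \<open>d + 2\<close> reflects that the largest section has size
  \<open>m + n\<close>, hence degree m + n - 1. The error is halved at each round.\<close>

lemma iterated_perturbation:
  assumes "strict_toeplitz d m c" "annihilates d c m f" "f \<noteq> 0" "2 * (m + n) \<le> d + 2" "\<epsilon> > 0"
  shows "\<exists>c'. strict_toeplitz d (m + n) c' \<and> (\<forall>k\<le>d. \<bar>c' k - c k\<bar> < \<epsilon>)"
  using assms
proof (induction n arbitrary: m c f \<epsilon>)
  case 0
  then show ?case by (intro exI[of _ c]) simp
next
  case (Suc n)
  obtain c1 f1 where 1: "strict_toeplitz d (Suc m) c1" "annihilates d c1 (Suc m) f1" "f1 \<noteq> 0"
    "\<forall>k\<le>d. \<bar>c1 k - c k\<bar> < \<epsilon> / 2"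
    using geometric_perturbation[OF Suc.prems(1-3), of "\<epsilon> / 2"] Suc.prems(4,5) by auto
  obtain c2 where 2: "strict_toeplitz d (Suc m + n) c2" "\<forall>k\<le>d. \<bar>c2 k - c1 k\<bar> < \<epsilon> / 2"
    using Suc.IH[OF 1(1-3), of "\<epsilon> / 2"] Suc.prems(4,5) by auto
  have "\<bar>c2 k - c k\<bar> < \<epsilon>" if "k \<le> d" for k
    using 1(4)[rule_format, OF that] 2(2)[rule_format, OF that] by linarith
  then show ?case using 2(1) by auto
qed

theorem hodge_riemann_imp_toeplitz_limit:
  assumes "hodge_riemann d i c" "2 * i \<le> d"
  shows "toeplitz_limit d i c"
  unfolding toeplitz_limit_def
proof (intro allI impI)
  fix \<epsilon> :: real assume "\<epsilon> > 0"
  have "\<forall>\<^sub>F e in at_right 0. \<forall>k\<in>{..d}. dist (moebius_seq e d c k) (c k) < \<epsilon> / 2"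
    using \<open>\<epsilon> > 0\<close> by (intro eventually_ball_finite ballI tendstoD[OF tendsto_moebius_seq]) auto
  moreover have "\<forall>\<^sub>F e in at_right 0. e \<in> {0<..<1 :: real}"
    by (rule eventually_at_right_real) simp
  ultimately have "\<forall>\<^sub>F e in at_right 0. (\<forall>k\<in>{..d}. dist (moebius_seq e d c k) (c k) < \<epsilon> / 2) \<and>
      e \<in> {0<..<1 :: real}" by (rule eventually_conj)
  from eventually_happens'[OF trivial_limit_at_right_real this]
  obtain e where close: "\<And>k. k \<le> d \<Longrightarrow> \<bar>moebius_seq e d c k - c k\<bar> < \<epsilon> / 2" and e: "0 < e" "e < 1"
    by (auto simp: dist_real_def)
  show "\<exists>c'. strict_toeplitz d (Suc i) c' \<and> (\<forall>k\<le>d. \<bar>c' k - c k\<bar> < \<epsilon>)"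
  \<comment> \<open>Below the minimal degree \<open>r\<close> of an annihilator the Hodge-Riemann
    relations give positivity; the remaining \<open>Suc i - r\<close> sizes are supplied by
    perturbation. Both moves change each entry by less than \<open>\<epsilon> / 2\<close>.\<close>
  proof (cases "\<exists>r f. r \<le> i \<and> f \<noteq> 0 \<and> annihilates d c r f")
    case True
    then obtain r where r: "r \<le> i" "\<exists>f. f \<noteq> 0 \<and> annihilates d c r f"
      and least: "\<And>r'. r' < r \<Longrightarrow> \<not> (r' \<le> i \<and> (\<exists>f. f \<noteq> 0 \<and> annihilates d c r' f))"
      using exists_least_iff[of "\<lambda>r. r \<le> i \<and> (\<exists>f. f \<noteq> 0 \<and> annihilates d c r f)"] by blast
    then obtain f where f: "f \<noteq> 0" "annihilates d c r f" by blast
    have strict: "strict_toeplitz d r (moebius_seq e d c)"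
    proof (rule hodge_riemann_imp_strict_toeplitz[OF assms e])
      fix j f assume "j < r" "annihilates d c j f"
      then show "f = 0" using least[of j] r(1) by auto
    qed (use r(1) in simp)
    have ann: "annihilates d (moebius_seq e d c) r (moebius (- e) r f)"
      using e by (intro annihilates_moebius f) simp
    have "degree f \<le> r" using f(2) by (simp add: annihilates_def)
    then have nz: "moebius (- e) r f \<noteq> 0"
      using e f by (intro moebius_nonzero) auto
    obtain c' where c': "strict_toeplitz d (r + (Suc i - r)) c'"
        "\<forall>k\<le>d. \<bar>c' k - moebius_seq e d c k\<bar> < \<epsilon> / 2"
      using iterated_perturbation[OF strict ann nz, of "Suc i - r" "\<epsilon> / 2"] r(1) assms(2) \<open>\<epsilon> > 0\<close> by auto
    have "\<bar>c' k - c k\<bar> < \<epsilon>" if "k \<le> d" for k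
      using close[OF that] c'(2)[rule_format, OF that] by linarith
    then show ?thesis using c'(1) r(1) by auto
  next
    case False
    have "strict_toeplitz d (Suc i) (moebius_seq e d c)"
    proof (rule hodge_riemann_imp_strict_toeplitz[OF assms e order_refl])
      fix j f assume "j < Suc i" "annihilates d c j f"
      then show "f = 0" using False by (auto simp: less_Suc_eq_le)
    qed
    moreover have "\<bar>moebius_seq e d c k - c k\<bar> < \<epsilon>" if "k \<le> d" for k
      using close[OF that] \<open>\<epsilon> > 0\<close> by linarith
    ultimately show ?thesis by blast
  qed
qed

section \<open>Contraction in coordinates\<close>

text \<open>The value at the origin of a mixed partial derivative; in these coordinates
  differentiation is a mere shift of indices.\<close>

definition divided_coeff :: "bipoly \<Rightarrow> nat \<Rightarrow> nat \<Rightarrow> real" where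
  "divided_coeff F m n = fact m * fact n * coeff (coeff F m) n"

lemma divided_coeff_eq_0_iff: "(\<forall>m n. divided_coeff F m n = 0) \<longleftrightarrow> F = 0"
  by (auto simp: divided_coeff_def poly_eq_iff)

lemma divided_coeff_0 [simp]: "divided_coeff 0 m n = 0"
  by (simp add: divided_coeff_def)

lemma divided_coeff_dX: "divided_coeff (dX F) m n = divided_coeff F (Suc m) n"
proof -
  have "coeff (dX F) m = smult (real (Suc m)) (coeff F (Suc m))"
    unfolding dX_def coeff_pderiv by (simp add: of_nat_poly del: of_nat_Suc)
  then show ?thesis by (simp add: divided_coeff_def fact_Suc mult_ac del: of_nat_Suc)
qed

lemma divided_coeff_dY: "divided_coeff (dY F) m n = divided_coeff F m (Suc n)"
  by (simp add: divided_coeff_def dY_def coeff_map_poly coeff_pderiv fact_Suc mult_ac del: of_nat_Suc)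

lemma divided_coeff_funpow_dX: "divided_coeff ((dX ^^ k) F) m n = divided_coeff F (m + k) n"
  by (induction k arbitrary: m) (simp_all add: divided_coeff_dX)

lemma divided_coeff_funpow_dY: "divided_coeff ((dY ^^ k) F) m n = divided_coeff F m (n + k)"
  by (induction k arbitrary: n) (simp_all add: divided_coeff_dY)

lemma divided_coeff_add: "divided_coeff (F + G) m n = divided_coeff F m n + divided_coeff G m n"
  by (simp add: divided_coeff_def distrib_left)

lemma divided_coeff_sum: "divided_coeff (\<Sum>x\<in>S. f x) m n = (\<Sum>x\<in>S. divided_coeff (f x) m n)"
  by (simp add: divided_coeff_def coeff_sum sum_distrib_left)

lemma divided_coeff_const_mult: "divided_coeff (const c * F) m n = c * divided_coeff F m n"
  by (simp add: divided_coeff_def const_def mult_ac)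

text \<open>A common square box for the exponents allows the sums that define the action of
  different operators to be compared term by term.\<close>

definition bounded_by :: "nat \<Rightarrow> bipoly \<Rightarrow> bool" where
  "bounded_by N \<alpha> \<longleftrightarrow> (\<forall>m n. N \<le> m \<or> N \<le> n \<longrightarrow> coeff (coeff \<alpha> m) n = 0)"

lemma bounded_by_mono: "bounded_by N \<alpha> \<Longrightarrow> N \<le> N' \<Longrightarrow> bounded_by N' \<alpha>"
  unfolding bounded_by_def by (meson le_trans)

lemma bounded_by_exists: "\<exists>N. bounded_by N \<alpha>"
proof -
  define N where "N = Suc (degree \<alpha> + (\<Sum>m\<le>degree \<alpha>. degree (coeff \<alpha> m)))"
  have "coeff (coeff \<alpha> m) n = 0" if "N \<le> m \<or> N \<le> n" for m n
  proof (cases "m \<le> degree \<alpha>")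
    case True
    then have "degree (coeff \<alpha> m) \<le> (\<Sum>m\<le>degree \<alpha>. degree (coeff \<alpha> m))"
      by (intro member_le_sum) auto
    then show ?thesis using that True by (intro coeff_eq_0) (auto simp: N_def)
  qed (simp add: coeff_eq_0)
  then show ?thesis unfolding bounded_by_def by blast
qed

lemma divided_coeff_act:
  assumes "bounded_by N \<alpha>"
  shows "divided_coeff (act \<alpha> F) a b =
    (\<Sum>m<N. \<Sum>n<N. coeff (coeff \<alpha> m) n * divided_coeff F (a + m) (b + n))"
proof -
  let ?t = "\<lambda>m n. coeff (coeff \<alpha> m) n * divided_coeff F (a + m) (b + n)"
  have inner: "(\<Sum>n\<le>degree (coeff \<alpha> m). ?t m n) = (\<Sum>n<N. ?t m n)" for m
  proof (rule sum.mono_neutral_cong)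
    fix n assume "n \<in> {..degree (coeff \<alpha> m)} - {..<N}"
    then show "?t m n = 0" using assms by (simp add: bounded_by_def)
  next
    fix n assume "n \<in> {..<N} - {..degree (coeff \<alpha> m)}"
    then show "?t m n = 0" by (simp add: coeff_eq_0)
  qed auto
  have "divided_coeff (act \<alpha> F) a b = (\<Sum>m\<le>degree \<alpha>. \<Sum>n<N. ?t m n)"
    by (simp add: act_def divided_coeff_sum divided_coeff_const_mult divided_coeff_funpow_dX
        divided_coeff_funpow_dY inner)
  also have "\<dots> = (\<Sum>m<N. \<Sum>n<N. ?t m n)"
  proof (rule sum.mono_neutral_cong)
    fix m assume "m \<in> {..degree \<alpha>} - {..<N}"
    then show "(\<Sum>n<N. ?t m n) = 0" using assms by (simp add: bounded_by_def)
  next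
    fix m assume "m \<in> {..<N} - {..degree \<alpha>}"
    then show "(\<Sum>n<N. ?t m n) = 0" by (simp add: coeff_eq_0)
  qed auto
  finally show ?thesis .
qed

lemma divided_coeff_eqI:
  assumes "\<And>a b. divided_coeff F a b = divided_coeff G a b"
  shows "F = G"
  using assms by (simp add: divided_coeff_def poly_eq_iff)

lemma act_0 [simp]: "act 0 F = 0"
  by (simp add: act_def const_def)

lemma act_add: "act (\<alpha> + \<beta>) F = act \<alpha> F + act \<beta> F"
proof (rule divided_coeff_eqI)
  fix a b
  obtain N1 N2 where "bounded_by N1 \<alpha>" "bounded_by N2 \<beta>"
    using bounded_by_exists by blast
  then have N: "bounded_by (N1 + N2) \<alpha>" "bounded_by (N1 + N2) \<beta>"
    by (auto intro: bounded_by_mono)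
  then have "bounded_by (N1 + N2) (\<alpha> + \<beta>)" by (simp add: bounded_by_def)
  then show "divided_coeff (act (\<alpha> + \<beta>) F) a b = divided_coeff (act \<alpha> F + act \<beta> F) a b"
    using N by (simp add: divided_coeff_act divided_coeff_add distrib_right sum.distrib)
qed

lemma act_smult_const: "act (smult [:c:] \<alpha>) F = const c * act \<alpha> F"
proof (rule divided_coeff_eqI)
  fix a b
  obtain N where N: "bounded_by N \<alpha>" using bounded_by_exists by blast
  then have "bounded_by N (smult [:c:] \<alpha>)" by (simp add: bounded_by_def)
  then show "divided_coeff (act (smult [:c:] \<alpha>) F) a b = divided_coeff (const c * act \<alpha> F) a b"
    using N by (simp add: divided_coeff_act divided_coeff_const_mult sum_distrib_left mult_ac)
qed

text \<open>Multiplying the operator by x shifts the first index. Together with the analogue for y,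
  this shows that \<open>Ann F\<close> is an ideal by induction on the multiplier.\<close>

lemma divided_coeff_act_pCons_0:
  "divided_coeff (act (pCons 0 \<alpha>) F) a b = divided_coeff (act \<alpha> F) (Suc a) b"
proof -
  obtain N where N: "bounded_by N \<alpha>" using bounded_by_exists by blast
  then have "bounded_by (Suc N) (pCons 0 \<alpha>)"
    by (auto simp: bounded_by_def coeff_pCons split: nat.splits)
  then have "divided_coeff (act (pCons 0 \<alpha>) F) a b = (\<Sum>m<Suc N. \<Sum>n<Suc N.
      coeff (coeff (pCons 0 \<alpha>) m) n * divided_coeff F (a + m) (b + n))"
    by (rule divided_coeff_act)
  also have "\<dots> = (\<Sum>m<N. \<Sum>n<Suc N. coeff (coeff \<alpha> m) n * divided_coeff F (Suc a + m) (b + n))"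
    by (subst sum.lessThan_Suc_shift) (simp del: sum.lessThan_Suc)
  also have "\<dots> = (\<Sum>m<Suc N. \<Sum>n<Suc N. coeff (coeff \<alpha> m) n * divided_coeff F (Suc a + m) (b + n))"
    using N by (simp add: bounded_by_def)
  also have "\<dots> = divided_coeff (act \<alpha> F) (Suc a) b"
    by (rule divided_coeff_act[symmetric], rule bounded_by_mono[OF N]) simp
  finally show ?thesis .
qed

lemma divided_coeff_act_smult_pCons_0:
  "divided_coeff (act (smult [:0, 1:] \<alpha>) F) a b = divided_coeff (act \<alpha> F) a (Suc b)"
proof -
  obtain N where N: "bounded_by N \<alpha>" using bounded_by_exists by blast
  then have "bounded_by (Suc N) (smult [:0, 1:] \<alpha>)"
    by (auto simp: bounded_by_def coeff_pCons split: nat.splits)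
  moreover have N': "bounded_by (Suc N) \<alpha>" using N by (rule bounded_by_mono) simp
  ultimately have "divided_coeff (act (smult [:0, 1:] \<alpha>) F) a b =
      (\<Sum>m<Suc N. \<Sum>n<N. coeff (coeff \<alpha> m) n * divided_coeff F (a + m) (Suc b + n))"
    by (simp add: divided_coeff_act sum.lessThan_Suc_shift[of "\<lambda>n. coeff (pCons 0 _) n * _ n" N]
        del: sum.lessThan_Suc)
  also have "\<dots> = divided_coeff (act \<alpha> F) a (Suc b)"
    using N N' by (subst divided_coeff_act[OF N']) (simp add: bounded_by_def)
  finally show ?thesis .
qed

section \<open>The quotient algebra\<close>

lemma Ann_add: "\<alpha> \<in> Ann F \<Longrightarrow> \<beta> \<in> Ann F \<Longrightarrow> \<alpha> + \<beta> \<in> Ann F"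
  by (simp add: Ann_def act_add)

lemma Ann_smult: "\<alpha> \<in> Ann F \<Longrightarrow> smult p \<alpha> \<in> Ann F"
proof (induction p)
  case 0
  then show ?case by (simp add: Ann_def)
next
  case (pCons c p)
  have "act (smult [:0, 1:] (smult p \<alpha>)) F = 0"
    using pCons by (intro divided_coeff_eqI) (simp add: divided_coeff_act_smult_pCons_0 Ann_def del: smult_smult)
  moreover have "smult (pCons c p) \<alpha> = smult [:c:] \<alpha> + smult [:0, 1:] (smult p \<alpha>)"
    by (simp add: smult_add_left[symmetric])
  ultimately show ?case using pCons.prems by (simp only: Ann_def mem_Collect_eq act_add act_smult_const add_0_left mult_zero_right)
qed

lemma Ann_mult: "\<alpha> \<in> Ann F \<Longrightarrow> \<beta> * \<alpha> \<in> Ann F"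
proof (induction \<beta>)
  case 0
  then show ?case by (simp add: Ann_def)
next
  case (pCons p \<beta>)
  have "act (pCons 0 (\<beta> * \<alpha>)) F = 0"
    using pCons by (intro divided_coeff_eqI) (simp add: divided_coeff_act_pCons_0 Ann_def)
  then have "pCons 0 (\<beta> * \<alpha>) \<in> Ann F" by (simp add: Ann_def)
  then show ?case using pCons.prems by (simp add: Ann_add Ann_smult)
qed

lemma Ann_mult_right: "\<alpha> \<in> Ann F \<Longrightarrow> \<alpha> * \<beta> \<in> Ann F"
  using Ann_mult[of \<alpha> F \<beta>] by (simp add: mult.commute)

lemma Ann_uminus: "\<alpha> \<in> Ann F \<Longrightarrow> - \<alpha> \<in> Ann F"
  using Ann_mult[of \<alpha> F "- 1"] by simp

lemma cring_R_ring: "cring R_ring"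
proof (rule cringI)
  show "abelian_group R_ring"
  proof (rule abelian_groupI)
    fix x assume "x \<in> carrier R_ring"
    show "\<exists>y\<in>carrier R_ring. y \<oplus>\<^bsub>R_ring\<^esub> x = \<zero>\<^bsub>R_ring\<^esub>"
      by (rule bexI[of _ "- x"]) (simp_all add: R_ring_def)
  qed (simp_all add: R_ring_def add_ac)
  show "comm_monoid R_ring"
    by (rule comm_monoidI) (simp_all add: R_ring_def mult_ac)
qed (simp add: R_ring_def distrib_right)

lemma ideal_Ann: "ideal (Ann F) R_ring"
proof (rule idealI)
  interpret cring R_ring by (rule cring_R_ring)
  show "ring R_ring" by (rule ring_axioms)
  show "subgroup (Ann F) (add_monoid R_ring)"
  proof (rule group.subgroupI[OF a_group])
    show "Ann F \<noteq> {}" by (auto simp: Ann_def intro!: exI[of _ 0])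
    fix \<alpha> assume \<alpha>: "\<alpha> \<in> Ann F"
    have "inv\<^bsub>add_monoid R_ring\<^esub> \<alpha> = - \<alpha>"
      by (rule group.inv_equality[OF a_group]) (simp_all add: R_ring_def)
    then show "inv\<^bsub>add_monoid R_ring\<^esub> \<alpha> \<in> Ann F" using Ann_uminus[OF \<alpha>] by simp
  qed (auto simp: R_ring_def Ann_add)
qed (simp_all add: R_ring_def Ann_mult Ann_mult_right)

lemma cls_mult: "cls F \<alpha> \<otimes>\<^bsub>A_alg F\<^esub> cls F \<beta> = cls F (\<alpha> * \<beta>)"
  using ideal.rcoset_mult_add[OF ideal_Ann[of F], of \<alpha> \<beta>]
  by (simp add: cls_def A_alg_def FactRing_def R_ring_def)

lemma zero_A_alg: "\<zero>\<^bsub>A_alg F\<^esub> = Ann F"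
  by (simp add: A_alg_def FactRing_def)

lemma cls_eq: "cls F \<alpha> = {\<beta> + \<alpha> |\<beta>. \<beta> \<in> Ann F}"
  by (auto simp: cls_def a_r_coset_def r_coset_def R_ring_def)

lemma cls_eq_iff: "cls F \<alpha> = cls F \<beta> \<longleftrightarrow> \<alpha> - \<beta> \<in> Ann F"
proof
  assume eq: "cls F \<alpha> = cls F \<beta>"
  have "0 \<in> Ann F" by (simp add: Ann_def)
  then have "\<alpha> \<in> cls F \<alpha>" unfolding cls_eq by force
  then have "\<alpha> \<in> cls F \<beta>" using eq by simp
  then obtain \<gamma> where "\<gamma> \<in> Ann F" "\<alpha> = \<gamma> + \<beta>" unfolding cls_eq by blast
  then show "\<alpha> - \<beta> \<in> Ann F" by simp
next
  assume diff: "\<alpha> - \<beta> \<in> Ann F"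
  show "cls F \<alpha> = cls F \<beta>"
  proof (rule Set.set_eqI)
    fix x
    have "x \<in> cls F \<gamma> \<longleftrightarrow> x - \<gamma> \<in> Ann F" for \<gamma>
      unfolding cls_eq by (auto intro!: exI[of _ "x - \<gamma>"])
    moreover have "x - \<alpha> \<in> Ann F \<longleftrightarrow> x - \<beta> \<in> Ann F"
      using Ann_add[of "x - \<alpha>" F "\<alpha> - \<beta>"] Ann_add[OF _ Ann_uminus[OF diff], of "x - \<beta>"] diff
      by auto
    ultimately show "x \<in> cls F \<alpha> \<longleftrightarrow> x \<in> cls F \<beta>" by simp
  qed
qed

lemma cls_eq_zero_iff: "cls F \<alpha> = \<zero>\<^bsub>A_alg F\<^esub> \<longleftrightarrow> \<alpha> \<in> Ann F"
proof -
  have "cls F 0 = Ann F" by (simp add: cls_eq)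
  then show ?thesis using cls_eq_iff[of F \<alpha> 0] by (simp add: zero_A_alg)
qed

section \<open>Dehomogenization\<close>

definition dehom :: "bipoly \<Rightarrow> real poly" where
  "dehom \<alpha> = map_poly (\<lambda>p. poly p 1) \<alpha>"

definition homog :: "nat \<Rightarrow> real poly \<Rightarrow> bipoly" where
  "homog k p = (\<Sum>m\<le>k. monom (monom (coeff p m) (k - m)) m)"

lemma coeff_dehom: "coeff (dehom \<alpha>) m = poly (coeff \<alpha> m) 1"
  by (simp add: dehom_def coeff_map_poly)

lemma dehom_mult: "dehom (\<alpha> * \<beta>) = dehom \<alpha> * dehom \<beta>"
  by (rule poly_eqI) (simp add: coeff_dehom coeff_mult poly_sum poly_mult)

lemma dehom_1: "dehom 1 = 1"
  by (rule poly_eqI) (simp add: coeff_dehom coeff_1)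

lemma coeff_homog: "coeff (homog k p) m = (if m \<le> k then monom (coeff p m) (k - m) else 0)"
  by (simp add: homog_def coeff_sum)

lemma homog_forms: "homog k p \<in> forms k"
  by (auto simp: forms_def coeff_homog split: if_splits)

lemma dehom_homog:
  assumes "degree p \<le> k"
  shows "dehom (homog k p) = p"
  by (rule poly_eqI) (use assms in \<open>auto simp: coeff_dehom coeff_homog poly_monom coeff_eq_0\<close>)

lemma forms_coeff: "\<alpha> \<in> forms k \<Longrightarrow> m + n \<noteq> k \<Longrightarrow> coeff (coeff \<alpha> m) n = 0"
  by (auto simp: forms_def)

lemma coeff_dehom_forms:
  assumes "\<alpha> \<in> forms k"
  shows "coeff (dehom \<alpha>) m = (if m \<le> k then coeff (coeff \<alpha> m) (k - m) else 0)"
proof (cases "m \<le> k")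
  case True
  have "coeff \<alpha> m = monom (coeff (coeff \<alpha> m) (k - m)) (k - m)"
    by (rule poly_eqI) (use forms_coeff[OF assms, of m] True in auto)
  then have "poly (coeff \<alpha> m) 1 = coeff (coeff \<alpha> m) (k - m)" by (metis mult.right_neutral poly_monom power_one)
  then show ?thesis using True by (simp add: coeff_dehom)
next
  case False
  have "coeff \<alpha> m = 0" by (rule poly_eqI) (use forms_coeff[OF assms, of m] False in auto)
  then show ?thesis using False by (simp add: coeff_dehom)
qed

lemma degree_dehom: "\<alpha> \<in> forms k \<Longrightarrow> degree (dehom \<alpha>) \<le> k"
  by (rule degree_le) (simp add: coeff_dehom_forms)

lemma forms_mult:
  assumes "\<alpha> \<in> forms j" "\<beta> \<in> forms k"
  shows "\<alpha> * \<beta> \<in> forms (j + k)"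
  unfolding forms_def mem_Collect_eq
proof (intro allI impI, rule ccontr)
  fix m n
  assume nz: "coeff (coeff (\<alpha> * \<beta>) m) n \<noteq> 0" and ne: "m + n \<noteq> j + k"
  have "coeff (coeff (\<alpha> * \<beta>) m) n =
      (\<Sum>a\<le>m. \<Sum>b\<le>n. coeff (coeff \<alpha> a) b * coeff (coeff \<beta> (m - a)) (n - b))"
    by (simp add: coeff_mult coeff_sum)
  also have "\<dots> = 0"
  proof (intro sum.neutral ballI)
    fix a b assume "a \<in> {..m}" "b \<in> {..n}"
    then have "a + b \<noteq> j \<or> (m - a) + (n - b) \<noteq> k" using ne by auto
    then show "coeff (coeff \<alpha> a) b * coeff (coeff \<beta> (m - a)) (n - b) = 0"
      using forms_coeff[OF assms(1)] forms_coeff[OF assms(2)] by auto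
  qed
  finally show False using nz by simp
qed

lemma one_forms: "1 \<in> forms 0"
  by (auto simp: forms_def coeff_1 split: if_splits)

lemma linear_form:
  shows "const a * var_x + const b * var_y \<in> forms 1"
    and "dehom (const a * var_x + const b * var_y) = [:b, a:]"
proof -
  have eq: "const a * var_x + const b * var_y = [:[:0, b:], [:a:]:]"
    by (simp add: const_def var_x_def var_y_def)
  show "const a * var_x + const b * var_y \<in> forms 1"
    unfolding eq by (auto simp: forms_def coeff_pCons split: nat.splits)
  show "dehom (const a * var_x + const b * var_y) = [:b, a:]"
    unfolding eq by (rule poly_eqI) (auto simp: coeff_dehom coeff_pCons split: nat.splits)
qed

text \<open>The binomial coefficient in the normalization cancels \<open>fact m * fact n\<close> up
  to the constant \<open>fact d\<close>, so contraction becomes the plain functional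
  \<open>Lf\<close>.\<close>

lemma divided_coeff_form:
  assumes "F \<in> forms d" "m + n = d"
  shows "divided_coeff F m n = fact d * norm_coeff d F m"
proof -
  have "n = d - m" "m \<le> d" using assms(2) by auto
  then show ?thesis
    by (simp add: divided_coeff_def norm_coeff_def binomial_fact)
qed

text \<open>The coordinates of the contracted form are the pairings of the operator with the
  monomials of complementary degree. The factor \<open>fact d\<close> is positive and disappears
  from all later sign conditions.\<close>

lemma divided_coeff_act_form:
  assumes "F \<in> forms d" "\<alpha> \<in> forms k"
  shows "divided_coeff (act \<alpha> F) a b = (if a + b + k = d
    then fact d * Lf d (norm_coeff d F) (monom 1 a * dehom \<alpha>) else 0)"
proof -
  have "bounded_by (Suc k) \<alpha>"
    unfolding bounded_by_def using forms_coeff[OF assms(2)] by auto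
  then have "divided_coeff (act \<alpha> F) a b =
      (\<Sum>m<Suc k. \<Sum>n<Suc k. coeff (coeff \<alpha> m) n * divided_coeff F (a + m) (b + n))"
    by (rule divided_coeff_act)
  also have "\<dots> = (\<Sum>m\<le>k. coeff (dehom \<alpha>) m * divided_coeff F (a + m) (b + (k - m)))"
    unfolding lessThan_Suc_atMost
  proof (intro sum.cong refl)
    fix m assume m: "m \<in> {..k}"
    have "(\<Sum>n\<le>k. coeff (coeff \<alpha> m) n * divided_coeff F (a + m) (b + n)) =
        (\<Sum>n\<le>k. if n = k - m then coeff (dehom \<alpha>) m * divided_coeff F (a + m) (b + (k - m)) else 0)"
      by (intro sum.cong refl)
         (use m forms_coeff[OF assms(2), of m] in \<open>auto simp: coeff_dehom_forms[OF assms(2)]\<close>)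
    then show "(\<Sum>n\<le>k. coeff (coeff \<alpha> m) n * divided_coeff F (a + m) (b + n)) =
        coeff (dehom \<alpha>) m * divided_coeff F (a + m) (b + (k - m))" by simp
  qed
  also have "\<dots> = (if a + b + k = d
    then fact d * Lf d (norm_coeff d F) (monom 1 a * dehom \<alpha>) else 0)"
  proof (cases "a + b + k = d")
    case True
    have "(\<Sum>m\<le>k. coeff (dehom \<alpha>) m * divided_coeff F (a + m) (b + (k - m))) =
        fact d * (\<Sum>m\<le>k. coeff (dehom \<alpha>) m * norm_coeff d F (a + m))"
      unfolding sum_distrib_left
      by (intro sum.cong refl) (use True in \<open>simp add: divided_coeff_form[OF assms(1)]\<close>)
    then show ?thesis
      using Lf_shift[OF degree_dehom[OF assms(2)], of a d] True by simp
  next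
    case False
    then show ?thesis
      using forms_coeff[OF assms(1)] by (auto simp: divided_coeff_def intro!: sum.neutral)
  qed
  finally show ?thesis .
qed

lemma Ann_form_iff:
  assumes "F \<in> forms d" "\<alpha> \<in> forms k"
  shows "\<alpha> \<in> Ann F \<longleftrightarrow> annihilates d (norm_coeff d F) k (dehom \<alpha>)"
proof -
  have "\<alpha> \<in> Ann F \<longleftrightarrow> (\<forall>a b. divided_coeff (act \<alpha> F) a b = 0)"
    by (simp add: Ann_def divided_coeff_eq_0_iff)
  also have "\<dots> \<longleftrightarrow> (\<forall>a. a + k \<le> d \<longrightarrow> Lf d (norm_coeff d F) (monom 1 a * dehom \<alpha>) = 0)"
    unfolding divided_coeff_act_form[OF assms]
  proof (intro iffI allI impI)
    fix a
    assume H: "\<forall>a b. (if a + b + k = d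
      then fact d * Lf d (norm_coeff d F) (monom 1 a * dehom \<alpha>) else 0) = 0" and "a + k \<le> d"
    then have "a + (d - k - a) + k = d" by simp
    then show "Lf d (norm_coeff d F) (monom 1 a * dehom \<alpha>) = 0"
      using spec[OF spec[OF H, of a], of "d - k - a"] by simp
  qed auto
  finally show ?thesis using degree_dehom[OF assms(2)] by (simp add: annihilates_def)
qed

lemma act_top_form:
  assumes "F \<in> forms d" "\<alpha> \<in> forms d"
  shows "act \<alpha> F = const (fact d * Lf d (norm_coeff d F) (dehom \<alpha>))"
proof (rule divided_coeff_eqI)
  fix a b
  show "divided_coeff (act \<alpha> F) a b =
      divided_coeff (const (fact d * Lf d (norm_coeff d F) (dehom \<alpha>))) a b"
    unfolding divided_coeff_act_form[OF assms]
    by (auto simp: divided_coeff_def const_def coeff_pCons split: nat.splits)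
qed

lemma A_integral_cls:
  assumes "F \<in> forms d" "\<alpha> \<in> forms d"
  shows "A_integral d F (cls F \<alpha>) = fact d * Lf d (norm_coeff d F) (dehom \<alpha>)"
  unfolding A_integral_def
proof (rule the_equality)
  show "\<exists>\<beta>\<in>forms d. cls F \<beta> = cls F \<alpha> \<and>
      act \<beta> F = const (fact d * Lf d (norm_coeff d F) (dehom \<alpha>))"
    using assms act_top_form by blast
  fix v assume "\<exists>\<beta>\<in>forms d. cls F \<beta> = cls F \<alpha> \<and> act \<beta> F = const v"
  then obtain \<beta> where \<beta>: "cls F \<beta> = cls F \<alpha>" "act \<beta> F = const v" by blast
  have "act ((\<beta> - \<alpha>) + \<alpha>) F = act (\<beta> - \<alpha>) F + act \<alpha> F" by (rule act_add)
  then have "const v = const (fact d * Lf d (norm_coeff d F) (dehom \<alpha>))"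
    using \<beta> act_top_form[OF assms] by (simp add: cls_eq_iff Ann_def)
  then show "v = fact d * Lf d (norm_coeff d F) (dehom \<alpha>)" by (simp add: const_def)
qed

section \<open>Translation of the three conditions\<close>

lemma pos_cone_form:
  assumes "l \<in> pos_cone"
  obtains a b where "a > 0" "b > 0" "l \<in> forms 1" "dehom l = [:b, a:]"
  using assms linear_form unfolding pos_cone_def by blast

lemma pos_cone_prod:
  assumes "\<And>k. 1 \<le> k \<Longrightarrow> k \<le> n \<Longrightarrow> L k \<in> pos_cone"
  shows "(\<Prod>k = 1..n. L k) \<in> forms n \<and> pos_lin_prod n (dehom (\<Prod>k = 1..n. L k))"
  using assms
proof (induction n)
  case 0
  then show ?case by (simp add: one_forms dehom_1 pos_lin_prod.one)
next
  case (Suc n)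
  obtain a b where ab: "a > 0" "b > 0" "L (Suc n) \<in> forms 1" "dehom (L (Suc n)) = [:b, a:]"
    using pos_cone_form[of "L (Suc n)"] Suc.prems by auto
  have "(\<Prod>k = 1..Suc n. L k) = L (Suc n) * (\<Prod>k = 1..n. L k)" by (simp add: mult.commute)
  moreover have "(\<Prod>k = 1..n. L k) \<in> forms n" "pos_lin_prod n (dehom (\<Prod>k = 1..n. L k))"
    using Suc by auto
  ultimately show ?case
    using forms_mult[of "L (Suc n)" 1] pos_lin_prod.lin[of n _ a b] ab
    by (simp only: dehom_mult) simp
qed

lemma pos_lin_prod_lift:
  assumes "pos_lin_prod n M"
  shows "\<exists>L. (\<forall>k. L k \<in> pos_cone) \<and> dehom (\<Prod>k = 1..n. L k) = M"
  using assms
proof (induction rule: pos_lin_prod.induct)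
  case one
  have "const 1 * var_x + const 1 * var_y \<in> pos_cone" by (force simp: pos_cone_def)
  then show ?case
    by (intro exI[of _ "\<lambda>_. const 1 * var_x + const 1 * var_y"]) (simp add: dehom_1)
next
  case (lin n M a b)
  then obtain L where L: "\<forall>k. L k \<in> pos_cone" "dehom (\<Prod>k = 1..n. L k) = M" by blast
  let ?l = "const a * var_x + const b * var_y"
  have "(\<Prod>k = 1..Suc n. (L(Suc n := ?l)) k) = ?l * (\<Prod>k = 1..n. L k)"
    by (simp add: mult.commute)
  then have "dehom (\<Prod>k = 1..Suc n. (L(Suc n := ?l)) k) = [:b, a:] * M"
    using L(2) by (simp only: dehom_mult linear_form(2))
  moreover have "?l \<in> pos_cone" using lin by (auto simp: pos_cone_def)
  ultimately show ?case using L(1) by (intro exI[of _ "L(Suc n := ?l)"]) simp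
qed

text \<open>A product of degree d - j + 1 leaves only the j complementary monomials as
  tests.\<close>

lemma annihilates_primitive_iff:
  assumes "j \<le> i" "2 * i \<le> d" "pos_lin_prod (d - 2 * j) M" "degree p \<le> j"
  shows "annihilates d c (Suc (d - 2 * j) + j) ([:b, a:] * M * p) \<longleftrightarrow>
    (\<forall>s<j. Lf d c (monom 1 s * ([:b, a:] * M * p)) = 0)"
proof -
  have "degree ([:b, a:] * M * p) \<le> degree [:b, a:] + degree M + degree p"
    by (meson add_mono degree_mult_le le_trans order_refl)
  moreover have "degree [:b, a:] \<le> 1" by simp
  ultimately have "degree ([:b, a:] * M * p) \<le> Suc (d - 2 * j) + j"
    using pos_lin_prod_degree[OF assms(3)] assms(4) by linarith
  moreover have "s + (Suc (d - 2 * j) + j) \<le> d \<longleftrightarrow> s < j" for s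
    using assms(1,2) by linarith
  ultimately show ?thesis unfolding annihilates_def by simp
qed

lemma mixed_HRR_iff:
  assumes F: "F \<in> forms d" and "2 * i \<le> d"
  shows "mixed_HRR d i F pos_cone \<longleftrightarrow> hodge_riemann d i (norm_coeff d F)"
proof
  let ?c = "norm_coeff d F"
  assume hr: "hodge_riemann d i ?c"
  show "mixed_HRR d i F pos_cone"
    unfolding mixed_HRR_def
  proof (intro allI impI ballI)
    fix L j x
    assume L: "\<forall>k\<le>d. L k \<in> pos_cone" and j: "j \<le> i" and x: "x \<in> A_graded F j"
      and nz: "x \<noteq> \<zero>\<^bsub>A_alg F\<^esub>"
      and prim: "cls F (\<Prod>k = 0..d - 2 * j. L k) \<otimes>\<^bsub>A_alg F\<^esub> x = \<zero>\<^bsub>A_alg F\<^esub>"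
    obtain \<alpha> where \<alpha>: "\<alpha> \<in> forms j" "x = cls F \<alpha>" using x by (auto simp: A_graded_def)
    obtain a b where ab: "a > 0" "b > 0" "L 0 \<in> forms 1" "dehom (L 0) = [:b, a:]"
      using pos_cone_form[of "L 0"] L by auto
    let ?M = "\<Prod>k = 1..d - 2 * j. L k"
    have M: "?M \<in> forms (d - 2 * j)" "pos_lin_prod (d - 2 * j) (dehom ?M)"
      using pos_cone_prod[of "d - 2 * j" L] L by auto
    have split: "(\<Prod>k = 0..d - 2 * j. L k) = L 0 * ?M"
      by (simp add: prod.atLeast_Suc_atMost)
    have "L 0 * ?M * \<alpha> \<in> Ann F"
      using prim unfolding \<alpha>(2) cls_mult cls_eq_zero_iff split .
    moreover have "L 0 * ?M * \<alpha> \<in> forms (Suc (d - 2 * j) + j)"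
      using forms_mult[OF forms_mult[OF ab(3) M(1)] \<alpha>(1)] by simp
    ultimately have "annihilates d ?c (Suc (d - 2 * j) + j) ([:b, a:] * dehom ?M * dehom \<alpha>)"
      using Ann_form_iff[OF F] by (metis ab(4) dehom_mult)
    then have "\<forall>s<j. Lf d ?c (monom 1 s * ([:b, a:] * dehom ?M * dehom \<alpha>)) = 0"
      using annihilates_primitive_iff[OF j assms(2) M(2) degree_dehom[OF \<alpha>(1)]] by blast
    moreover have "\<not> annihilates d ?c j (dehom \<alpha>)"
      using nz unfolding \<alpha>(2) cls_eq_zero_iff Ann_form_iff[OF F \<alpha>(1)] .
    ultimately have pos: "(-1) ^ j * Lf d ?c (dehom ?M * dehom \<alpha> * dehom \<alpha>) > 0"
      using hr j M(2) ab degree_dehom[OF \<alpha>(1)] unfolding hodge_riemann_def by blast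
    have "?M * (\<alpha> * \<alpha>) \<in> forms d"
      using forms_mult[OF M(1) forms_mult[OF \<alpha>(1) \<alpha>(1)]] j assms(2) by simp
    then have "A_integral d F (cls F ?M \<otimes>\<^bsub>A_alg F\<^esub> (x \<otimes>\<^bsub>A_alg F\<^esub> x)) =
        fact d * Lf d ?c (dehom ?M * dehom \<alpha> * dehom \<alpha>)"
      unfolding \<alpha>(2) cls_mult by (simp only: A_integral_cls[OF F] dehom_mult mult.assoc)
    then show "0 < (-1) ^ j * A_integral d F (cls F ?M \<otimes>\<^bsub>A_alg F\<^esub> (x \<otimes>\<^bsub>A_alg F\<^esub> x))"
      using pos by (simp add: mult.left_commute zero_less_mult_iff)
  qed
next
  let ?c = "norm_coeff d F"
  assume hrr: "mixed_HRR d i F pos_cone"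
  show "hodge_riemann d i ?c"
    unfolding hodge_riemann_def
  proof (intro allI impI)
    fix j M a b p
    assume j: "j \<le> i" and M: "pos_lin_prod (d - 2 * j) M" and ab: "(0 :: real) < a" "(0 :: real) < b"
      and p: "degree p \<le> j" "\<not> annihilates d ?c j p"
      and prim: "\<forall>s<j. Lf d ?c (monom 1 s * ([:b, a:] * M * p)) = 0"
    obtain L' where L': "\<forall>k. L' k \<in> pos_cone" "dehom (\<Prod>k = 1..d - 2 * j. L' k) = M"
      using pos_lin_prod_lift[OF M] by blast
    \<comment> \<open>Index 0 is free for the form that defines primitivity, because the product
      representing \<open>M\<close> starts at 1.\<close>
    define L where "L = L'(0 := const a * var_x + const b * var_y)"
    have L: "L k \<in> pos_cone" for k using L'(1) ab by (auto simp: L_def pos_cone_def)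
    have L0: "L 0 \<in> forms 1" "dehom (L 0) = [:b, a:]" unfolding L_def using linear_form by simp_all
    let ?M = "\<Prod>k = 1..d - 2 * j. L k"
    have M_eq: "dehom ?M = M"
      unfolding L'(2)[symmetric] L_def by (intro arg_cong[where f = dehom] prod.cong) auto
    have M_forms: "?M \<in> forms (d - 2 * j)" using pos_cone_prod[of "d - 2 * j" L] L by auto
    define \<alpha> where "\<alpha> = homog j p"
    have \<alpha>: "\<alpha> \<in> forms j" "dehom \<alpha> = p"
      unfolding \<alpha>_def using homog_forms dehom_homog[OF p(1)] by auto
    have split: "(\<Prod>k = 0..d - 2 * j. L k) = L 0 * ?M"
      by (simp add: prod.atLeast_Suc_atMost)
    have "annihilates d ?c (Suc (d - 2 * j) + j) ([:b, a:] * M * p)"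
      using annihilates_primitive_iff[OF j assms(2) M p(1)] prim by blast
    moreover have "L 0 * ?M * \<alpha> \<in> forms (Suc (d - 2 * j) + j)"
      using forms_mult[OF forms_mult[OF L0(1) M_forms] \<alpha>(1)] by simp
    ultimately have "L 0 * ?M * \<alpha> \<in> Ann F"
      using Ann_form_iff[OF F] by (metis L0(2) M_eq \<alpha>(2) dehom_mult)
    then have "cls F (\<Prod>k = 0..d - 2 * j. L k) \<otimes>\<^bsub>A_alg F\<^esub> cls F \<alpha> = \<zero>\<^bsub>A_alg F\<^esub>"
      unfolding cls_mult cls_eq_zero_iff split .
    moreover have "cls F \<alpha> \<noteq> \<zero>\<^bsub>A_alg F\<^esub>"
      unfolding cls_eq_zero_iff Ann_form_iff[OF F \<alpha>(1)] using \<alpha>(2) p(2) by simp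
    moreover have "cls F \<alpha> \<in> A_graded F j" using \<alpha>(1) by (simp add: A_graded_def)
    ultimately have "0 < (-1) ^ j *
        A_integral d F (cls F ?M \<otimes>\<^bsub>A_alg F\<^esub> (cls F \<alpha> \<otimes>\<^bsub>A_alg F\<^esub> cls F \<alpha>))"
      using hrr j L unfolding mixed_HRR_def by blast
    moreover have "?M * (\<alpha> * \<alpha>) \<in> forms d"
      using forms_mult[OF M_forms forms_mult[OF \<alpha>(1) \<alpha>(1)]] j assms(2) by simp
    ultimately have "0 < (-1) ^ j * (fact d * Lf d ?c (M * (p * p)))"
      unfolding cls_mult by (simp only: A_integral_cls[OF F] dehom_mult M_eq \<alpha>(2))
    then show "0 < (-1) ^ j * Lf d ?c (M * p * p)"
      by (simp add: mult.left_commute zero_less_mult_iff mult.assoc)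
  qed
qed

section \<open>Minors over index sets as minors over increasing index functions\<close>

lemma pick_strict_mono_image:
  fixes f :: "nat \<Rightarrow> nat"
  assumes "strict_mono_on {..<n} f" "k < n"
  shows "pick (f ` {..<n}) k = f k"
proof -
  have "{a \<in> f ` {..<n}. a < f k} = f ` {..<k}"
  proof (intro equalityI subsetI)
    fix a assume "a \<in> {a \<in> f ` {..<n}. a < f k}"
    then obtain l where l: "l < n" "a = f l" "f l < f k" by auto
    then have "l < k" using strict_mono_on_less[OF assms(1)] assms(2) by simp
    then show "a \<in> f ` {..<k}" using l by simp
  next
    fix a assume "a \<in> f ` {..<k}"
    then obtain l where l: "l < k" "a = f l" by auto
    then have "f l < f k" using strict_mono_onD[OF assms(1)] assms(2) by simp
    moreover have "l \<in> {..<n}" using l assms(2) by simp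
    ultimately show "a \<in> {a \<in> f ` {..<n}. a < f k}" using l by blast
  qed
  moreover have "inj_on f {..<k}"
    using strict_mono_on_imp_inj_on[OF assms(1)] assms(2) by (auto intro: inj_on_subset)
  ultimately have "card {a \<in> f ` {..<n}. a < f k} = k" by (simp add: card_image)
  then show ?thesis using pick_card_in_set[of "f k" "f ` {..<n}"] assms(2) by simp
qed

lemma det_submatrix:
  assumes "I \<subseteq> {..<r}" "J \<subseteq> {..<s}" "card I = n" "card J = n"
  shows "det (submatrix (mat r s (\<lambda>(p, q). A p q)) I J) = fdet n (\<lambda>p q. A (pick I p) (pick J q))"
proof -
  have "finite I" "finite J" using assms(1,2) finite_subset by blast+
  then have "pick I p \<in> {..<r}" "pick J p \<in> {..<s}" if "p < n" for p
    using pick_in_set_le[of p I] pick_in_set_le[of p J] assms that by auto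
  moreover have "{i. i < r \<and> i \<in> I} = I" "{i. i < s \<and> i \<in> J} = J" using assms by auto
  ultimately show ?thesis
    unfolding submatrix_def fdet_def using assms
    by (intro arg_cong[where f = det] eq_matI) auto
qed

text \<open>Finite index sets and their increasing enumerations correspond: the image of the
  function in one direction, \<open>pick\<close> in the other.\<close>

lemma totally_nonneg_iff:
  "totally_nonneg (mat r s (\<lambda>(p, q). A p q)) \<longleftrightarrow> (\<forall>n f g.
    strict_mono_on {..<n} f \<longrightarrow> (\<forall>k<n. f k < r) \<longrightarrow> strict_mono_on {..<n} g \<longrightarrow> (\<forall>k<n. g k < s) \<longrightarrow>
    fdet n (\<lambda>p q. A (f p) (g q)) \<ge> 0)"
proof (intro iffI allI impI)
  fix n :: nat and f g :: "nat \<Rightarrow> nat"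
  assume tn: "totally_nonneg (mat r s (\<lambda>(p, q). A p q))"
    and f: "strict_mono_on {..<n} f" "\<forall>k<n. f k < r" and g: "strict_mono_on {..<n} g" "\<forall>k<n. g k < s"
  let ?I = "f ` {..<n}" and ?J = "g ` {..<n}"
  have card: "card ?I = n" "card ?J = n"
    using strict_mono_on_imp_inj_on[OF f(1)] strict_mono_on_imp_inj_on[OF g(1)]
    by (simp_all add: card_image)
  have sub: "?I \<subseteq> {..<r}" "?J \<subseteq> {..<s}" using f(2) g(2) by auto
  then have "det (submatrix (mat r s (\<lambda>(p, q). A p q)) ?I ?J) \<ge> 0"
    using tn card unfolding totally_nonneg_def by simp
  also have "det (submatrix (mat r s (\<lambda>(p, q). A p q)) ?I ?J) =
      fdet n (\<lambda>p q. A (pick ?I p) (pick ?J q))"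
    by (rule det_submatrix[OF sub card])
  also have "\<dots> = fdet n (\<lambda>p q. A (f p) (g q))"
    by (rule fdet_cong) (simp add: pick_strict_mono_image[OF f(1)] pick_strict_mono_image[OF g(1)])
  finally show "fdet n (\<lambda>p q. A (f p) (g q)) \<ge> 0" .
next
  assume minors: "\<forall>n f g. strict_mono_on {..<n} f \<longrightarrow> (\<forall>k<n. f k < r) \<longrightarrow>
    strict_mono_on {..<n} g \<longrightarrow> (\<forall>k<n. g k < s) \<longrightarrow> fdet n (\<lambda>p q. A (f p) (g q)) \<ge> 0"
  show "totally_nonneg (mat r s (\<lambda>(p, q). A p q))"
    unfolding totally_nonneg_def
  proof (intro allI impI)
    fix I J
    assume "I \<subseteq> {..<dim_row (mat r s (\<lambda>(p, q). A p q))} \<and>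
      J \<subseteq> {..<dim_col (mat r s (\<lambda>(p, q). A p q))} \<and> card I = card J"
    then have IJ: "I \<subseteq> {..<r}" "J \<subseteq> {..<s}" "card I = card J" by auto
    have mono: "strict_mono_on {..<card S} (pick S)" for S
      using pick_mono_le[of _ S] by (auto simp: strict_mono_on_def)
    have "\<forall>k<card I. pick I k < r" "\<forall>k<card J. pick J k < s"
      using pick_in_set_le[of _ I] pick_in_set_le[of _ J] IJ by auto
    then have "fdet (card I) (\<lambda>p q. A (pick I p) (pick J q)) \<ge> 0"
      using minors mono[of I] mono[of J] IJ(3) by simp
    then show "det (submatrix (mat r s (\<lambda>(p, q). A p q)) I J) \<ge> 0"
      using det_submatrix[OF IJ(1,2) refl] IJ(3) by simp
  qed
qed

lemma strongly_totally_nonneg_iff: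
  "strongly_totally_nonneg d i F \<longleftrightarrow> toeplitz_nonneg d i (norm_coeff d F)"
  unfolding strongly_totally_nonneg_def toeplitz_nonneg_def toeplitz_def totally_nonneg_iff
  by (simp add: less_Suc_eq_le)

section \<open>The Lorentzian condition and its closure in coordinates\<close>

lemma strictly_lorentzian_iff:
  "strictly_lorentzian d i F \<longleftrightarrow> F \<in> forms d \<and> strict_toeplitz d (Suc i) (norm_coeff d F)"
proof (cases "F \<in> forms d")
  case F: True
  have power_x: "var_x ^ m = monom 1 m" for m
    by (simp add: var_x_def monom_altdef)
  have power_y: "var_y ^ n = [:monom 1 n:]" for n
    by (induction n) (simp_all add: var_y_def monom_Suc one_pCons)
  have xy: "var_x ^ m * var_y ^ n = monom (monom 1 n) m" for m n
    unfolding power_x power_y by (simp add: smult_monom)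
  have entry: "const_val (act (var_x ^ m * var_y ^ n) F) = fact d * norm_coeff d F m" if "m + n = d" for m n
  proof -
    have form: "var_x ^ m * var_y ^ n \<in> forms d"
      unfolding xy using that by (auto simp: forms_def coeff_monom split: if_splits)
    have "dehom (var_x ^ m * var_y ^ n) = monom 1 m"
      unfolding xy by (rule poly_eqI) (auto simp: coeff_dehom coeff_monom poly_monom)
    then show ?thesis
      using act_top_form[OF F form] that by (simp add: const_val_def const_def Lf_monom)
  qed
  \<comment> \<open>Each entry carries the factor \<open>fact d\<close>, so the determinants differ
    by the positive factor \<open>fact d ^ Suc j\<close>.\<close>
  have "det (mat (j + 1) (j + 1) (\<lambda>(p, q). const_val (act (var_x ^ (a + j + q - p) * var_y ^ (b + j + p - q)) F))) =
      fact d ^ Suc j * fdet (Suc j) (\<lambda>p q. norm_coeff d F (a + j + q - p))"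
    if "a + b + 2 * j = d" for a b j
  proof -
    have "det (mat (j + 1) (j + 1) (\<lambda>(p, q). const_val (act (var_x ^ (a + j + q - p) * var_y ^ (b + j + p - q)) F))) =
        fdet (Suc j) (\<lambda>p q. const_val (act (var_x ^ (a + j + q - p) * var_y ^ (b + j + p - q)) F))"
      by (simp add: fdet_def)
    also have "\<dots> = fdet (Suc j) (\<lambda>p q. fact d * norm_coeff d F (a + j + q - p))"
      by (rule fdet_cong, rule entry) (use that in linarith)
    finally show ?thesis by (simp only: fdet_scale)
  qed
  then have "strictly_lorentzian d i F \<longleftrightarrow> (\<forall>j\<le>i. \<forall>a b. a + b + 2 * j = d \<longrightarrow>
      fdet (Suc j) (\<lambda>p q. norm_coeff d F (a + j + q - p)) > 0)"
    unfolding strictly_lorentzian_def using F by (simp add: zero_less_mult_iff del: power_Suc)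
  also have "\<dots> \<longleftrightarrow> strict_toeplitz d (Suc i) (norm_coeff d F)"
    unfolding strict_toeplitz_def
  proof (intro iffI allI impI)
    fix j a
    assume H: "\<forall>j\<le>i. \<forall>a b. a + b + 2 * j = d \<longrightarrow>
      0 < fdet (Suc j) (\<lambda>p q. norm_coeff d F (a + j + q - p))" and "j < Suc i" "a + 2 * j \<le> d"
    then have "j \<le> i" "a + (d - 2 * j - a) + 2 * j = d" by auto
    then show "0 < fdet (Suc j) (\<lambda>p q. norm_coeff d F (a + j + q - p))" using H by blast
  qed (simp add: less_Suc_eq_le)
  finally show ?thesis using F by simp
qed (simp add: strictly_lorentzian_def)

lemma strict_toeplitz_cong:
  assumes "\<And>k. k \<le> d \<Longrightarrow> c k = c' k"
  shows "strict_toeplitz d n c \<longleftrightarrow> strict_toeplitz d n c'"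
proof -
  have "fdet (Suc j) (\<lambda>p q. c (a + j + q - p)) = fdet (Suc j) (\<lambda>p q. c' (a + j + q - p))"
    if "a + 2 * j \<le> d" for a j
    by (rule fdet_cong, rule assms) (use that in linarith)
  then show ?thesis by (auto simp: strict_toeplitz_def)
qed

lemma coeff_eq_norm_coeff: "k \<le> d \<Longrightarrow> coeff (coeff F k) (d - k) = real (d choose k) * norm_coeff d F k"
  by (simp add: norm_coeff_def)

lemma norm_coeff_dist_le:
  assumes "k \<le> d"
  shows "\<bar>norm_coeff d G k - norm_coeff d F k\<bar> \<le> form_dist d G F"
proof -
  let ?x = "norm_coeff d G k - norm_coeff d F k"
  \<comment> \<open>Binomial coefficients are at least 1, so passing to normalized coefficients does
    not increase distances.\<close>
  have "1 * \<bar>?x\<bar> \<le> real (d choose k) * \<bar>?x\<bar>"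
    using assms by (intro mult_right_mono) (simp_all add: Suc_leI)
  also have "\<dots> = \<bar>coeff (coeff G k) (d - k) - coeff (coeff F k) (d - k)\<bar>"
    using assms by (simp add: coeff_eq_norm_coeff right_diff_distrib[symmetric] abs_mult)
  also have "\<dots> \<le> L2_set (\<lambda>k. \<bar>coeff (coeff G k) (d - k) - coeff (coeff F k) (d - k)\<bar>) {..d}"
    by (rule member_le_L2_set[where f = "\<lambda>k. \<bar>coeff (coeff G k) (d - k) - coeff (coeff F k) (d - k)\<bar>"])
       (use assms in auto)
  also have "\<dots> = form_dist d G F" by (simp add: form_dist_def L2_set_def)
  finally show ?thesis by simp
qed

lemma lorentzian_iff:
  assumes "F \<in> forms d"
  shows "lorentzian d i F \<longleftrightarrow> toeplitz_limit d i (norm_coeff d F)"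
proof
  assume "lorentzian d i F"
  then obtain G where G: "\<And>n. strictly_lorentzian d i (G n)" "(\<lambda>n. form_dist d (G n) F) \<longlonglongrightarrow> 0"
    unfolding lorentzian_def by blast
  show "toeplitz_limit d i (norm_coeff d F)"
    unfolding toeplitz_limit_def
  proof (intro allI impI)
    fix e :: real assume "e > 0"
    then obtain n where "form_dist d (G n) F < e"
      using order_tendstoD(2)[OF G(2)] eventually_happens'[OF sequentially_bot] by blast
    then have "\<forall>k\<le>d. \<bar>norm_coeff d (G n) k - norm_coeff d F k\<bar> < e"
      using norm_coeff_dist_le le_less_trans by blast
    then show "\<exists>c'. strict_toeplitz d (Suc i) c' \<and> (\<forall>k\<le>d. \<bar>c' k - norm_coeff d F k\<bar> < e)"
      using G(1)[of n] unfolding strictly_lorentzian_iff by blast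
  qed
next
  assume lim: "toeplitz_limit d i (norm_coeff d F)"
  have "\<exists>c'. strict_toeplitz d (Suc i) c' \<and> (\<forall>k\<le>d. \<bar>c' k - norm_coeff d F k\<bar> < 1 / real (Suc n))" for n
    using lim unfolding toeplitz_limit_def by (metis of_nat_0_less_iff zero_less_Suc zero_less_divide_1_iff)
  then obtain C where C: "\<And>n. strict_toeplitz d (Suc i) (C n)"
    "\<And>n k. k \<le> d \<Longrightarrow> \<bar>C n k - norm_coeff d F k\<bar> < 1 / real (Suc n)" by metis
  \<comment> \<open>The form whose normalized coefficients are \<open>C n\<close>.\<close>
  define G where "G n = homog d (\<Sum>k\<le>d. monom (real (d choose k) * C n k) k)" for n
  have coeff_G: "coeff (coeff (G n) k) (d - k) = real (d choose k) * C n k" if "k \<le> d" for n k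
    using that by (simp add: G_def coeff_homog coeff_sum)
  have norm_G: "norm_coeff d (G n) k = C n k" if "k \<le> d" for n k
    using that by (simp add: norm_coeff_def coeff_G)
  have "strictly_lorentzian d i (G n)" for n
  proof -
    have "strict_toeplitz d (Suc i) (norm_coeff d (G n))"
      using strict_toeplitz_cong[of d "norm_coeff d (G n)" "C n"] norm_G C(1) by blast
    then show ?thesis unfolding strictly_lorentzian_iff by (simp add: G_def homog_forms)
  qed
  moreover have "(\<lambda>n. form_dist d (G n) F) \<longlonglongrightarrow> 0"
  proof (rule tendsto_sandwich)
    show "\<forall>\<^sub>F n in sequentially. 0 \<le> form_dist d (G n) F" by (simp add: form_dist_def)
    show "\<forall>\<^sub>F n in sequentially. form_dist d (G n) F \<le> (\<Sum>k\<le>d. real (d choose k)) * (1 / real (Suc n))"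
    proof (rule always_eventually, rule allI)
      fix n
      have "form_dist d (G n) F \<le> (\<Sum>k\<le>d. \<bar>coeff (coeff (G n) k) (d - k) - coeff (coeff F k) (d - k)\<bar>)"
        unfolding form_dist_def by (rule L2_set_le_sum_abs)
      also have "\<dots> \<le> (\<Sum>k\<le>d. real (d choose k) * (1 / real (Suc n)))"
      proof (rule sum_mono)
        fix k assume k: "k \<in> {..d}"
        have "\<bar>coeff (coeff (G n) k) (d - k) - coeff (coeff F k) (d - k)\<bar> =
            real (d choose k) * \<bar>C n k - norm_coeff d F k\<bar>"
          using k by (simp add: norm_G coeff_eq_norm_coeff right_diff_distrib[symmetric] abs_mult)
        also have "\<dots> \<le> real (d choose k) * (1 / real (Suc n))"
          using C(2)[of k n] k by (intro mult_left_mono) (auto intro: less_imp_le)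
        finally show "\<bar>coeff (coeff (G n) k) (d - k) - coeff (coeff F k) (d - k)\<bar> \<le>
            real (d choose k) * (1 / real (Suc n))" .
      qed
      finally show "form_dist d (G n) F \<le> (\<Sum>k\<le>d. real (d choose k)) * (1 / real (Suc n))"
        by (simp only: sum_distrib_right)
    qed
    show "(\<lambda>n. (\<Sum>k\<le>d. real (d choose k)) * (1 / real (Suc n))) \<longlonglongrightarrow> 0"
      by (rule tendsto_mult_right_zero, rule LIMSEQ_Suc[OF lim_1_over_n])
  qed simp
  ultimately show "lorentzian d i F" unfolding lorentzian_def using assms by blast
qed

theorem theorem1p1:
  fixes d i :: nat and F :: bipoly
  assumes "F \<in> forms d" and "i \<le> d div 2"
  shows "(lorentzian d i F \<longleftrightarrow> strongly_totally_nonneg d i F) \<and>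
         (strongly_totally_nonneg d i F \<longleftrightarrow> mixed_HRR d i F pos_cone)"
proof -
  have i: "2 * i \<le> d" using assms(2) by simp
  show ?thesis
    unfolding lorentzian_iff[OF assms(1)] strongly_totally_nonneg_iff mixed_HRR_iff[OF assms(1) i]
    using toeplitz_limit_imp_nonneg[OF _ i] toeplitz_nonneg_imp_hodge_riemann[OF _ i]
      hodge_riemann_imp_toeplitz_limit[OF _ i] by blast
qed

end
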